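(* Let $d,p_1,\ldots,p_d\in\mathbb{N}$, $p=p_1+\cdots+p_d$, and $\alpha\in(p-1,\infty)$. Let $\Sigma\in\mathcal{S}_{++}^p$ be written in block form $\Sigma=(\Sigma_{ij})_{1\le i,j\le d}$ with $\Sigma_{ij}$ of size $p_i\times p_j$. For each $i\in\{1,\ldots,d\}$ let $\phi_i:\mathcal{S}_{++}^{p_i}\to[0,\infty)$ be a matrix-variate completely monotone function. Let $M$ be the unique block lower triangular $p\times p$ matrix (blocks $M_{ij}$ of size $p_i\times p_j$) with $\Sigma=MM^\top$ and each diagonal block $M_{ii}$ positive definite. Let $\mathfrak{X}\sim\mathcal{W}_p(\alpha,\Sigma)$ be partitioned conformally with $\Sigma$, and let $k\in\{2,\ldots,d\}$. Then there exists a product measure $\mu_1\times\cdots\times\mu_d$ on $\mathcal{S}_+^{p_1}\times\cdots\times\mathcal{S}_+^{p_d}$ such that \[\mathbb{E}\Big\{\prod_{i=1}^{k-1}\phi_i(\mathfrak{X}_{ii})\Big\}\,\mathbb{E}\Big\{\prod_{i=k}^d\phi_i(\mathfrak{X}_{ii})\Big\}\le\mathbb{E}\Big\{\prod_{i=1}^d\phi_i(\mathfrak{X}_{ii})\Big\}\le\prod_{i=1}^d\int_{\mathcal{S}_+^{p_i}}\frac{2^{p_i\alpha/2}\,\mu_i(\mathrm{d}T_{ii})}{|I_{p_i}+\sqrt{2}\,T_{ii}^{1/2}M_{ii}|^{\alpha}},\] provided that the expectations and integrals are finite.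
   Context: $\mathcal{S}_+^q$, $\mathcal{S}_{++}^q$: symmetric nonnegative definite / positive definite real $q\times q$ matrices; $\mathrm{etr}(\cdot)=\exp\{\mathrm{tr}(\cdot)\}$; $|\cdot|$ is the determinant; $T^{1/2}$ is the symmetric nonnegative definite square root. The multivariate gamma function is $\Gamma_p(\nu)=\pi^{p(p-1)/4}\prod_{i=1}^p\Gamma\{\nu-(i-1)/2\}$ for $\nu>(p-1)/2$. For $\alpha\in(p-1,\infty)$ and $\Sigma\in\mathcal{S}_{++}^p$, $\mathfrak{X}\sim\mathcal{W}_p(\alpha,\Sigma)$ (Wishart) means $\mathfrak{X}$ has density $f_{\alpha,\Sigma}(X)=|X|^{\alpha/2-(p+1)/2}\mathrm{etr}(-\Sigma^{-1}X/2)/\{2^{p\alpha/2}|\Sigma|^{\alpha/2}\Gamma_p(\alpha/2)\}$ on $\mathcal{S}_{++}^p$ with respect to Lebesgue measure; "partitioned conformally" means $\mathfrak{X}=(\mathfrak{X}_{ij})$ with $\mathfrak{X}_{ij}$ of size $p_i\times p_j$. A map $\phi:\mathcal{S}_{++}^q\to[0,\infty)$ is matrix-variate completely monotone if there is a measure $\mu$ on $\mathcal{S}_+^q$ with $\phi(T)=\int_{\mathcal{S}_+^q}\mathrm{etr}(-TX)\,\mu(\mathrm{d}X)$ for all $T\in\mathcal{S}_{++}^q$. *)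

theory Defs
  imports "HOL-Probability.Probability" "Jordan_Normal_Form.Determinant"
begin

definition mtrace :: "real mat \<Rightarrow> real" where
  "mtrace A = (\<Sum>i<dim_row A. A $$ (i, i))"

definition pd_mat :: "nat \<Rightarrow> real mat \<Rightarrow> bool" where
  "pd_mat n A \<longleftrightarrow> A \<in> carrier_mat n n \<and> transpose_mat A = A \<and>
     (\<forall>v \<in> carrier_vec n. v \<noteq> 0\<^sub>v n \<longrightarrow> 0 < v \<bullet> (A *\<^sub>v v))"

definition psd_mat :: "nat \<Rightarrow> real mat \<Rightarrow> bool" where
  "psd_mat n A \<longleftrightarrow> A \<in> carrier_mat n n \<and> transpose_mat A = A \<and>
     (\<forall>v \<in> carrier_vec n. 0 \<le> v \<bullet> (A *\<^sub>v v))"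

definition msqrt :: "nat \<Rightarrow> real mat \<Rightarrow> real mat" where
  "msqrt n T = (THE S. psd_mat n S \<and> S * S = T)"

definition minv :: "nat \<Rightarrow> real mat \<Rightarrow> real mat" where
  "minv n A = (THE B. B \<in> carrier_mat n n \<and> A * B = 1\<^sub>m n)"

text \<open>A symmetric \<open>n \<times> n\<close> matrix is coordinatised by its entries \<open>(i,j)\<close> with \<open>i \<le> j < n\<close>.\<close>
definition sym_idx :: "nat \<Rightarrow> (nat \<times> nat) set" where
  "sym_idx n = {(i, j). i \<le> j \<and> j < n}"

definition sym_of :: "nat \<Rightarrow> (nat \<times> nat \<Rightarrow> real) \<Rightarrow> real mat" where
  "sym_of n f = Matrix.mat n n (\<lambda>(i, j). f (min i j, max i j))"

definition sym_lebesgue :: "nat \<Rightarrow> (nat \<times> nat \<Rightarrow> real) measure" where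
  "sym_lebesgue n = PiM (sym_idx n) (\<lambda>_. lborel)"

definition sym_space :: "nat \<Rightarrow> (nat \<times> nat \<Rightarrow> real) measure" where
  "sym_space n = PiM (sym_idx n) (\<lambda>_. borel)"

definition multigamma :: "nat \<Rightarrow> real \<Rightarrow> real" where
  "multigamma p \<nu> = pi powr (real p * (real p - 1) / 4) *
     (\<Prod>i\<in>{1..p}. Gamma (\<nu> - (real i - 1) / 2))"

definition wishart_dens :: "nat \<Rightarrow> real \<Rightarrow> real mat \<Rightarrow> real mat \<Rightarrow> real" where
  "wishart_dens p \<alpha> \<Sigma> X =
     det X powr (\<alpha> / 2 - (real p + 1) / 2) * exp (- mtrace (minv p \<Sigma> * X) / 2) /
     (2 powr (real p * \<alpha> / 2) * det \<Sigma> powr (\<alpha> / 2) * multigamma p (\<alpha> / 2))"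

definition wishart_expect ::
  "nat \<Rightarrow> real \<Rightarrow> real mat \<Rightarrow> (real mat \<Rightarrow> ennreal) \<Rightarrow> ennreal" where
  "wishart_expect p \<alpha> \<Sigma> g =
     (\<integral>\<^sup>+ f. (if pd_mat p (sym_of p f)
               then ennreal (wishart_dens p \<alpha> \<Sigma> (sym_of p f)) * g (sym_of p f) else 0)
        \<partial>sym_lebesgue p)"

definition cm_rep :: "nat \<Rightarrow> (real mat \<Rightarrow> real) \<Rightarrow> (nat \<times> nat \<Rightarrow> real) measure \<Rightarrow> bool" where
  "cm_rep q \<phi> \<mu> \<longleftrightarrow> sets \<mu> = sets (sym_space q) \<and>
     (AE X in \<mu>. psd_mat q (sym_of q X)) \<and>
     (\<forall>T. pd_mat q T \<longrightarrow>
        ennreal (\<phi> T) = (\<integral>\<^sup>+ X. ennreal (exp (- mtrace (T * sym_of q X))) \<partial>\<mu>))"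

definition matrix_cm :: "nat \<Rightarrow> (real mat \<Rightarrow> real) \<Rightarrow> bool" where
  "matrix_cm q \<phi> \<longleftrightarrow> (\<forall>T. pd_mat q T \<longrightarrow> 0 \<le> \<phi> T) \<and> (\<exists>\<mu>. cm_rep q \<phi> \<mu>)"

text \<open>Blocks are indexed by \<open>1..d\<close>; block \<open>i\<close> has size \<open>ps i\<close> and starts at offset \<open>blk_off ps i\<close>.\<close>
definition blk_off :: "(nat \<Rightarrow> nat) \<Rightarrow> nat \<Rightarrow> nat" where
  "blk_off ps i = (\<Sum>j\<in>{1..<i}. ps j)"

definition blk :: "(nat \<Rightarrow> nat) \<Rightarrow> real mat \<Rightarrow> nat \<Rightarrow> nat \<Rightarrow> real mat" where
  "blk ps A i j = Matrix.mat (ps i) (ps j) (\<lambda>(a, b). A $$ (blk_off ps i + a, blk_off ps j + b))"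

end

theory Submission
  imports Defs "Jordan_Normal_Form.Spectral_Radius"
begin

unbundle no vec_syntax
unbundle no inner_syntax

text \<open>
  Writing each \<open>\<phi>\<^sub>i\<close> as a Laplace transform and exchanging integrals, the expectation of
  \<open>\<Prod>i\<in>J. \<phi>\<^sub>i (X\<^sub>i\<^sub>i)\<close> becomes the integral of \<open>det (I + 2 T \<Sigma>) powr (-\<alpha>/2)\<close> against the product of
  the representing measures, where \<open>T\<close> is block diagonal with zero blocks outside \<open>J\<close>.
  With \<open>S\<close> the square root of \<open>T\<close>, the lower bound is Fischer's inequality for \<open>I + 2 S \<Sigma> S\<close>.
  For the upper bound put \<open>N = sqrt 2 S M\<close>: then \<open>(I + N)(I + N)\<^sup>T \<le> 2 (I + N N\<^sup>T)\<close> in the Loewner order,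
  so \<open>det (I + N)\<^sup>2 \<le> 2 ^ p det (I + 2 T \<Sigma>)\<close>, and \<open>det (I + N)\<close> factors over the diagonal blocks
  because \<open>N\<close> is block lower triangular.  Fischer's inequality and the monotonicity of the determinant
  are both read off from the Gaussian integral \<open>\<integral> exp (- y\<^sup>T Q y) dy = sqrt (\<pi> ^ n / det Q)\<close>.
\<close>

section \<open>Pivoting on the last index\<close>

text \<open>One recursion carries the analytic part: splitting off the last index of a symmetric
  matrix by its Schur complement governs positive definiteness, determinants, Gaussian integrals and
  the matrix gamma integral alike. The last of these yields E etr(-T X) = det (I + 2 T \<Sigma>)
  powr (-\<alpha>/2) for nonnegative definite T, on which the exchange of integrals rests. The
  product T \<Sigma> is linear in T, hence plainly measurable, but it is not symmetric; the
  inequalities are proved for I + 2 S \<Sigma> S, and Sylvester's determinant identity moves between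
  the two. Two obstacles shape the measure theory. The \<mu>_i may be infinite, so sigma-finiteness
  is extracted from the finiteness of \<phi>_i (I) before Fubini. And the right-hand integrand
  contains the square root of T, whose measurability is never shown: the upper bound is derived for
  lower integrals, with only the determinant side measurable. The constant 2^(p_i \<alpha>/2) is the
  share of block i in (2^p)^(\<alpha>/2), where 2^p comes from (a + b)^2 \<le> 2 (a^2 + b^2) applied
  in each of p coordinates.\<close>

text \<open>Vectors are plain functions read only below \<open>n\<close>, so that points of a
  product measure space can be inserted without any carrier condition.\<close>

definition qform :: "nat \<Rightarrow> real mat \<Rightarrow> (nat \<Rightarrow> real) \<Rightarrow> real" where
  "qform n A v = (\<Sum>i<n. \<Sum>j<n. A $$ (i, j) * v i * v j)"

text \<open>Eliminates the last index of a matrix of size \<open>Suc n\<close>. The last row is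
  written as \<open>A $$ (j, n)\<close>, which is the usual formula for symmetric
  \<open>A\<close>.\<close>

definition schur_compl :: "nat \<Rightarrow> real mat \<Rightarrow> real mat" where
  "schur_compl n A = mat n n (\<lambda>(i, j). A $$ (i, j) - A $$ (i, n) * A $$ (j, n) / A $$ (n, n))"

lemma schur_compl_carrier[simp]: "schur_compl n A \<in> carrier_mat n n"
  by (simp add: schur_compl_def)

lemma scalar_prod_mult_mat_vec_eq_qform:
  assumes "A \<in> carrier_mat n n" "v \<in> carrier_vec n"
  shows "v \<bullet> (A *\<^sub>v v) = qform n A (vec_index v)"
  using assms
  by (auto simp: qform_def scalar_prod_def sum_distrib_left lessThan_atLeast0 algebra_simps
      intro!: sum.cong)

lemma qform_cong: "(\<And>i. i < n \<Longrightarrow> v i = w i) \<Longrightarrow> qform n A v = qform n A w"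
  by (auto simp: qform_def intro!: sum.cong)

lemma pd_mat_iff_qform:
  "pd_mat n A \<longleftrightarrow> A \<in> carrier_mat n n \<and> transpose_mat A = A \<and>
     (\<forall>v. (\<exists>i<n. v i \<noteq> 0) \<longrightarrow> 0 < qform n A v)"
proof -
  have "(\<forall>v \<in> carrier_vec n. v \<noteq> 0\<^sub>v n \<longrightarrow> 0 < v \<bullet> (A *\<^sub>v v)) \<longleftrightarrow>
     (\<forall>v. (\<exists>i<n. v i \<noteq> 0) \<longrightarrow> 0 < qform n A v)" (is "?L \<longleftrightarrow> ?R") if A: "A \<in> carrier_mat n n"
  proof
    assume L: ?L
    show ?R
    proof (intro allI impI)
      fix v :: "nat \<Rightarrow> real" assume v: "\<exists>i<n. v i \<noteq> 0"
      have c: "vec n v \<in> carrier_vec n" by simp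
      moreover have "vec n v \<noteq> 0\<^sub>v n" using v by (metis index_vec index_zero_vec(1))
      ultimately have "0 < qform n A (vec_index (vec n v))"
        using L scalar_prod_mult_mat_vec_eq_qform[OF A c] by metis
      then show "0 < qform n A v" by (simp add: qform_cong[of n "vec_index (vec n v)" v])
    qed
  next
    assume R: ?R
    show ?L
    proof (intro ballI impI)
      fix v :: "real vec" assume v: "v \<in> carrier_vec n" "v \<noteq> 0\<^sub>v n"
      then have "\<exists>i<n. v $ i \<noteq> 0" by (metis carrier_vecD eq_vecI index_zero_vec)
      then show "0 < v \<bullet> (A *\<^sub>v v)" using R scalar_prod_mult_mat_vec_eq_qform[OF A v(1)] by auto
    qed
  qed
  then show ?thesis by (auto simp: pd_mat_def)
qed

lemma psd_mat_iff_qform: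
  "psd_mat n A \<longleftrightarrow> A \<in> carrier_mat n n \<and> transpose_mat A = A \<and> (\<forall>v. 0 \<le> qform n A v)"
proof -
  have "(\<forall>v \<in> carrier_vec n. 0 \<le> v \<bullet> (A *\<^sub>v v)) \<longleftrightarrow> (\<forall>v. 0 \<le> qform n A v)" (is "?L \<longleftrightarrow> ?R")
    if A: "A \<in> carrier_mat n n"
  proof
    assume L: ?L
    show ?R
    proof
      fix v :: "nat \<Rightarrow> real"
      have c: "vec n v \<in> carrier_vec n" by simp
      have "0 \<le> qform n A (vec_index (vec n v))"
        using L c scalar_prod_mult_mat_vec_eq_qform[OF A c] by metis
      then show "0 \<le> qform n A v" by (simp add: qform_cong[of n "vec_index (vec n v)" v])
    qed
  next
    assume ?R then show ?L by (simp add: scalar_prod_mult_mat_vec_eq_qform[OF A])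
  qed
  then show ?thesis by (auto simp: psd_mat_def)
qed

lemma symmetric_mat_index:
  assumes "A \<in> carrier_mat n n" "transpose_mat A = A" "i < n" "j < n"
  shows "A $$ (j, i) = A $$ (i, j)"
  using assms by (metis carrier_matD index_transpose_mat(1))

lemma symmetric_matI:
  assumes "A \<in> carrier_mat n n" "\<And>i j. i < n \<Longrightarrow> j < n \<Longrightarrow> A $$ (j, i) = A $$ (i, j)"
  shows "transpose_mat A = A"
  using assms by (intro eq_matI) auto

lemma qform_Suc:
  assumes A: "A \<in> carrier_mat (Suc n) (Suc n)" "transpose_mat A = A"
  shows "qform (Suc n) A v =
    qform n A v + 2 * v n * (\<Sum>i<n. A $$ (i, n) * v i) + A $$ (n, n) * (v n)\<^sup>2"
proof -
  have "(\<Sum>j<n. A $$ (n, j) * v n * v j) = v n * (\<Sum>i<n. A $$ (i, n) * v i)"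
    using symmetric_mat_index[OF A, of _ n] by (auto simp: sum_distrib_left intro!: sum.cong)
  moreover have "(\<Sum>j<n. A $$ (j, n) * v j * v n) = v n * (\<Sum>i<n. A $$ (i, n) * v i)"
    by (auto simp: sum_distrib_left intro!: sum.cong)
  ultimately show ?thesis
    by (simp add: qform_def sum.distrib power2_eq_square algebra_simps)
qed

lemma qform_schur_compl:
  "qform n (schur_compl n A) v = qform n A v - (\<Sum>i<n. A $$ (i, n) * v i)\<^sup>2 / A $$ (n, n)"
proof -
  have "qform n (schur_compl n A) v = qform n A v -
      (\<Sum>i<n. \<Sum>j<n. (A $$ (i, n) * v i) * (A $$ (j, n) * v j)) / A $$ (n, n)"
    by (simp add: qform_def schur_compl_def sum_subtractf sum_divide_distrib algebra_simps
        flip: sum_subtractf)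
  then show ?thesis by (simp add: power2_eq_square sum_product)
qed

text \<open>Completing the square in the last variable; the remainder is a form in the first
  \<open>n\<close> variables only.\<close>

lemma qform_pivot:
  assumes A: "A \<in> carrier_mat (Suc n) (Suc n)" "transpose_mat A = A" and "A $$ (n, n) \<noteq> 0"
  shows "qform (Suc n) A v = qform n (schur_compl n A) v +
    A $$ (n, n) * (v n + (\<Sum>i<n. A $$ (i, n) * v i) / A $$ (n, n))\<^sup>2"
  using assms(3) unfolding qform_Suc[OF A] qform_schur_compl
  by (simp add: power2_eq_square field_simps)

lemma transpose_schur_compl:
  assumes A: "A \<in> carrier_mat (Suc n) (Suc n)" "transpose_mat A = A"
  shows "transpose_mat (schur_compl n A) = schur_compl n A"
  using symmetric_mat_index[OF A] by (intro symmetric_matI[of _ n]) (auto simp: schur_compl_def)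

lemma pd_mat_Suc_iff:
  assumes A: "A \<in> carrier_mat (Suc n) (Suc n)" "transpose_mat A = A"
  shows "pd_mat (Suc n) A \<longleftrightarrow> 0 < A $$ (n, n) \<and> pd_mat n (schur_compl n A)"
proof
  assume pd: "pd_mat (Suc n) A"
  then have pos: "0 < qform (Suc n) A v" if "\<exists>i<Suc n. v i \<noteq> 0" for v
    using that by (simp add: pd_mat_iff_qform)
  have "0 < qform (Suc n) A (\<lambda>i. if i = n then 1 else 0)" by (rule pos) auto
  then have nn: "0 < A $$ (n, n)"
    by (subst (asm) qform_Suc[OF A]) (simp add: qform_def)
  have "0 < qform n (schur_compl n A) v" if v: "\<exists>i<n. v i \<noteq> 0" for v
  proof -
    \<comment> \<open>The last coordinate is chosen so that the square in \<open>qform_pivot\<close>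
      vanishes, leaving exactly the form of the Schur complement.\<close>
    define w where "w = v(n := - (\<Sum>i<n. A $$ (i, n) * v i) / A $$ (n, n))"
    have "\<exists>i<Suc n. w i \<noteq> 0" using v by (auto simp: w_def intro: less_SucI)
    then have "0 < qform (Suc n) A w" by (rule pos)
    moreover have "(\<Sum>i<n. A $$ (i, n) * w i) = (\<Sum>i<n. A $$ (i, n) * v i)"
      by (auto simp: w_def intro!: sum.cong)
    moreover have "qform n (schur_compl n A) w = qform n (schur_compl n A) v"
      by (rule qform_cong) (simp add: w_def)
    ultimately show ?thesis using nn by (simp add: qform_pivot[OF A] w_def)
  qed
  then show "0 < A $$ (n, n) \<and> pd_mat n (schur_compl n A)"
    using nn transpose_schur_compl[OF A] by (simp add: pd_mat_iff_qform)
next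
  assume H: "0 < A $$ (n, n) \<and> pd_mat n (schur_compl n A)"
  have "0 < qform (Suc n) A v" if v: "\<exists>i<Suc n. v i \<noteq> 0" for v
  proof (cases "\<exists>i<n. v i \<noteq> 0")
    case True
    then have "0 < qform n (schur_compl n A) v" using H by (simp add: pd_mat_iff_qform)
    then show ?thesis using H by (simp add: qform_pivot[OF A] add_pos_nonneg)
  next
    case False
    then have "v n \<noteq> 0" using v less_Suc_eq by auto
    moreover have "qform n A v = 0" "(\<Sum>i<n. A $$ (i, n) * v i) = 0"
      using False by (auto simp: qform_def)
    ultimately show ?thesis using H by (simp add: qform_Suc[OF A])
  qed
  then show "pd_mat (Suc n) A" using A by (simp add: pd_mat_iff_qform)
qed

section \<open>Determinants by elimination, and inverses\<close>

lemma index_mult_mat_sum: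
  assumes "A \<in> carrier_mat n m" "B \<in> carrier_mat m l" "i < n" "j < l"
  shows "(A * B) $$ (i, j) = (\<Sum>k<m. A $$ (i, k) * B $$ (k, j))"
  using assms by (simp add: scalar_prod_def lessThan_atLeast0)

lemma det_pivot:
  assumes A: "A \<in> carrier_mat (Suc n) (Suc n)" "transpose_mat A = A" and nz: "A $$ (n, n) \<noteq> 0"
  shows "det A = A $$ (n, n) * det (schur_compl n A)"
proof -
  \<comment> \<open>Right multiplication by \<open>E\<close> subtracts multiples of the last column
    from the others, chosen to clear the last row to the left of the pivot.\<close>
  define E where "E = mat (Suc n) (Suc n)
    (\<lambda>(k, j). if k = j then 1 else if k = n then - A $$ (n, j) / A $$ (n, n) else 0)"
  have E: "E \<in> carrier_mat (Suc n) (Suc n)" by (simp add: E_def)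
  define B where "B = four_block_mat (schur_compl n A) (mat n 1 (\<lambda>(i, _). A $$ (i, n))) (0\<^sub>m 1 n)
    (mat 1 1 (\<lambda>_. A $$ (n, n)))"
  have "A * E = B"
  proof (rule eq_matI)
    fix i j assume ij: "i < dim_row B" "j < dim_col B"
    then have ij: "i < Suc n" "j < Suc n" by (simp_all add: B_def schur_compl_def)
    have "(A * E) $$ (i, j) = (\<Sum>k<Suc n. A $$ (i, k) * E $$ (k, j))"
      by (rule index_mult_mat_sum[OF A(1) E ij])
    also have "\<dots> = (\<Sum>k<n. (if k = j then A $$ (i, k) else 0)) + A $$ (i, n) * E $$ (n, j)"
      unfolding sum.lessThan_Suc using ij
      by (intro arg_cong2[where f = "(+)"] sum.cong) (auto simp: E_def)
    also have "\<dots> = B $$ (i, j)"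
      using ij nz symmetric_mat_index[OF A, of n j]
      by (auto simp: E_def B_def schur_compl_def less_Suc_eq)
    finally show "(A * E) $$ (i, j) = B $$ (i, j)" .
  qed (use A E in \<open>auto simp: B_def schur_compl_def\<close>)
  moreover have "det E = 1"
  proof -
    have "det E = prod_list (diag_mat E)"
      by (rule det_lower_triangular[OF _ E]) (auto simp: E_def)
    also have "diag_mat E = map (\<lambda>_. 1) [0..<Suc n]"
      unfolding diag_mat_def by (auto simp: E_def)
    finally show ?thesis by (simp add: map_replicate_const)
  qed
  moreover have "det B = det (schur_compl n A) * A $$ (n, n)"
    unfolding B_def by (subst det_four_block_mat_lower_left_zero[of _ n _ 1]) (auto simp: det_single)
  ultimately show ?thesis using det_mult[OF A(1) E] by (simp add: mult.commute)
qed

text \<open>Here the leading block is eliminated instead of the last entry: \<open>w\<close> solves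
  the linear system whose right-hand side is the last column, and the scalar factor is the Schur
  complement of the leading block. The gamma integral needs this form for its rate matrix, while the
  variable matrix is pivoted on its corner.\<close>

lemma det_bordered:
  assumes A: "A \<in> carrier_mat (Suc n) (Suc n)" "transpose_mat A = A"
    and w: "\<And>i. i < n \<Longrightarrow> (\<Sum>j<n. A $$ (i, j) * w j) = A $$ (i, n)"
  shows "det A = det (mat n n (\<lambda>(i, j). A $$ (i, j))) * (A $$ (n, n) - qform n A w)"
proof -
  define E where "E = mat (Suc n) (Suc n)
    (\<lambda>(k, j). if k = j then 1 else if j = n then - w k else 0)"
  have E: "E \<in> carrier_mat (Suc n) (Suc n)" by (simp add: E_def)
  define B where "B = four_block_mat (mat n n (\<lambda>(i, j). A $$ (i, j))) (0\<^sub>m n 1)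
    (mat 1 n (\<lambda>(_, j). A $$ (n, j))) (mat 1 1 (\<lambda>_. A $$ (n, n) - qform n A w))"
  have q: "qform n A w = (\<Sum>k<n. A $$ (n, k) * w k)"
  proof -
    have "qform n A w = (\<Sum>i<n. w i * (\<Sum>j<n. A $$ (i, j) * w j))"
      by (simp add: qform_def sum_distrib_left algebra_simps)
    then show ?thesis using w symmetric_mat_index[OF A, of n] by (simp add: algebra_simps)
  qed
  have "A * E = B"
  proof (rule eq_matI)
    fix i j assume ij: "i < dim_row B" "j < dim_col B"
    then have ij: "i < Suc n" "j < Suc n" by (simp_all add: B_def)
    have 1: "(A * E) $$ (i, j) = (\<Sum>k<Suc n. A $$ (i, k) * E $$ (k, j))"
      by (rule index_mult_mat_sum[OF A(1) E ij])
    show "(A * E) $$ (i, j) = B $$ (i, j)"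
    proof (cases "j = n")
      case True
      have "(\<Sum>k<n. A $$ (i, k) * E $$ (k, j)) = - (\<Sum>k<n. A $$ (i, k) * w k)"
        unfolding sum_negf[symmetric] using ij True by (intro sum.cong) (auto simp: E_def)
      then show ?thesis using True ij w[of i] q unfolding 1
        by (auto simp: E_def B_def less_Suc_eq)
    next
      case False
      have "(\<Sum>k<Suc n. A $$ (i, k) * E $$ (k, j)) = (\<Sum>k<Suc n. if k = j then A $$ (i, k) else 0)"
        using ij False by (intro sum.cong) (auto simp: E_def)
      then show ?thesis using False ij unfolding 1
        by (auto simp: E_def B_def less_Suc_eq simp del: sum.lessThan_Suc)
    qed
  qed (use A E in \<open>auto simp: B_def\<close>)
  moreover have "det E = 1"
  proof -
    have "det E = prod_list (diag_mat E)"
      by (rule det_upper_triangular[OF _ E]) (auto simp: E_def)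
    also have "diag_mat E = map (\<lambda>_. 1) [0..<Suc n]"
      unfolding diag_mat_def by (auto simp: E_def)
    finally show ?thesis by (simp add: map_replicate_const)
  qed
  moreover have "det B = det (mat n n (\<lambda>(i, j). A $$ (i, j))) * (A $$ (n, n) - qform n A w)"
    unfolding B_def by (subst det_four_block_mat_upper_right_zero[of _ n _ 1]) (auto simp: det_single)
  ultimately show ?thesis using det_mult[OF A(1) E] by simp
qed

lemma pd_mat_det_pos: "pd_mat n A \<Longrightarrow> 0 < det A"
proof (induction n arbitrary: A)
  case 0
  then show ?case by (simp add: pd_mat_def det_dim_zero)
next
  case (Suc n)
  then have A: "A \<in> carrier_mat (Suc n) (Suc n)" "transpose_mat A = A" by (auto simp: pd_mat_def)
  have "0 < A $$ (n, n)" "0 < det (schur_compl n A)"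
    using Suc pd_mat_Suc_iff[OF A] by blast+
  then show ?case by (simp add: det_pivot[OF A])
qed

lemma pd_mat_minv:
  assumes "pd_mat n A"
  shows "minv n A \<in> carrier_mat n n" "A * minv n A = 1\<^sub>m n" "minv n A * A = 1\<^sub>m n"
proof -
  have A: "A \<in> carrier_mat n n" using assms by (simp add: pd_mat_def)
  have "A \<in> Units (ring_mat TYPE(real) n ())"
    using det_non_zero_imp_unit[OF A] pd_mat_det_pos[OF assms] by simp
  then obtain B where B: "B \<in> carrier_mat n n" "A * B = 1\<^sub>m n" "B * A = 1\<^sub>m n"
    by (auto simp: Units_def ring_mat_def)
  have "C = B" if "C \<in> carrier_mat n n" "A * C = 1\<^sub>m n" for C
  proof -
    have "C = (B * A) * C" using that(1) B(3) by simp
    also have "\<dots> = B * (A * C)" by (rule assoc_mult_mat[OF B(1) A that(1)])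
    also have "\<dots> = B" using that(2) B(1) by simp
    finally show ?thesis .
  qed
  then have "minv n A = B" unfolding minv_def using B by (intro the_equality) blast+
  with B show "minv n A \<in> carrier_mat n n" "A * minv n A = 1\<^sub>m n" "minv n A * A = 1\<^sub>m n" by auto
qed

lemma mtrace_mult:
  assumes "A \<in> carrier_mat n m" "B \<in> carrier_mat m n"
  shows "mtrace (A * B) = (\<Sum>i<n. \<Sum>j<m. A $$ (i, j) * B $$ (j, i))"
  using assms by (simp add: mtrace_def scalar_prod_def lessThan_atLeast0)

section \<open>Gaussian and multivariate gamma integrals\<close>

lemma product_sigma_finite_lborel: "product_sigma_finite (\<lambda>_. lborel :: real measure)"
  by standard

lemma measurable_component_lborel:
  "i \<in> I \<Longrightarrow> (\<lambda>x. x i) \<in> borel_measurable (PiM I (\<lambda>_. lborel :: real measure))"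
  using measurable_component_singleton[of i I "\<lambda>_. lborel :: real measure"] by simp

lemma nn_integral_gaussian:
  fixes a c :: real assumes a: "0 < a"
  shows "(\<integral>\<^sup>+x. ennreal (exp (- (a * (x + c)\<^sup>2))) \<partial>lborel) = ennreal (sqrt (pi / a))"
proof -
  \<comment> \<open>The standard deviation for which the normal density is proportional to exp (- a
    (x + c)^2).\<close>
  define \<sigma> where "\<sigma> = sqrt (1 / (2 * a))"
  have s: "0 < \<sigma>" "\<sigma>\<^sup>2 = 1 / (2 * a)" using a by (simp_all add: \<sigma>_def)
  have "exp (- (a * (x + c)\<^sup>2)) = sqrt (pi / a) * normal_density (- c) \<sigma> x" for x
    using a by (simp add: normal_density_def s(2) real_sqrt_divide)
  moreover have "(\<integral>\<^sup>+x. ennreal (normal_density (- c) \<sigma> x) \<partial>lborel) = 1"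
    using s by (subst nn_integral_eq_integral) auto
  ultimately show ?thesis using a by (simp add: ennreal_mult' nn_integral_cmult)
qed

lemma borel_measurable_qform:
  assumes "\<And>i. i < n \<Longrightarrow> (\<lambda>x. v x i) \<in> borel_measurable M"
  shows "(\<lambda>x. qform n Q (v x)) \<in> borel_measurable M"
  unfolding qform_def using assms by (intro borel_measurable_sum borel_measurable_times) auto

text \<open>Integrating the last variable leaves the form of \<open>schur_compl n Q\<close>, and
  \<open>det_pivot\<close> splits the determinant in the same way. The map \<open>h\<close> lets the
  variables sit on any coordinates of a product space: \<open>id\<close> for the determinant
  inequalities, the pairs \<open>(i, n)\<close> of a last column for the gamma integral.\<close>

lemma nn_integral_gaussian_qform:
  fixes h :: "nat \<Rightarrow> 'i"
  assumes "inj_on h {..<n}" "pd_mat n Q"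
  shows "(\<integral>\<^sup>+y. ennreal (exp (- qform n Q (\<lambda>i. y (h i)))) \<partial>PiM (h ` {..<n}) (\<lambda>_. lborel)) =
    ennreal (sqrt (pi ^ n / det Q))"
  using assms
proof (induction n arbitrary: Q)
  case 0
  interpret product_sigma_finite "\<lambda>_::'i. lborel :: real measure" by (rule product_sigma_finite_lborel)
  show ?case using 0 by (simp add: PiM_empty qform_def det_dim_zero pd_mat_def)
next
  case (Suc n)
  interpret product_sigma_finite "\<lambda>_::'i. lborel :: real measure" by (rule product_sigma_finite_lborel)
  from Suc.prems have Q: "Q \<in> carrier_mat (Suc n) (Suc n)" "transpose_mat Q = Q"
    by (auto simp: pd_mat_def)
  have pd: "0 < Q $$ (n, n)" "pd_mat n (schur_compl n Q)" using Suc.prems pd_mat_Suc_iff[OF Q] by auto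
  have hn: "h n \<notin> h ` {..<n}" "inj_on h {..<n}"
    using Suc.prems(1) by (auto simp: lessThan_Suc)
  have hi: "h i \<noteq> h n" if "i < n" for i using hn(1) that by (metis imageI lessThan_iff)
  have ins: "h ` {..<Suc n} = insert (h n) (h ` {..<n})" by (auto simp: lessThan_Suc)
  have m: "(\<lambda>y. ennreal (exp (- qform k B (\<lambda>i. y (h i))))) \<in> borel_measurable (PiM (h ` {..<k}) (\<lambda>_. lborel))"
    for k B
    by (intro measurable_compose[OF _ measurable_ennreal] measurable_compose[OF _ borel_measurable_exp]
        borel_measurable_uminus borel_measurable_qform measurable_component_lborel) auto
  have inner: "(\<integral>\<^sup>+y. ennreal (exp (- qform (Suc n) Q (\<lambda>i. (x(h n := y)) (h i)))) \<partial>lborel) =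
      ennreal (sqrt (pi / Q $$ (n, n))) * ennreal (exp (- qform n (schur_compl n Q) (\<lambda>i. x (h i))))"
    (is "?L = _") for x
  proof -
    have 1: "qform n (schur_compl n Q) (\<lambda>i. (x(h n := y)) (h i)) = qform n (schur_compl n Q) (\<lambda>i. x (h i))" for y
      by (rule qform_cong) (simp add: hi)
    have 2: "(\<Sum>i<n. Q $$ (i, n) * (x(h n := y)) (h i)) = (\<Sum>i<n. Q $$ (i, n) * x (h i))" for y
      by (rule sum.cong) (simp_all add: hi)
    have "?L = (\<integral>\<^sup>+y. ennreal (exp (- qform n (schur_compl n Q) (\<lambda>i. x (h i)))) *
        ennreal (exp (- (Q $$ (n, n) * (y + (\<Sum>i<n. Q $$ (i, n) * x (h i)) / Q $$ (n, n))\<^sup>2))) \<partial>lborel)"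
      using pd(1) by (simp add: qform_pivot[OF Q] 1 2 ennreal_mult'[symmetric] exp_add[symmetric] del: fun_upd_apply)
        simp
    also have "\<dots> = ennreal (exp (- qform n (schur_compl n Q) (\<lambda>i. x (h i)))) * ennreal (sqrt (pi / Q $$ (n, n)))"
      by (subst nn_integral_cmult) (auto simp: nn_integral_gaussian[OF pd(1)])
    finally show ?thesis by (simp add: mult.commute)
  qed
  have "(\<integral>\<^sup>+y. ennreal (exp (- qform (Suc n) Q (\<lambda>i. y (h i)))) \<partial>PiM (h ` {..<Suc n}) (\<lambda>_. lborel)) =
     (\<integral>\<^sup>+x. ennreal (sqrt (pi / Q $$ (n, n))) * ennreal (exp (- qform n (schur_compl n Q) (\<lambda>i. x (h i))))
        \<partial>PiM (h ` {..<n}) (\<lambda>_. lborel))"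
    unfolding ins inner[symmetric] using hn m[of "Suc n" Q, unfolded ins]
    by (intro product_nn_integral_insert) auto
  also have "\<dots> = ennreal (sqrt (pi / Q $$ (n, n))) * ennreal (sqrt (pi ^ n / det (schur_compl n Q)))"
    by (subst nn_integral_cmult) (auto simp: m Suc.IH[OF hn(2) pd(2)])
  also have "\<dots> = ennreal (sqrt (pi ^ Suc n / det Q))"
    using pd by (simp add: det_pivot[OF Q] ennreal_mult'[symmetric] real_sqrt_mult[symmetric])
  finally show ?case .
qed

text \<open>The translated measure agrees with the product measure on boxes. It serves both
  substitutions in the gamma integral: removing y y^T / x from the leading block and recentring the
  Gaussian.\<close>

lemma nn_integral_PiM_lborel_translate:
  fixes c :: "'i \<Rightarrow> real"
  assumes "finite I" "g \<in> borel_measurable (PiM I (\<lambda>_. lborel))"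
  shows "(\<integral>\<^sup>+x. g (\<lambda>i\<in>I. x i + c i) \<partial>PiM I (\<lambda>_. lborel)) = integral\<^sup>N (PiM I (\<lambda>_. lborel)) g"
proof -
  interpret product_sigma_finite "\<lambda>_::'i. lborel :: real measure" by (rule product_sigma_finite_lborel)
  have tm: "(\<lambda>x. \<lambda>i\<in>I. x i + c i) \<in> PiM I (\<lambda>_. lborel) \<rightarrow>\<^sub>M PiM I (\<lambda>_. lborel)"
    using measurable_component_lborel[of _ I] by (intro measurable_restrict) simp
  have eq: "distr (PiM I (\<lambda>_. lborel)) (PiM I (\<lambda>_. lborel)) (\<lambda>x. \<lambda>i\<in>I. x i + c i) = PiM I (\<lambda>_. lborel)"
  proof (rule PiM_eqI)
    fix A :: "'i \<Rightarrow> real set" assume A: "\<And>i. i \<in> I \<Longrightarrow> A i \<in> sets lborel"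
    have A': "(\<lambda>t. t + c i) -` A i \<in> sets lborel" if "i \<in> I" for i
      using measurable_sets[of "\<lambda>t. t + c i" borel borel "A i"] A[OF that] by simp
    have "emeasure lborel ((\<lambda>t. t + c i) -` A i) = emeasure lborel (A i)" if "i \<in> I" for i
    proof -
      have "emeasure (distr lborel borel ((+) (c i))) (A i) = emeasure lborel ((+) (c i) -` A i)"
        using A[OF that] by (subst emeasure_distr) auto
      moreover have "(\<lambda>t. t + c i) = (+) (c i)" by (simp add: add.commute fun_eq_iff)
      ultimately show ?thesis by (simp add: lborel_distr_plus)
    qed
    moreover have "(\<lambda>x. \<lambda>i\<in>I. x i + c i) -` Pi\<^sub>E I A \<inter> space (PiM I (\<lambda>_. lborel)) =
        Pi\<^sub>E I (\<lambda>i. (\<lambda>t. t + c i) -` A i)"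
      by (auto simp: space_PiM PiE_def Pi_def)
    ultimately show "emeasure (distr (PiM I (\<lambda>_. lborel)) (PiM I (\<lambda>_. lborel)) (\<lambda>x. \<lambda>i\<in>I. x i + c i)) (Pi\<^sub>E I A) =
        (\<Prod>i\<in>I. emeasure lborel (A i))"
      using A A' assms(1)
      by (subst emeasure_distr) (auto simp: emeasure_PiM intro!: sets_PiM_I_finite)
  qed (use assms in auto)
  show ?thesis using nn_integral_distr[OF tm, of g, unfolded eq] assms(2) by simp
qed

text \<open>Substitution t = c x in Euler's integral. The endpoint needs no separate care, since
  \<open>0 powr (s - 1) = 0\<close> makes both integrands vanish there.\<close>

lemma nn_integral_gamma_rate:
  fixes s c :: real assumes s: "0 < s" and c: "0 < c"
  shows "(\<integral>\<^sup>+x. (if 0 < x then ennreal (x powr (s - 1) * exp (- (c * x))) else 0) \<partial>lborel) =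
    ennreal (Gamma s * c powr (- s))"
proof -
  let ?I = "\<integral>\<^sup>+x. (if 0 < x then ennreal (x powr (s - 1) * exp (- (c * x))) else 0) \<partial>lborel"
  have "ennreal (Gamma s) = (\<integral>\<^sup>+t. ennreal (indicator {0..} t * t powr (s - 1) / exp t) \<partial>lborel)"
    using Gamma_conv_nn_integral_real[OF s] .
  also have "\<dots> = ennreal \<bar>c\<bar> * (\<integral>\<^sup>+x. ennreal (indicator {0..} (0 + c * x) * (0 + c * x) powr (s - 1) / exp (0 + c * x)) \<partial>lborel)"
    using c by (intro nn_integral_real_affine) auto
  also have "(\<integral>\<^sup>+x. ennreal (indicator {0..} (0 + c * x) * (0 + c * x) powr (s - 1) / exp (0 + c * x)) \<partial>lborel) =
      (\<integral>\<^sup>+x. ennreal (c powr (s - 1)) * (if 0 < x then ennreal (x powr (s - 1) * exp (- (c * x))) else 0) \<partial>lborel)"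
    using c by (intro nn_integral_cong)
      (auto simp: indicator_def powr_mult exp_minus field_simps zero_le_mult_iff ennreal_mult'[symmetric])
  also have "\<dots> = ennreal (c powr (s - 1)) * ?I" by (subst nn_integral_cmult) auto
  also have "ennreal \<bar>c\<bar> * (ennreal (c powr (s - 1)) * ?I) = ennreal (c powr s) * ?I"
    using c by (simp add: mult.assoc[symmetric] ennreal_mult'[symmetric] powr_mult_base)
  finally have "ennreal (c powr (- s)) * ennreal (Gamma s) = ennreal (c powr (- s)) * ennreal (c powr s) * ?I"
    by (simp add: mult.assoc)
  also have "ennreal (c powr (- s)) * ennreal (c powr s) = 1"
    using c by (simp add: ennreal_mult'[symmetric] powr_add[symmetric])
  finally show ?thesis using s by (simp add: ennreal_mult' mult.commute)
qed

section \<open>Coordinates of symmetric matrices, measurability, and the matrix gamma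
  integral\<close>

lemma sym_of_carrier[simp]: "sym_of n f \<in> carrier_mat n n"
  by (simp add: sym_of_def)

lemma sym_of_index[simp]: "i < n \<Longrightarrow> j < n \<Longrightarrow> sym_of n f $$ (i, j) = f (min i j, max i j)"
  by (simp add: sym_of_def)

lemma transpose_sym_of[simp]: "transpose_mat (sym_of n f) = sym_of n f"
  by (intro eq_matI) (auto simp: sym_of_def min.commute max.commute)

lemma sym_of_cong: "(\<And>i j. i \<le> j \<Longrightarrow> j < n \<Longrightarrow> f (i, j) = g (i, j)) \<Longrightarrow> sym_of n f = sym_of n g"
  by (intro eq_matI) (auto simp: sym_of_def min_def max_def)

lemma schur_compl_sym_of:
  "schur_compl n (sym_of (Suc n) f) = sym_of n (\<lambda>(i, j). f (i, j) - f (i, n) * f (j, n) / f (n, n))"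
  by (intro eq_matI) (auto simp: sym_of_def schur_compl_def min_def max_def)

text \<open>Definiteness quantifies over uncountably many vectors; the pivot criterion replaces this
  by finitely many strict inequalities between rational functions of the entries. The family
  \<open>g\<close> is general so that the induction can pass to the Schur complement.\<close>

lemma pred_pd_mat_sym_of:
  assumes "\<And>i j. i \<le> j \<Longrightarrow> j < n \<Longrightarrow> (\<lambda>x. g x (i, j)) \<in> borel_measurable M"
  shows "Measurable.pred M (\<lambda>x. pd_mat n (sym_of n (g x)))"
  using assms
proof (induction n arbitrary: g)
  case 0
  have "pd_mat 0 (sym_of 0 (g x))" for x by (simp add: pd_mat_iff_qform)
  then show ?case by simp
next
  case (Suc n)
  have "pd_mat (Suc n) (sym_of (Suc n) (g x)) \<longleftrightarrow> 0 < g x (n, n) \<and>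
      pd_mat n (sym_of n (\<lambda>(i, j). g x (i, j) - g x (i, n) * g x (j, n) / g x (n, n)))" for x
    by (simp add: pd_mat_Suc_iff schur_compl_sym_of)
  moreover have "Measurable.pred M (\<lambda>x. pd_mat n (sym_of n (\<lambda>(i, j). g x (i, j) - g x (i, n) * g x (j, n) / g x (n, n))))"
  proof (rule Suc.IH)
    fix i j assume ij: "i \<le> j" "j < n"
    have [measurable]: "(\<lambda>x. g x (i, j)) \<in> borel_measurable M" "(\<lambda>x. g x (i, n)) \<in> borel_measurable M"
      "(\<lambda>x. g x (j, n)) \<in> borel_measurable M" "(\<lambda>x. g x (n, n)) \<in> borel_measurable M"
      using ij by (auto intro!: Suc.prems)
    show "(\<lambda>x. (case (i, j) of (i, j) \<Rightarrow> g x (i, j) - g x (i, n) * g x (j, n) / g x (n, n))) \<in> borel_measurable M"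
      by simp
  qed
  moreover have "(\<lambda>x. g x (n, n)) \<in> borel_measurable M" by (rule Suc.prems) auto
  ultimately show ?case by simp
qed

lemma borel_measurable_det:
  fixes A :: "'a \<Rightarrow> real mat"
  assumes "\<And>x. A x \<in> carrier_mat n n"
    and "\<And>i j. i < n \<Longrightarrow> j < n \<Longrightarrow> (\<lambda>x. A x $$ (i, j)) \<in> borel_measurable M"
  shows "(\<lambda>x. det (A x)) \<in> borel_measurable M"
proof -
  have "(\<lambda>x. det (A x)) = (\<lambda>x. \<Sum>p\<in>{p. p permutes {0..<n}}. signof p * (\<Prod>i = 0..<n. A x $$ (i, p i)))"
    by (rule ext, rule Determinant.det_def'[OF assms(1)])
  moreover have "(\<lambda>x. A x $$ (i, p i)) \<in> borel_measurable M" if "p permutes {0..<n}" "i \<in> {0..<n}" for p i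
    using that permutes_in_image[OF that(1), of i] by (intro assms(2)) auto
  ultimately show ?thesis by (auto intro!: borel_measurable_sum borel_measurable_times borel_measurable_prod)
qed

lemma borel_measurable_sym_of_index:
  assumes "\<And>i j. i \<le> j \<Longrightarrow> j < n \<Longrightarrow> (\<lambda>x. g x (i, j)) \<in> borel_measurable M" "i < n" "j < n"
  shows "(\<lambda>x. sym_of n (g x) $$ (i, j)) \<in> borel_measurable M"
  using assms by (auto simp: min_def max_def)

lemma borel_measurable_mtrace_mult:
  assumes "\<And>x. A x \<in> carrier_mat n m" "\<And>x. B x \<in> carrier_mat m n"
    and "\<And>i j. i < n \<Longrightarrow> j < m \<Longrightarrow> (\<lambda>x. A x $$ (i, j)) \<in> borel_measurable M"
    and "\<And>i j. i < m \<Longrightarrow> j < n \<Longrightarrow> (\<lambda>x. B x $$ (i, j)) \<in> borel_measurable M"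
  shows "(\<lambda>x. mtrace (A x * B x)) \<in> borel_measurable M"
  unfolding mtrace_mult[OF assms(1,2)] using assms(3,4)
  by (intro borel_measurable_sum borel_measurable_times) auto


text \<open>The Wishart density without its normalisation, with \<open>a\<close> for \<alpha>/2 and
  an arbitrary rate matrix \<open>A\<close> in place of half the inverse of \<Sigma>.\<close>

definition gamma_integrand :: "nat \<Rightarrow> real \<Rightarrow> real mat \<Rightarrow> (nat \<times> nat \<Rightarrow> real) \<Rightarrow> ennreal" where
  "gamma_integrand n a A f = (if pd_mat n (sym_of n f)
     then ennreal (det (sym_of n f) powr (a - (real n + 1) / 2) * exp (- mtrace (A * sym_of n f))) else 0)"

lemma borel_measurable_gamma_integrand:
  assumes A: "A \<in> carrier_mat n n"
  shows "gamma_integrand n a A \<in> borel_measurable (PiM (sym_idx n) (\<lambda>_. lborel))"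
proof -
  let ?M = "PiM (sym_idx n) (\<lambda>_. lborel :: real measure)"
  have f: "(\<lambda>f. f (i, j)) \<in> borel_measurable ?M" if "i \<le> j" "j < n" for i j
    using that by (intro measurable_component_lborel) (auto simp: sym_idx_def)
  have [measurable]: "Measurable.pred ?M (\<lambda>f. pd_mat n (sym_of n f))"
    by (rule pred_pd_mat_sym_of) (rule f)
  have [measurable]: "(\<lambda>f. det (sym_of n f)) \<in> borel_measurable ?M"
    by (intro borel_measurable_det[of _ n] borel_measurable_sym_of_index[of n] f) auto
  have [measurable]: "(\<lambda>f. mtrace (A * sym_of n f)) \<in> borel_measurable ?M"
    by (intro borel_measurable_mtrace_mult[of _ n n] borel_measurable_sym_of_index[of n] f) (auto simp: A)
  show ?thesis unfolding gamma_integrand_def by measurable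
qed

lemma mtrace_mult_sym_of_Suc:
  assumes A: "A \<in> carrier_mat (Suc n) (Suc n)" "transpose_mat A = A"
  shows "mtrace (A * sym_of (Suc n) f) =
    mtrace (mat n n (\<lambda>(i, j). A $$ (i, j)) * sym_of n f) + 2 * (\<Sum>i<n. A $$ (i, n) * f (i, n)) + A $$ (n, n) * f (n, n)"
proof -
  have 1: "(\<Sum>j<n. A $$ (n, j) * sym_of (Suc n) f $$ (j, n)) = (\<Sum>i<n. A $$ (i, n) * f (i, n))"
    using symmetric_mat_index[OF A, of n] by (intro sum.cong) (auto simp: min_def max_def)
  have 2: "(\<Sum>i<n. A $$ (i, n) * sym_of (Suc n) f $$ (n, i)) = (\<Sum>i<n. A $$ (i, n) * f (i, n))"
    by (intro sum.cong) (auto simp: min_def max_def)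
  have "mtrace (A * sym_of (Suc n) f) = (\<Sum>i<Suc n. \<Sum>j<Suc n. A $$ (i, j) * sym_of (Suc n) f $$ (j, i))"
    by (rule mtrace_mult[OF A(1)]) simp
  also have "\<dots> = (\<Sum>i<n. \<Sum>j<n. A $$ (i, j) * sym_of (Suc n) f $$ (j, i)) +
      2 * (\<Sum>i<n. A $$ (i, n) * f (i, n)) + A $$ (n, n) * f (n, n)"
    using 1 2 by (simp add: sum.distrib del: sym_of_index) simp
  also have "(\<Sum>i<n. \<Sum>j<n. A $$ (i, j) * sym_of (Suc n) f $$ (j, i)) =
      mtrace (mat n n (\<lambda>(i, j). A $$ (i, j)) * sym_of n f)"
    by (subst mtrace_mult[of _ n n]) (auto intro!: sum.cong)
  finally show ?thesis .
qed

text \<open>With \<open>W\<close> the Schur complement of the corner \<open>x\<close>, the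
  determinant factors as x det W, and the trace against the leading block Q of \<open>A\<close>
  picks up y^T Q y / x, where y is the last column.\<close>

lemma gamma_integrand_Suc:
  assumes A: "A \<in> carrier_mat (Suc n) (Suc n)" "transpose_mat A = A"
    and x: "f (n, n) = x" "0 < x"
    and W: "\<And>i j. i \<le> j \<Longrightarrow> j < n \<Longrightarrow> f (i, j) = W (i, j) + f (i, n) * f (j, n) / x"
  shows "gamma_integrand (Suc n) a A f =
    ennreal (x powr (a - (real n + 2) / 2) *
      exp (- (qform n A (\<lambda>i. f (i, n)) / x + 2 * (\<Sum>i<n. A $$ (i, n) * f (i, n)) + A $$ (n, n) * x))) *
    gamma_integrand n (a - 1 / 2) (mat n n (\<lambda>(i, j). A $$ (i, j))) W"
proof -
  let ?Q = "mat n n (\<lambda>(i, j). A $$ (i, j))"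
  have sc: "schur_compl n (sym_of (Suc n) f) = sym_of n W"
    unfolding schur_compl_sym_of by (rule sym_of_cong) (simp add: x W)
  have nn: "sym_of (Suc n) f $$ (n, n) = x" using x by simp
  have det: "det (sym_of (Suc n) f) = x * det (sym_of n W)"
    using det_pivot[of "sym_of (Suc n) f" n] x(2) nn sc by simp
  have pd: "pd_mat (Suc n) (sym_of (Suc n) f) \<longleftrightarrow> pd_mat n (sym_of n W)"
    using pd_mat_Suc_iff[of "sym_of (Suc n) f" n] x(2) nn sc by simp
  have tr: "mtrace (?Q * sym_of n f) = mtrace (?Q * sym_of n W) + qform n A (\<lambda>i. f (i, n)) / x"
  proof -
    have "sym_of n f $$ (j, i) = sym_of n W $$ (j, i) + f (i, n) * f (j, n) / x" if "i < n" "j < n" for i j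
      using that W[of i j] W[of j i] by (cases "i \<le> j") (auto simp: min_def max_def)
    then have "mtrace (?Q * sym_of n f) =
        (\<Sum>i<n. \<Sum>j<n. A $$ (i, j) * (sym_of n W $$ (j, i) + f (i, n) * f (j, n) / x))"
      by (subst mtrace_mult[of _ n n]) (auto intro!: sum.cong simp del: sym_of_index)
    also have "\<dots> = (\<Sum>i<n. \<Sum>j<n. A $$ (i, j) * sym_of n W $$ (j, i)) + qform n A (\<lambda>i. f (i, n)) / x"
      by (simp add: qform_def sum_divide_distrib sum.distrib algebra_simps del: sym_of_index)
    also have "(\<Sum>i<n. \<Sum>j<n. A $$ (i, j) * sym_of n W $$ (j, i)) = mtrace (?Q * sym_of n W)"
      by (subst mtrace_mult[of _ n n]) (auto intro!: sum.cong)
    finally show ?thesis .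
  qed
  show ?thesis
  proof (cases "pd_mat n (sym_of n W)")
    case True
    \<comment> \<open>Both determinants carry the same exponent; this is why the parameter falls by
      1/2 with each dimension.\<close>
    have e: "a - (real (Suc n) + 1) / 2 = a - (real n + 2) / 2" "a - 1 / 2 - (real n + 1) / 2 = a - (real n + 2) / 2"
      by (simp_all add: field_simps)
    have "gamma_integrand (Suc n) a A f = ennreal ((x * det (sym_of n W)) powr (a - (real n + 2) / 2) *
        exp (- (mtrace (?Q * sym_of n f) + 2 * (\<Sum>i<n. A $$ (i, n) * f (i, n)) + A $$ (n, n) * x)))"
      using True by (simp add: gamma_integrand_def pd det e[symmetric] mtrace_mult_sym_of_Suc[OF A] x(1))
    also have "\<dots> = ennreal ((x powr (a - (real n + 2) / 2) *
      exp (- (qform n A (\<lambda>i. f (i, n)) / x + 2 * (\<Sum>i<n. A $$ (i, n) * f (i, n)) + A $$ (n, n) * x))) *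
      (det (sym_of n W) powr (a - (real n + 2) / 2) * exp (- mtrace (?Q * sym_of n W))))"
      unfolding tr using x(2) pd_mat_det_pos[OF True] by (simp add: powr_mult exp_add[symmetric] mult_ac)
    finally show ?thesis using True by (simp add: gamma_integrand_def e ennreal_mult')
  qed (simp add: gamma_integrand_def pd)
qed


lemma pd_mat_smult: "pd_mat n A \<Longrightarrow> 0 < c \<Longrightarrow> pd_mat n (c \<cdot>\<^sub>m A)"
proof -
  assume A: "pd_mat n A" and c: "0 < c"
  then have "A \<in> carrier_mat n n" by (simp add: pd_mat_def)
  then have "qform n (c \<cdot>\<^sub>m A) v = c * qform n A v" for v
    by (simp add: qform_def sum_distrib_left algebra_simps)
  moreover have "transpose_mat (c \<cdot>\<^sub>m A) = c \<cdot>\<^sub>m A"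
    using A by (intro symmetric_matI[of _ n]) (auto simp: pd_mat_def symmetric_mat_index[of A n])
  ultimately show ?thesis using A c by (auto simp: pd_mat_iff_qform)
qed

lemma pd_mat_leading:
  assumes pd: "pd_mat (Suc n) A"
  shows "pd_mat n (mat n n (\<lambda>(i, j). A $$ (i, j)))"
proof -
  let ?Q = "mat n n (\<lambda>(i, j). A $$ (i, j))"
  have A: "A \<in> carrier_mat (Suc n) (Suc n)" "transpose_mat A = A" using pd by (auto simp: pd_mat_def)
  have "0 < qform n ?Q v" if v: "\<exists>i<n. v i \<noteq> 0" for v
  proof -
    have "\<exists>i<Suc n. (v(n := 0)) i \<noteq> 0" using v by (auto intro: less_SucI)
    then have "0 < qform (Suc n) A (v(n := 0))" using pd unfolding pd_mat_iff_qform by blast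
    also have "\<dots> = qform n ?Q v" unfolding qform_Suc[OF A] by (simp add: qform_def)
    finally show ?thesis .
  qed
  moreover have "transpose_mat ?Q = ?Q"
    by (intro symmetric_matI[of _ n]) (auto simp: symmetric_mat_index[OF A])
  ultimately show ?thesis by (simp add: pd_mat_iff_qform)
qed

text \<open>Completes the square of the Gaussian in y with centre - x w. The surplus x w^T Q w,
  taken from \<open>A $$ (n, n) * x\<close>, leaves the rate of the gamma density in x.\<close>

lemma qform_complete_square:
  assumes A: "A \<in> carrier_mat (Suc n) (Suc n)" "transpose_mat A = A" and x: "x \<noteq> 0"
    and w: "\<And>i. i < n \<Longrightarrow> (\<Sum>j<n. A $$ (i, j) * w j) = A $$ (i, n)"
  shows "qform n ((1 / x) \<cdot>\<^sub>m mat n n (\<lambda>(i, j). A $$ (i, j))) (\<lambda>i. y i + x * w i) =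
    qform n A y / x + 2 * (\<Sum>i<n. A $$ (i, n) * y i) + x * qform n A w"
proof -
  have 1: "(\<Sum>i<n. \<Sum>j<n. A $$ (i, j) * y i * w j) = (\<Sum>i<n. A $$ (i, n) * y i)"
    by (rule sum.cong) (simp_all add: w[symmetric] sum_distrib_left algebra_simps)
  have "(\<Sum>i<n. \<Sum>j<n. A $$ (i, j) * w i * y j) = (\<Sum>j<n. \<Sum>i<n. A $$ (i, j) * w i * y j)"
    by (rule sum.swap)
  also have "\<dots> = (\<Sum>i<n. \<Sum>j<n. A $$ (i, j) * y i * w j)"
    by (intro sum.cong refl) (simp add: symmetric_mat_index[OF A])
  finally have 2: "(\<Sum>i<n. \<Sum>j<n. A $$ (i, j) * w i * y j) = (\<Sum>i<n. A $$ (i, n) * y i)"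
    using 1 by simp
  have "qform n ((1 / x) \<cdot>\<^sub>m mat n n (\<lambda>(i, j). A $$ (i, j))) (\<lambda>i. y i + x * w i) =
     (\<Sum>i<n. \<Sum>j<n. A $$ (i, j) * y i * y j / x + A $$ (i, j) * y i * w j + A $$ (i, j) * w i * y j
       + x * (A $$ (i, j) * w i * w j))"
    unfolding qform_def using x by (intro sum.cong refl) (simp add: field_simps)
  also have "\<dots> = qform n A y / x + (\<Sum>i<n. \<Sum>j<n. A $$ (i, j) * y i * w j) +
     (\<Sum>i<n. \<Sum>j<n. A $$ (i, j) * w i * y j) + x * qform n A w"
    by (simp add: sum.distrib qform_def sum_divide_distrib sum_distrib_left)
  finally show ?thesis using 1 2 by simp
qed

text \<open>The factors match one integration step: Gamma a from the corner, pi^(n/2) from the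
  Gaussian column, and the lower-dimensional integral with parameter a - 1/2.\<close>

lemma multigamma_Suc:
  "multigamma (Suc n) a = Gamma a * sqrt (pi ^ n) * multigamma n (a - 1 / 2)"
proof -
  have "(\<Prod>i\<in>{1..Suc n}. Gamma (a - (real i - 1) / 2)) = Gamma a * (\<Prod>i\<in>{1..n}. Gamma (a - (real (Suc i) - 1) / 2))"
    by (subst prod.atLeast_Suc_atMost) (simp_all add: prod.atLeast_Suc_atMost_Suc_shift del: prod.cl_ivl_Suc)
  also have "(\<Prod>i\<in>{1..n}. Gamma (a - (real (Suc i) - 1) / 2)) = (\<Prod>i\<in>{1..n}. Gamma (a - 1 / 2 - (real i - 1) / 2))"
    by (intro prod.cong refl arg_cong[where f = Gamma]) (simp add: field_simps)
  finally have 1: "(\<Prod>i\<in>{1..Suc n}. Gamma (a - (real i - 1) / 2)) =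
      Gamma a * (\<Prod>i\<in>{1..n}. Gamma (a - 1 / 2 - (real i - 1) / 2))" .
  have "sqrt (pi ^ n) = pi powr (real n / 2)"
    by (simp add: powr_half_sqrt[symmetric] powr_realpow[symmetric] powr_powr)
  moreover have "real (Suc n) * (real (Suc n) - 1) / 4 = real n / 2 + real n * (real n - 1) / 4"
    by (simp add: field_simps)
  ultimately have 2: "pi powr (real (Suc n) * (real (Suc n) - 1) / 4) = sqrt (pi ^ n) * pi powr (real n * (real n - 1) / 4)"
    by (simp only: powr_add)
  show ?thesis unfolding multigamma_def 1 2 by simp
qed

text \<open>Write \<open>X = ((Z, y), (y\<^sup>T, x))\<close> and substitute \<open>Z = W + y y\<^sup>T / x\<close>, so that \<open>W\<close> is the Schur complement
  of \<open>x\<close>: the integrand splits into the integrand in \<open>W\<close> one dimension lower, a Gaussian in \<open>y\<close>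
  and a gamma density in \<open>x\<close>.\<close>

theorem nn_integral_gamma_integrand:
  assumes "pd_mat n A" "(real n - 1) / 2 < a"
  shows "integral\<^sup>N (sym_lebesgue n) (gamma_integrand n a A) = ennreal (multigamma n a * det A powr (- a))"
  using assms
proof (induction n arbitrary: a A)
  case 0
  then have "A \<in> carrier_mat 0 0" by (simp add: pd_mat_def)
  moreover have "pd_mat 0 (sym_of 0 f)" for f by (simp add: pd_mat_iff_qform)
  ultimately show ?case
    by (simp add: sym_lebesgue_def sym_idx_def PiM_empty gamma_integrand_def multigamma_def mtrace_def
        det_dim_zero sym_of_def)
next
  case (Suc n)
  interpret product_sigma_finite "\<lambda>_::nat \<times> nat. lborel :: real measure" by (rule product_sigma_finite_lborel)
  from Suc.prems have A: "A \<in> carrier_mat (Suc n) (Suc n)" "transpose_mat A = A" by (auto simp: pd_mat_def)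
  define Q where "Q = mat n n (\<lambda>(i, j). A $$ (i, j))"
  have pdQ: "pd_mat n Q" unfolding Q_def by (rule pd_mat_leading) fact
  then have Q: "Q \<in> carrier_mat n n" by (simp add: pd_mat_def)
  \<comment> \<open>The solution of Q w = b, where b is the last column of \<open>A\<close> above
    the corner.\<close>
  define w where "w j = (\<Sum>k<n. minv n Q $$ (j, k) * A $$ (k, n))" for j
  have w: "(\<Sum>j<n. A $$ (i, j) * w j) = A $$ (i, n)" if i: "i < n" for i
  proof -
    have "(\<Sum>j<n. A $$ (i, j) * w j) = (\<Sum>j<n. \<Sum>k<n. Q $$ (i, j) * minv n Q $$ (j, k) * A $$ (k, n))"
      using i by (intro sum.cong) (auto simp: w_def Q_def sum_distrib_left mult.assoc)
    also have "\<dots> = (\<Sum>k<n. (\<Sum>j<n. Q $$ (i, j) * minv n Q $$ (j, k)) * A $$ (k, n))"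
      by (subst sum.swap) (simp add: sum_distrib_right)
    also have "\<dots> = (\<Sum>k<n. if k = i then A $$ (k, n) else 0)"
      using i pd_mat_minv[OF pdQ] index_mult_mat_sum[OF Q pd_mat_minv(1)[OF pdQ], symmetric]
      by (intro sum.cong) auto
    finally show ?thesis using i by simp
  qed
  \<comment> \<open>The Schur complement of \<open>Q\<close> in \<open>A\<close>, which becomes the
    rate of the gamma density in x.\<close>
  define s where "s = A $$ (n, n) - qform n A w"
  have detA: "det A = det Q * s" unfolding s_def Q_def by (rule det_bordered[OF A w])
  have dQ: "0 < det Q" and s: "0 < s"
    using pd_mat_det_pos[OF pdQ] pd_mat_det_pos[OF Suc.prems(1)] detA by (simp_all add: zero_less_mult_iff)
  \<comment> \<open>The coordinates split into the column y on \<open>C\<close>, the leading block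
    on \<open>I\<close>, and the corner \<open>(n, n)\<close>.\<close>
  define C where "C = (\<lambda>i. (i, n)) ` {..<n}"
  define I where "I = sym_idx n"
  have fin: "finite C" "finite I"
    by (auto simp: C_def I_def sym_idx_def intro: finite_subset[of _ "{..n} \<times> {..n}"])
  have disj: "C \<inter> I = {}" "(n, n) \<notin> C \<union> I" by (auto simp: C_def I_def sym_idx_def)
  have idx: "sym_idx (Suc n) = insert (n, n) (C \<union> I)"
    by (auto simp: C_def I_def sym_idx_def less_Suc_eq)
  let ?F = "gamma_integrand (Suc n) a A"
  let ?G = "multigamma n (a - 1 / 2) * det Q powr (- (a - 1 / 2))"
  have mF: "?F \<in> borel_measurable (PiM (insert (n, n) (C \<union> I)) (\<lambda>_. lborel))"
    using borel_measurable_gamma_integrand[OF A(1)] unfolding idx .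
  have upd: "(\<lambda>z. z((n, n) := x)) \<in> PiM (C \<union> I) (\<lambda>_. lborel) \<rightarrow>\<^sub>M PiM (insert (n, n) (C \<union> I)) (\<lambda>_. lborel)"
    for x :: real by (rule measurable_fun_upd[where J = "C \<union> I"]) auto
  \<comment> \<open>The induction hypothesis at a - 1/2 asks for (n - 1)/2 < a - 1/2, which is the
    present assumption for dimension \<open>Suc n\<close>.\<close>
  have "a > 1 / 2 * real n" using Suc.prems by (simp add: field_simps)
  then have IH: "integral\<^sup>N (PiM I (\<lambda>_. lborel)) (gamma_integrand n (a - 1 / 2) Q) = ennreal ?G"
    using Suc.IH[OF pdQ, of "a - 1 / 2"] by (simp add: sym_lebesgue_def I_def field_simps)
  have inner_W: "(\<integral>\<^sup>+W. ?F ((merge C I (y, W))((n, n) := x)) \<partial>PiM I (\<lambda>_. lborel)) =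
      ennreal (x powr (a - (real n + 2) / 2) * exp (- (s * x))) *
      ennreal (exp (- qform n ((1 / x) \<cdot>\<^sub>m Q) (\<lambda>i. y (i, n) + x * w i))) * ennreal ?G"
    if x: "0 < x" and y: "y \<in> space (PiM C (\<lambda>_. lborel))" for x y
  proof -
    have m: "(\<lambda>W. ?F ((merge C I (y, W))((n, n) := x))) \<in> borel_measurable (PiM I (\<lambda>_. lborel))"
      by (rule measurable_compose[OF measurable_compose[OF
            measurable_compose[OF measurable_Pair1'[OF y] measurable_merge] upd] mF])
    \<comment> \<open>The shift y y^T / x that turns a leading block into its Schur complement; it
      depends on x and y, so \<open>W\<close> must be integrated innermost.\<close>
    let ?c = "\<lambda>(i, j). y (i, n) * y (j, n) / x"
    have "?F ((merge C I (y, \<lambda>ij\<in>I. W ij + ?c ij))((n, n) := x)) =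
      ennreal (x powr (a - (real n + 2) / 2) * exp (- (s * x))) *
      ennreal (exp (- qform n ((1 / x) \<cdot>\<^sub>m Q) (\<lambda>i. y (i, n) + x * w i))) * gamma_integrand n (a - 1 / 2) Q W" for W
    proof -
      define f where "f = (merge C I (y, \<lambda>ij\<in>I. W ij + ?c ij))((n, n) := x)"
      have fn: "f (i, n) = y (i, n)" if "i < n" for i using that by (auto simp: f_def merge_def C_def)
      have "?F f = ennreal (x powr (a - (real n + 2) / 2) *
          exp (- (qform n A (\<lambda>i. f (i, n)) / x + 2 * (\<Sum>i<n. A $$ (i, n) * f (i, n)) + A $$ (n, n) * x))) *
          gamma_integrand n (a - 1 / 2) Q W"
        unfolding Q_def
      proof (rule gamma_integrand_Suc[OF A _ x])
        fix i j assume ij: "i \<le> j" "j < n"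
        then have "(i, j) \<notin> C" "(i, j) \<in> I" by (auto simp: C_def I_def sym_idx_def)
        then have "f (i, j) = W (i, j) + y (i, n) * y (j, n) / x"
          using ij by (simp add: f_def merge_def)
        then show "f (i, j) = W (i, j) + f (i, n) * f (j, n) / x" using ij by (simp add: fn)
      qed (simp add: f_def)
      also have "qform n A (\<lambda>i. f (i, n)) = qform n A (\<lambda>i. y (i, n))" by (rule qform_cong) (rule fn)
      also have "(\<Sum>i<n. A $$ (i, n) * f (i, n)) = (\<Sum>i<n. A $$ (i, n) * y (i, n))"
        by (intro sum.cong) (auto simp: fn)
      also have "qform n A (\<lambda>i. y (i, n)) / x + 2 * (\<Sum>i<n. A $$ (i, n) * y (i, n)) + A $$ (n, n) * x =
          s * x + qform n ((1 / x) \<cdot>\<^sub>m Q) (\<lambda>i. y (i, n) + x * w i)"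
        unfolding Q_def using qform_complete_square[OF A _ w, of x "\<lambda>i. y (i, n)"] x
        by (simp add: s_def algebra_simps)
      finally show ?thesis
        unfolding f_def[symmetric] by (simp add: exp_add[symmetric] ennreal_mult'[symmetric] mult.assoc)
    qed
    then have "(\<integral>\<^sup>+W. ?F ((merge C I (y, \<lambda>ij\<in>I. W ij + ?c ij))((n, n) := x)) \<partial>PiM I (\<lambda>_. lborel)) =
      ennreal (x powr (a - (real n + 2) / 2) * exp (- (s * x))) *
      ennreal (exp (- qform n ((1 / x) \<cdot>\<^sub>m Q) (\<lambda>i. y (i, n) + x * w i))) * ennreal ?G"
      using borel_measurable_gamma_integrand[OF Q, folded I_def] by (simp add: nn_integral_cmult IH)
    then show ?thesis using nn_integral_PiM_lborel_translate[OF fin(2) m, of ?c] by simp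
  qed
  have inner_y: "(\<integral>\<^sup>+y. \<integral>\<^sup>+W. ?F ((merge C I (y, W))((n, n) := x)) \<partial>PiM I (\<lambda>_. lborel) \<partial>PiM C (\<lambda>_. lborel)) =
      (if 0 < x then ennreal (x powr (a - 1) * exp (- (s * x))) else 0) * ennreal (sqrt (pi ^ n / det Q) * ?G)"
    (is "?L = _") for x
  proof (cases "0 < x")
    case False
    then have "?F ((merge C I (y, W))((n, n) := x)) = 0" for y W
      by (simp add: gamma_integrand_def pd_mat_Suc_iff)
    then show ?thesis using False by simp
  next
    case x: True
    let ?g = "\<lambda>y. ennreal (exp (- qform n ((1 / x) \<cdot>\<^sub>m Q) (\<lambda>i. y (i, n))))"
    have mg: "?g \<in> borel_measurable (PiM C (\<lambda>_. lborel))"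
      by (intro measurable_compose[OF _ measurable_ennreal] measurable_compose[OF _ borel_measurable_exp]
        borel_measurable_uminus borel_measurable_qform measurable_component_lborel) (auto simp: C_def)
    have "(\<integral>\<^sup>+y. ennreal (exp (- qform n ((1 / x) \<cdot>\<^sub>m Q) (\<lambda>i. y (i, n) + x * w i))) \<partial>PiM C (\<lambda>_. lborel)) =
        (\<integral>\<^sup>+y. ?g (\<lambda>ij\<in>C. y ij + (\<lambda>(i, j). x * w i) ij) \<partial>PiM C (\<lambda>_. lborel))"
      by (intro nn_integral_cong arg_cong[where f = "\<lambda>u. ennreal (exp (- u))"] qform_cong) (auto simp: C_def)
    also have "\<dots> = integral\<^sup>N (PiM C (\<lambda>_. lborel)) ?g"
      by (rule nn_integral_PiM_lborel_translate[OF fin(1) mg])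
    also have "\<dots> = ennreal (sqrt (pi ^ n / det ((1 / x) \<cdot>\<^sub>m Q)))"
      unfolding C_def by (rule nn_integral_gaussian_qform) (use pdQ x in \<open>auto simp: inj_on_def pd_mat_smult\<close>)
    \<comment> \<open>Scaling by 1/x divides the determinant by x^n; the resulting x^(n/2) raises
      the exponent a - (n + 2)/2 to the a - 1 of the gamma density.\<close>
    also have "sqrt (pi ^ n / det ((1 / x) \<cdot>\<^sub>m Q)) = x powr (real n / 2) * sqrt (pi ^ n / det Q)"
    proof -
      have "pi ^ n / det ((1 / x) \<cdot>\<^sub>m Q) = x ^ n * (pi ^ n / det Q)" using Q x by (simp add: field_simps)
      moreover have "sqrt (x ^ n) = x powr (real n / 2)"
        using x by (simp add: powr_half_sqrt[symmetric] powr_realpow[symmetric] powr_powr)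
      ultimately show ?thesis by (metis real_sqrt_mult)
    qed
    finally have gy: "(\<integral>\<^sup>+y. ennreal (exp (- qform n ((1 / x) \<cdot>\<^sub>m Q) (\<lambda>i. y (i, n) + x * w i))) \<partial>PiM C (\<lambda>_. lborel)) =
        ennreal (x powr (real n / 2) * sqrt (pi ^ n / det Q))" .
    have m2: "(\<lambda>y. ennreal (exp (- qform n ((1 / x) \<cdot>\<^sub>m Q) (\<lambda>i. y (i, n) + x * w i)))) \<in> borel_measurable (PiM C (\<lambda>_. lborel))"
      by (intro measurable_compose[OF _ measurable_ennreal] measurable_compose[OF _ borel_measurable_exp]
        borel_measurable_uminus borel_measurable_qform borel_measurable_add measurable_component_lborel) (auto simp: C_def)
    have "?L = (\<integral>\<^sup>+y. ennreal (x powr (a - (real n + 2) / 2) * exp (- (s * x))) *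
      ennreal (exp (- qform n ((1 / x) \<cdot>\<^sub>m Q) (\<lambda>i. y (i, n) + x * w i))) * ennreal ?G \<partial>PiM C (\<lambda>_. lborel))"
      by (rule nn_integral_cong) (rule inner_W[OF x])
    also have "\<dots> = ennreal (x powr (a - (real n + 2) / 2) * exp (- (s * x))) *
        ennreal (x powr (real n / 2) * sqrt (pi ^ n / det Q)) * ennreal ?G"
      using m2 by (simp add: nn_integral_cmult nn_integral_multc gy)
    also have "\<dots> = ennreal (x powr (a - (real n + 2) / 2) * x powr (real n / 2) * exp (- (s * x)))
        * ennreal (sqrt (pi ^ n / det Q) * ?G)"
      using dQ by (simp add: ennreal_mult' mult_ac)
    also have "x powr (a - (real n + 2) / 2) * x powr (real n / 2) = x powr (a - 1)"
      by (simp add: powr_add[symmetric] diff_divide_distrib add_divide_distrib)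
    finally show ?thesis by (simp only: x if_True)
  qed
  have "integral\<^sup>N (sym_lebesgue (Suc n)) ?F =
      (\<integral>\<^sup>+x. \<integral>\<^sup>+z. ?F (z((n, n) := x)) \<partial>PiM (C \<union> I) (\<lambda>_. lborel) \<partial>lborel)"
    unfolding sym_lebesgue_def idx using fin disj mF by (intro product_nn_integral_insert_rev) auto
  also have "\<dots> = (\<integral>\<^sup>+x. \<integral>\<^sup>+y. \<integral>\<^sup>+W. ?F ((merge C I (y, W))((n, n) := x)) \<partial>PiM I (\<lambda>_. lborel) \<partial>PiM C (\<lambda>_. lborel) \<partial>lborel)"
    by (intro nn_integral_cong product_nn_integral_fold fin disj measurable_compose[OF upd mF])
  also have "\<dots> = ennreal (Gamma a * s powr (- a)) * ennreal (sqrt (pi ^ n / det Q) * ?G)"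
  proof -
    have "0 < a" using \<open>a > 1 / 2 * real n\<close> by (smt (verit) divide_nonneg_nonneg mult_nonneg_nonneg of_nat_0_le_iff)
    then show ?thesis unfolding inner_y by (subst nn_integral_multc) (simp_all add: nn_integral_gamma_rate[OF _ s])
  qed
  also have "\<dots> = ennreal (multigamma (Suc n) a * det A powr (- a))"
  proof -
    have "0 < a" using \<open>a > 1 / 2 * real n\<close> by (smt (verit) divide_nonneg_nonneg mult_nonneg_nonneg of_nat_0_le_iff)
    then have "0 \<le> Gamma a * s powr (- a)" by simp
    moreover have "Gamma a * s powr (- a) * (sqrt (pi ^ n / det Q) * ?G) = multigamma (Suc n) a * det A powr (- a)"
    proof -
      have "sqrt (pi ^ n / det Q) = sqrt (pi ^ n) * det Q powr (- 1 / 2)"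
        using dQ by (simp add: real_sqrt_divide powr_minus powr_half_sqrt field_simps)
      \<comment> \<open>One half of the exponent comes from the Gaussian, the rest from the
        induction hypothesis.\<close>
      moreover have "det Q powr (- 1 / 2) * det Q powr (- (a - 1 / 2)) = det Q powr (- a)"
        by (simp add: powr_add[symmetric])
      ultimately show ?thesis
        using dQ s by (simp add: multigamma_Suc detA powr_mult mult_ac)
    qed
    ultimately show ?thesis by (metis ennreal_mult')
  qed
  finally show ?case .
qed

section \<open>Square roots of nonnegative definite matrices\<close>

text \<open>The complexified matrix has an eigenvector X + i Y with eigenvalue k. Symmetry equates
  the pairings Y^T A X and X^T A Y, which gives Im k (|X|^2 + |Y|^2) = 0; hence k is real, and X or
  Y is a nonzero real eigenvector.\<close>

lemma symmetric_mat_eigenvector: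
  fixes A :: "real mat"
  assumes A: "A \<in> carrier_mat n n" "transpose_mat A = A" and n: "0 < n"
  shows "\<exists>e v. (\<forall>i<n. (\<Sum>j<n. A $$ (i, j) * v j) = e * v i) \<and> (\<exists>i<n. v i \<noteq> 0)"
proof -
  define Ac where "Ac = map_mat complex_of_real A"
  have Ac: "Ac \<in> carrier_mat n n" using A by (simp add: Ac_def)
  obtain k where "eigenvalue Ac k"
    using spectrum_non_empty[OF Ac n] by (auto simp: spectrum_def)
  then obtain z where z: "z \<in> carrier_vec n" "z \<noteq> 0\<^sub>v n" "Ac *\<^sub>v z = k \<cdot>\<^sub>v z"
    using Ac by (auto simp: eigenvalue_def eigenvector_def)
  define X Y where "X i = Re (z $ i)" and "Y i = Im (z $ i)" for i
  have ev: "(\<Sum>j<n. complex_of_real (A $$ (i, j)) * z $ j) = k * z $ i" if i: "i < n" for i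
  proof -
    have "(Ac *\<^sub>v z) $ i = (\<Sum>j<n. complex_of_real (A $$ (i, j)) * z $ j)"
      using A z(1) i by (simp add: Ac_def scalar_prod_def lessThan_atLeast0)
    then show ?thesis using z i by simp
  qed
  have re: "(\<Sum>j<n. A $$ (i, j) * X j) = Re k * X i - Im k * Y i" if "i < n" for i
    using arg_cong[OF ev[OF that], of Re] by (simp add: X_def Y_def)
  have im: "(\<Sum>j<n. A $$ (i, j) * Y j) = Re k * Y i + Im k * X i" if "i < n" for i
    using arg_cong[OF ev[OF that], of Im] by (simp add: X_def Y_def)
  have "(\<Sum>i<n. Y i * (\<Sum>j<n. A $$ (i, j) * X j)) = (\<Sum>j<n. \<Sum>i<n. Y i * (A $$ (i, j) * X j))"
    by (subst sum.swap) (simp add: sum_distrib_left)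
  also have "\<dots> = (\<Sum>i<n. X i * (\<Sum>j<n. A $$ (i, j) * Y j))"
    unfolding sum_distrib_left by (intro sum.cong refl) (simp add: symmetric_mat_index[OF A])
  finally have "(\<Sum>i<n. Y i * (Re k * X i - Im k * Y i)) = (\<Sum>i<n. X i * (Re k * Y i + Im k * X i))"
    by (simp add: re im)
  then have "(\<Sum>i<n. X i * (Re k * Y i + Im k * X i) - Y i * (Re k * X i - Im k * Y i)) = 0"
    by (simp add: sum_subtractf)
  then have "Im k * (\<Sum>i<n. (X i)\<^sup>2 + (Y i)\<^sup>2) = 0"
    by (simp add: sum_distrib_left power2_eq_square algebra_simps)
  moreover obtain i where i: "i < n" "X i \<noteq> 0 \<or> Y i \<noteq> 0"
    using z(1,2) by (metis X_def Y_def carrier_vecD complex_eq_iff eq_vecI index_zero_vec zero_complex.simps)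
  moreover have "0 < (\<Sum>i<n. (X i)\<^sup>2 + (Y i)\<^sup>2)"
    using i by (intro sum_pos2[of _ i]) (auto simp: sum_power2_gt_zero_iff)
  ultimately have "Im k = 0" by simp
  then have "\<forall>i<n. (\<Sum>j<n. A $$ (i, j) * X j) = Re k * X i" "\<forall>i<n. (\<Sum>j<n. A $$ (i, j) * Y j) = Re k * Y i"
    using re im by simp_all
  with i show ?thesis by blast
qed

lemma scalar_prod_congruence:
  fixes A H :: "real mat"
  assumes "A \<in> carrier_mat m m" "H \<in> carrier_mat m n" "v \<in> carrier_vec n"
  shows "v \<bullet> ((transpose_mat H * A * H) *\<^sub>v v) = (H *\<^sub>v v) \<bullet> (A *\<^sub>v (H *\<^sub>v v))"
proof -
  have "(transpose_mat H * A * H) *\<^sub>v v = transpose_mat H *\<^sub>v (A *\<^sub>v (H *\<^sub>v v))"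
    using assms by (simp add: assoc_mult_mat_vec[of _ n m] assoc_mult_mat_vec[of _ n m _ n])
  moreover have "v \<bullet> (transpose_mat H *\<^sub>v (A *\<^sub>v (H *\<^sub>v v))) = (H *\<^sub>v v) \<bullet> (A *\<^sub>v (H *\<^sub>v v))"
    using transpose_vec_mult_scalar[of H m n v "A *\<^sub>v (H *\<^sub>v v)"] assms
    by (metis comm_scalar_prod mult_mat_vec_carrier transpose_carrier_mat)
  ultimately show ?thesis by simp
qed

lemma psd_mat_congruence:
  assumes A: "psd_mat m A" and H: "H \<in> carrier_mat m n"
  shows "psd_mat n (transpose_mat H * A * H)"
proof -
  have A': "A \<in> carrier_mat m m" "transpose_mat A = A" using A by (auto simp: psd_mat_def)
  have "transpose_mat (transpose_mat H * A * H) = transpose_mat H * transpose_mat (transpose_mat H * A)"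
    using A' H by (intro transpose_mult[of _ n m _ n]) auto
  also have "transpose_mat (transpose_mat H * A) = A * H"
    using A' H transpose_mult[of "transpose_mat H" n m A m] by simp
  also have "transpose_mat H * (A * H) = transpose_mat H * A * H"
    using A' H by (intro assoc_mult_mat[symmetric, of _ n m _ m _ n]) auto
  finally show ?thesis using A H A'
    unfolding psd_mat_def using scalar_prod_congruence[OF A'(1) H] by auto
qed

lemma pd_mat_congruence:
  assumes A: "pd_mat n A" and H: "H \<in> carrier_mat n n" "det H \<noteq> 0"
  shows "pd_mat n (transpose_mat H * A * H)"
proof -
  have A': "A \<in> carrier_mat n n" "transpose_mat A = A" using A by (auto simp: pd_mat_def)
  have "psd_mat n A" using A unfolding pd_mat_def psd_mat_def
    by (metis less_eq_real_def mult_mat_vec_carrier scalar_prod_left_zero)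
  then have psd: "psd_mat n (transpose_mat H * A * H)" using H by (intro psd_mat_congruence) auto
  have "0 < v \<bullet> ((transpose_mat H * A * H) *\<^sub>v v)" if v: "v \<in> carrier_vec n" "v \<noteq> 0\<^sub>v n" for v
  proof -
    have "H *\<^sub>v v \<noteq> 0\<^sub>v n" using det_0_iff_vec_prod_zero_field[OF H(1)] H(2) v by blast
    moreover have "H *\<^sub>v v \<in> carrier_vec n" using H v by simp
    ultimately show ?thesis using A by (simp add: scalar_prod_congruence[OF A'(1) H(1) v(1)] pd_mat_def)
  qed
  then show ?thesis using psd by (simp add: pd_mat_def psd_mat_def)
qed

text \<open>A Householder reflection exchanging the last basis vector and \<open>v\<close>.\<close>

lemma orthogonal_mat_with_last_col:
  fixes v :: "nat \<Rightarrow> real"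
  assumes v: "(\<Sum>i<Suc n. (v i)\<^sup>2) = 1"
  obtains H where "H \<in> carrier_mat (Suc n) (Suc n)" "transpose_mat H = H" "H * H = 1\<^sub>m (Suc n)"
    "\<And>i. i < Suc n \<Longrightarrow> H $$ (i, n) = v i"
proof (cases "v n = 1")
  case True
  then have "(\<Sum>i<n. (v i)\<^sup>2) = 0" using v by simp
  then have 0: "v i = 0" if "i < n" for i using that by (simp add: sum_nonneg_eq_0_iff)
  show thesis by (rule that[of "1\<^sub>m (Suc n)"]) (use 0 True in \<open>auto simp: less_Suc_eq\<close>)
next
  case False
  \<comment> \<open>The reflection is I - 2 u u^T / |u|^2 with u = v - e_n. Here |u|^2 = 2 - 2 v_n,
    which vanishes precisely in the case already treated by the identity matrix.\<close>
  define u where "u i = v i - (if i = n then 1 else 0)" for i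
  define c where "c = (\<Sum>i<Suc n. (u i)\<^sup>2)"
  have c: "c = 2 - 2 * v n" using v by (simp add: c_def u_def power2_eq_square algebra_simps)
  then have c0: "c \<noteq> 0" using False by simp
  define H where "H = mat (Suc n) (Suc n) (\<lambda>(i, j). (if i = j then 1 else 0) - 2 * u i * u j / c)"
  have H: "H \<in> carrier_mat (Suc n) (Suc n)" by (simp add: H_def)
  have "H * H = 1\<^sub>m (Suc n)"
  proof (rule eq_matI)
    fix i j assume ij: "i < dim_row (1\<^sub>m (Suc n) :: real mat)" "j < dim_col (1\<^sub>m (Suc n) :: real mat)"
    then have ij: "i < Suc n" "j < Suc n" by auto
    have "(H * H) $$ (i, j) = (\<Sum>k<Suc n. H $$ (i, k) * H $$ (k, j))"
      by (rule index_mult_mat_sum[OF H H ij])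
    also have "\<dots> = (\<Sum>k<Suc n. (if k = i then (if i = j then 1 else 0) else 0) -
        (if k = i then 2 * u i * u j / c else 0) - (if k = j then 2 * u i * u j / c else 0) +
        4 * u i * u j / c / c * (u k)\<^sup>2)"
      using ij by (intro sum.cong) (auto simp: H_def power2_eq_square algebra_simps)
    also have "\<dots> = (if i = j then 1 else 0) - 2 * u i * u j / c - 2 * u i * u j / c + 4 * u i * u j / c / c * c"
      using ij unfolding c_def by (simp add: sum.distrib sum_subtractf sum_distrib_left del: sum.lessThan_Suc)
    also have "\<dots> = 1\<^sub>m (Suc n) $$ (i, j)" using ij c0 by simp
    finally show "(H * H) $$ (i, j) = 1\<^sub>m (Suc n) $$ (i, j)" .
  qed (use H in auto)
  moreover have "H $$ (i, n) = v i" if "i < Suc n" for i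
  proof -
    have "2 * u n / c = - 1" using c c0 by (simp add: u_def field_simps)
    then have "u i * (2 * u n / c) = - u i" by simp
    then have "2 * u i * u n / c = - u i" by (simp add: mult_ac)
    then show ?thesis using that by (simp add: H_def u_def)
  qed
  moreover have "transpose_mat H = H" by (rule symmetric_matI[OF H]) (auto simp: H_def)
  ultimately show thesis using H that by blast
qed

lemma psd_mat_leading:
  assumes psd: "psd_mat (Suc n) A"
  shows "psd_mat n (mat n n (\<lambda>(i, j). A $$ (i, j)))"
proof -
  let ?Q = "mat n n (\<lambda>(i, j). A $$ (i, j))"
  have A: "A \<in> carrier_mat (Suc n) (Suc n)" "transpose_mat A = A" using psd by (auto simp: psd_mat_def)
  have "0 \<le> qform n ?Q v" for v
  proof -
    have "0 \<le> qform (Suc n) A (v(n := 0))" using psd unfolding psd_mat_iff_qform by blast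
    also have "\<dots> = qform n ?Q v" unfolding qform_Suc[OF A] by (simp add: qform_def)
    finally show ?thesis .
  qed
  moreover have "transpose_mat ?Q = ?Q"
    by (intro symmetric_matI[of _ n]) (auto simp: symmetric_mat_index[OF A])
  ultimately show ?thesis by (simp add: psd_mat_iff_qform)
qed

text \<open>Deflation: a reflection moves a unit eigenvector to the last basis vector, the
  conjugated matrix splits into a leading block and the eigenvalue, and the roots of the two parts
  are conjugated back.\<close>

lemma psd_mat_sqrt_exists: "psd_mat n T \<Longrightarrow> \<exists>S. psd_mat n S \<and> S * S = T"
proof (induction n arbitrary: T)
  case 0
  then show ?case by (intro exI[of _ "0\<^sub>m 0 0"]) (auto simp: psd_mat_iff_qform qform_def)
next
  case (Suc n)
  then have T: "T \<in> carrier_mat (Suc n) (Suc n)" "transpose_mat T = T" by (auto simp: psd_mat_def)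
  obtain e v0 where v0: "\<forall>i<Suc n. (\<Sum>j<Suc n. T $$ (i, j) * v0 j) = e * v0 i" "\<exists>i<Suc n. v0 i \<noteq> 0"
    using symmetric_mat_eigenvector[OF T zero_less_Suc] by blast
  define r where "r = sqrt (\<Sum>i<Suc n. (v0 i)\<^sup>2)"
  have "0 < (\<Sum>i<Suc n. (v0 i)\<^sup>2)"
    using v0(2) by (metis finite_lessThan lessThan_iff sum_pos2 zero_le_power2 zero_less_power2)
  then have r: "0 < r" "r\<^sup>2 = (\<Sum>i<Suc n. (v0 i)\<^sup>2)" by (simp_all add: r_def del: sum.lessThan_Suc)
  define v where "v i = v0 i / r" for i
  have v1: "(\<Sum>i<Suc n. (v i)\<^sup>2) = 1"
    using r(1) by (simp add: v_def power_divide sum_divide_distrib[symmetric] r(2)[symmetric] del: sum.lessThan_Suc)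
  have ev: "(\<Sum>j<Suc n. T $$ (i, j) * v j) = e * v i" if "i < Suc n" for i
    using v0(1)[rule_format, OF that] by (simp add: v_def sum_divide_distrib[symmetric] del: sum.lessThan_Suc)
  \<comment> \<open>The Rayleigh quotient at the unit eigenvector is the eigenvalue, so nonnegative
    definiteness makes it nonnegative.\<close>
  have "qform (Suc n) T v = (\<Sum>i<Suc n. v i * (\<Sum>j<Suc n. T $$ (i, j) * v j))"
    unfolding qform_def sum_distrib_left by (simp add: algebra_simps del: sum.lessThan_Suc)
  also have "\<dots> = (\<Sum>i<Suc n. e * (v i)\<^sup>2)"
    by (rule sum.cong) (simp_all add: ev power2_eq_square del: sum.lessThan_Suc)
  also have "\<dots> = e" using v1 by (simp add: sum_distrib_left[symmetric] del: sum.lessThan_Suc)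
  finally have e: "0 \<le> e" using Suc.prems unfolding psd_mat_iff_qform by metis
  obtain H where H: "H \<in> carrier_mat (Suc n) (Suc n)" "transpose_mat H = H" "H * H = 1\<^sub>m (Suc n)"
    and Hn: "\<And>i. i < Suc n \<Longrightarrow> H $$ (i, n) = v i"
    using orthogonal_mat_with_last_col[OF v1] by blast
  define B where "B = H * T * H"
  have psdB: "psd_mat (Suc n) B"
    using psd_mat_congruence[OF Suc.prems H(1)] H(2) by (simp add: B_def)
  then have B: "B \<in> carrier_mat (Suc n) (Suc n)" "transpose_mat B = B" by (auto simp: psd_mat_def)
  \<comment> \<open>\<open>H\<close> sends e_n to v and, being an involution, v back to e_n; hence
    the last column of \<open>H * T * H\<close> is a multiple of e_n.\<close>
  have Bn: "B $$ (i, n) = (if i = n then e else 0)" if i: "i < Suc n" for i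
  proof -
    have TH: "(T * H) $$ (k, n) = e * H $$ (k, n)" if "k < Suc n" for k
      using index_mult_mat_sum[OF T(1) H(1) that, of n] ev[OF that] that by (simp add: Hn)
    have "B $$ (i, n) = (H * (T * H)) $$ (i, n)" using H(1) T(1) by (simp add: B_def)
    also have "\<dots> = (\<Sum>k<Suc n. H $$ (i, k) * (T * H) $$ (k, n))"
      using H(1) T(1) i by (intro index_mult_mat_sum) auto
    also have "\<dots> = e * (\<Sum>k<Suc n. H $$ (i, k) * H $$ (k, n))"
      unfolding sum_distrib_left by (intro sum.cong refl) (simp add: TH del: index_mult_mat)
    also have "(\<Sum>k<Suc n. H $$ (i, k) * H $$ (k, n)) = (H * H) $$ (i, n)"
      using H(1) i by (intro index_mult_mat_sum[symmetric]) auto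
    finally show ?thesis using i by (simp add: H(3))
  qed
  obtain S' where S': "psd_mat n S'" "S' * S' = mat n n (\<lambda>(i, j). B $$ (i, j))"
    using Suc.IH[OF psd_mat_leading[OF psdB]] by blast
  have cS': "S' \<in> carrier_mat n n" "transpose_mat S' = S'" using S' by (auto simp: psd_mat_def)
  define R where "R = mat (Suc n) (Suc n)
    (\<lambda>(i, j). if i < n \<and> j < n then S' $$ (i, j) else if i = n \<and> j = n then sqrt e else 0)"
  have R: "R \<in> carrier_mat (Suc n) (Suc n)" by (simp add: R_def)
  have symR: "transpose_mat R = R"
    by (rule symmetric_matI[OF R]) (auto simp: R_def symmetric_mat_index[OF cS'])
  have "qform (Suc n) R u = qform n S' u + sqrt e * (u n)\<^sup>2" for u
    unfolding qform_Suc[OF R symR] by (auto simp: qform_def R_def)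
  then have psdR: "psd_mat (Suc n) R"
    using S'(1) e R symR by (simp add: psd_mat_iff_qform)
  have RR: "R * R = B"
  proof (rule eq_matI)
    fix i j assume "i < dim_row B" "j < dim_col B"
    then have ij: "i < Suc n" "j < Suc n" using B by auto
    have 1: "(R * R) $$ (i, j) = (\<Sum>k<n. R $$ (i, k) * R $$ (k, j)) + R $$ (i, n) * R $$ (n, j)"
      using index_mult_mat_sum[OF R R ij] by simp
    have sq: "(\<Sum>k<n. S' $$ (i, k) * S' $$ (k, j)) = B $$ (i, j)" if "i < n" "j < n"
      using index_mult_mat_sum[OF cS'(1) cS'(1) that] S'(2) that by simp
    show "(R * R) $$ (i, j) = B $$ (i, j)"
    proof (cases "i < n \<and> j < n")
      case True
      then show ?thesis using sq unfolding 1 by (simp add: R_def)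
    next
      case False
      then show ?thesis unfolding 1
        using ij e Bn[of i] Bn[of j] symmetric_mat_index[OF B, of n j]
        by (auto simp: R_def less_Suc_eq)
    qed
  qed (use R B in auto)
  define S where "S = H * R * H"
  have "psd_mat (Suc n) S" using psd_mat_congruence[OF psdR H(1)] H(2) by (simp add: S_def)
  moreover have "S * S = T"
  proof -
    have "S * S = H * R * (H * H) * R * H"
      using H(1) R by (simp add: S_def assoc_mult_mat[of _ "Suc n" "Suc n" _ "Suc n" _ "Suc n"])
    also have "\<dots> = H * (R * R) * H"
      using H(1) R by (simp add: H(3) assoc_mult_mat[of _ "Suc n" "Suc n" _ "Suc n" _ "Suc n"])
    also have "\<dots> = (H * H) * T * (H * H)"
      using H(1) T(1) by (simp add: RR B_def assoc_mult_mat[of _ "Suc n" "Suc n" _ "Suc n" _ "Suc n"])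
    finally show ?thesis using T(1) by (simp add: H(3))
  qed
  ultimately show ?case by blast
qed

lemma mtrace_mult_commute:
  assumes "A \<in> carrier_mat n m" "B \<in> carrier_mat m n"
  shows "mtrace (A * B) = mtrace (B * A)"
  unfolding mtrace_mult[OF assms] mtrace_mult[OF assms(2,1)] by (subst sum.swap) (simp add: mult.commute)

lemma mtrace_add:
  "A \<in> carrier_mat n n \<Longrightarrow> B \<in> carrier_mat n n \<Longrightarrow> mtrace (A + B) = mtrace A + mtrace B"
  by (simp add: mtrace_def sum.distrib)

lemma mtrace_transpose_mult_self_nonneg:
  "A \<in> carrier_mat n m \<Longrightarrow> 0 \<le> mtrace (transpose_mat A * A)"
  by (subst mtrace_mult[of _ m n]) (auto intro!: sum_nonneg)

lemma mtrace_transpose_mult_self_eq_0: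
  assumes A: "A \<in> carrier_mat n m" and 0: "mtrace (transpose_mat A * A) = 0"
  shows "A = 0\<^sub>m n m"
proof (rule eq_matI)
  have "(\<Sum>j<m. \<Sum>i<n. (A $$ (i, j))\<^sup>2) = 0"
    using 0 A by (subst (asm) mtrace_mult[of _ m n]) (auto simp: power2_eq_square)
  moreover fix i j assume "i < dim_row (0\<^sub>m n m :: real mat)" "j < dim_col (0\<^sub>m n m :: real mat)"
  then have "i < n" "j < m" by auto
  ultimately show "A $$ (i, j) = 0\<^sub>m n m $$ (i, j)"
    by (simp add: sum_nonneg_eq_0_iff sum_nonneg)
qed (use A in auto)

text \<open>With \<open>D = S1 - S2\<close>, the relation \<open>S1 D + D S2 = 0\<close> gives \<open>tr (D S1 D) + tr (D S2 D) = 0\<close>;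
  taking roots of \<open>S1\<close> and \<open>S2\<close> yields \<open>S1 D = S2 D = 0\<close>, hence \<open>D\<^sup>2 = 0\<close>.\<close>

lemma psd_mat_sqrt_unique:
  assumes S1: "psd_mat n S1" and S2: "psd_mat n S2" and eq: "S1 * S1 = S2 * S2"
  shows "S1 = S2"
proof -
  obtain R1 R2 where R1: "psd_mat n R1" "R1 * R1 = S1" and R2: "psd_mat n R2" "R2 * R2 = S2"
    using psd_mat_sqrt_exists[OF S1] psd_mat_sqrt_exists[OF S2] by blast
  have c[simp]: "S1 \<in> carrier_mat n n" "S2 \<in> carrier_mat n n" "R1 \<in> carrier_mat n n" "R2 \<in> carrier_mat n n"
    and t: "transpose_mat S1 = S1" "transpose_mat S2 = S2" "transpose_mat R1 = R1" "transpose_mat R2 = R2"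
    using S1 S2 R1 R2 by (auto simp: psd_mat_def)
  define D where "D = S1 - S2"
  have D[simp]: "D \<in> carrier_mat n n" by (simp add: D_def minus_carrier_mat)
  have tD: "transpose_mat D = D" by (simp add: D_def transpose_minus[of _ n n] t)
  have tr: "mtrace (transpose_mat (R * D) * (R * D)) = mtrace (D * (S * D))"
    if "R \<in> carrier_mat n n" "transpose_mat R = R" "R * R = S" for R S
  proof -
    have "transpose_mat (R * D) * (R * D) = D * R * (R * D)"
      using that by (simp add: transpose_mult[of _ n n _ n] tD)
    also have "\<dots> = D * (S * D)"
      using that by (simp add: assoc_mult_mat[of _ n n _ n _ n] flip: that(3))
    finally show ?thesis by simp
  qed
  have "S1 * D + D * S2 = 0\<^sub>m n n"
  proof -
    have "S1 * D = S1 * S1 - S1 * S2" "D * S2 = S1 * S2 - S2 * S2"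
      unfolding D_def using mult_minus_distrib_mat[of S1 n n S1 n S2] minus_mult_distrib_mat[of S1 n n S2 S2 n]
      by auto
    then have "S1 * D + D * S2 = (S2 * S2 - S1 * S2) + (S1 * S2 - S2 * S2)" using eq by simp
    also have "\<dots> = 0\<^sub>m n n" using carrier_matD[OF c(1)] carrier_matD[OF c(2)]
      by (intro eq_matI) (auto simp del: index_mult_mat(1))
    finally show ?thesis .
  qed
  then have "D * (S1 * D) + D * (D * S2) = 0\<^sub>m n n"
    using mult_add_distrib_mat[OF D mult_carrier_mat[OF c(1) D] mult_carrier_mat[OF D c(2)]] right_mult_zero_mat[OF D]
    by simp
  then have "mtrace (D * (S1 * D)) + mtrace (D * (D * S2)) = 0"
    using mtrace_add[OF mult_carrier_mat[OF D mult_carrier_mat[OF c(1) D]]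
        mult_carrier_mat[OF D mult_carrier_mat[OF D c(2)]]] by (simp add: mtrace_def)
  moreover have "mtrace (D * (D * S2)) = mtrace (D * (S2 * D))"
    using mtrace_mult_commute[OF D mult_carrier_mat[OF D c(2)]] by (simp add: assoc_mult_mat[of _ n n _ n _ n])
  ultimately have "mtrace (transpose_mat (R1 * D) * (R1 * D)) + mtrace (transpose_mat (R2 * D) * (R2 * D)) = 0"
    by (simp add: tr[of R1 S1] tr[of R2 S2] t R1 R2)
  moreover have "0 \<le> mtrace (transpose_mat (R1 * D) * (R1 * D))" "0 \<le> mtrace (transpose_mat (R2 * D) * (R2 * D))"
    using mtrace_transpose_mult_self_nonneg[OF mult_carrier_mat[OF c(3) D]]
      mtrace_transpose_mult_self_nonneg[OF mult_carrier_mat[OF c(4) D]] by blast+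
  ultimately have "mtrace (transpose_mat (R1 * D) * (R1 * D)) = 0" "mtrace (transpose_mat (R2 * D) * (R2 * D)) = 0"
    by linarith+
  then have "R1 * D = 0\<^sub>m n n" "R2 * D = 0\<^sub>m n n"
    using mtrace_transpose_mult_self_eq_0[OF mult_carrier_mat[OF c(3) D]]
      mtrace_transpose_mult_self_eq_0[OF mult_carrier_mat[OF c(4) D]] by blast+
  then have "S1 * D = 0\<^sub>m n n" "S2 * D = 0\<^sub>m n n"
    unfolding R1(2)[symmetric] R2(2)[symmetric] by (simp_all add: assoc_mult_mat[of _ n n _ n _ n] right_mult_zero_mat[of _ n n])
  then have "transpose_mat D * D = 0\<^sub>m n n"
    unfolding tD using minus_mult_distrib_mat[of S1 n n S2 D n] by (simp add: D_def[symmetric])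
  then have "D = 0\<^sub>m n n"
    by (intro mtrace_transpose_mult_self_eq_0) (auto simp: mtrace_def)
  show ?thesis
  proof (rule eq_matI)
    fix i j assume ij: "i < dim_row S2" "j < dim_col S2"
    then have ij: "i < n" "j < n" using carrier_matD[OF c(2)] by auto
    then have "D $$ (i, j) = S1 $$ (i, j) - S2 $$ (i, j)" using carrier_matD[OF c(1)] carrier_matD[OF c(2)] by (simp add: D_def)
    with \<open>D = 0\<^sub>m n n\<close> ij show "S1 $$ (i, j) = S2 $$ (i, j)" by simp
  qed (use carrier_matD[OF c(1)] carrier_matD[OF c(2)] in auto)
qed

lemma msqrt_psd:
  assumes "psd_mat n T"
  shows "psd_mat n (msqrt n T)" "msqrt n T * msqrt n T = T"
proof -
  have "\<exists>!S. psd_mat n S \<and> S * S = T"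
    using psd_mat_sqrt_exists[OF assms] psd_mat_sqrt_unique by metis
  from theI'[OF this] show "psd_mat n (msqrt n T)" "msqrt n T * msqrt n T = T"
    by (simp_all add: msqrt_def)
qed

section \<open>Determinant inequalities and block matrices\<close>

lemma det_mono_qform:
  assumes A: "pd_mat n A" and B: "pd_mat n B" and le: "\<And>v. qform n A v \<le> qform n B v"
  shows "det A \<le> det B"
proof -
  have "ennreal (sqrt (pi ^ n / det B)) \<le> ennreal (sqrt (pi ^ n / det A))"
    unfolding nn_integral_gaussian_qform[OF inj_on_id A, symmetric] nn_integral_gaussian_qform[OF inj_on_id B, symmetric]
    by (intro nn_integral_mono) (simp add: le)
  then have "pi ^ n / det B \<le> pi ^ n / det A"
    using pd_mat_det_pos[OF A] by (simp add: ennreal_le_iff)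
  then show ?thesis using pd_mat_det_pos[OF A] pd_mat_det_pos[OF B] by (simp add: field_simps)
qed

text \<open>By convexity of exp, the Gaussian integrand at the midpoint form is at most the mean of
  the two others. Their integrals coincide when the determinants do, and a smaller Gaussian integral
  means a larger determinant.\<close>

lemma det_le_det_midpoint:
  assumes A: "pd_mat n A" and B: "pd_mat n B" and C: "pd_mat n C" and AB: "det A = det B"
    and mid: "\<And>v. qform n C v = (qform n A v + qform n B v) / 2"
  shows "det A \<le> det C"
proof -
  let ?M = "PiM (id ` {..<n}) (\<lambda>_. lborel :: real measure)"
  let ?g = "\<lambda>Q y. ennreal (exp (- qform n Q (\<lambda>i. y (id i))))"
  have m: "?g Q \<in> borel_measurable ?M" for Q
    by (intro measurable_compose[OF _ measurable_ennreal] measurable_compose[OF _ borel_measurable_exp]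
        borel_measurable_uminus borel_measurable_qform measurable_component_lborel) auto
  have amgm: "2 * exp (- ((a + b) / 2)) \<le> exp (- a) + exp (- b)" for a b :: real
  proof -
    have "0 \<le> (exp (- a / 2) - exp (- b / 2))\<^sup>2" by simp
    also have "\<dots> = exp (- a) + exp (- b) - 2 * exp (- ((a + b) / 2))"
      by (simp add: power2_diff exp_double[symmetric] mult_exp_exp power2_eq_square field_simps)
    finally show ?thesis by simp
  qed
  have "2 * ennreal (sqrt (pi ^ n / det C)) = (\<integral>\<^sup>+y. 2 * ?g C y \<partial>?M)"
    by (simp only: nn_integral_cmult[OF m] nn_integral_gaussian_qform[OF inj_on_id C])
  also have "\<dots> \<le> (\<integral>\<^sup>+y. ?g A y + ?g B y \<partial>?M)"
  proof (rule nn_integral_mono)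
    fix y :: "nat \<Rightarrow> real"
    have "2 * ?g C y = ennreal (2 * exp (- qform n C (\<lambda>i. y (id i))))" by (simp add: ennreal_mult')
    also have "\<dots> \<le> ennreal (exp (- qform n A (\<lambda>i. y (id i))) + exp (- qform n B (\<lambda>i. y (id i))))"
      unfolding mid by (rule ennreal_leI[OF amgm])
    finally show "2 * ?g C y \<le> ?g A y + ?g B y" by (simp add: ennreal_plus)
  qed
  also have "\<dots> = 2 * ennreal (sqrt (pi ^ n / det A))"
    by (simp only: nn_integral_add[OF m m] nn_integral_gaussian_qform[OF inj_on_id A]
        nn_integral_gaussian_qform[OF inj_on_id B] AB mult_2)
  finally have "ennreal (2 * sqrt (pi ^ n / det C)) \<le> ennreal (2 * sqrt (pi ^ n / det A))"
    by (simp add: ennreal_mult')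
  then have "pi ^ n / det C \<le> pi ^ n / det A"
    using pd_mat_det_pos[OF A] by (simp add: ennreal_le_iff)
  then show ?thesis using pd_mat_det_pos[OF A] pd_mat_det_pos[OF C] by (simp add: field_simps)
qed

text \<open>Fischer's inequality: \<open>W\<close> and its conjugate by the diagonal sign matrix have the same determinant,
  and their midpoint is the block diagonal part of \<open>W\<close>.\<close>

lemma det_fischer:
  fixes P :: "nat \<Rightarrow> bool"
  assumes W: "pd_mat n W"
  shows "det W \<le> det (mat n n (\<lambda>(i, j). if P i \<and> P j then W $$ (i, j) else if i = j then 1 else 0)) *
    det (mat n n (\<lambda>(i, j). if \<not> P i \<and> \<not> P j then W $$ (i, j) else if i = j then 1 else 0))"
    (is "_ \<le> det ?V1 * det ?V2")
proof -
  have cW: "W \<in> carrier_mat n n" "transpose_mat W = W" using W by (auto simp: pd_mat_def)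
  define s :: "nat \<Rightarrow> real" where "s i = (if P i then 1 else -1)" for i
  have ss: "s i * s i = 1" for i by (simp add: s_def)
  define E where "E = mat n n (\<lambda>(i, j). if i = j then s i else 0)"
  have E: "E \<in> carrier_mat n n" by (simp add: E_def)
  have tE: "transpose_mat E = E" by (rule symmetric_matI[OF E]) (auto simp: E_def)
  have EM: "(E * M) $$ (i, j) = s i * M $$ (i, j)" if "M \<in> carrier_mat n n" "i < n" "j < n" for M i j
  proof -
    have "(E * M) $$ (i, j) = (\<Sum>k<n. if k = i then s i * M $$ (i, j) else 0)"
      unfolding index_mult_mat_sum[OF E that] using that by (intro sum.cong) (auto simp: E_def)
    then show ?thesis using that by simp
  qed
  have ME: "(M * E) $$ (i, j) = M $$ (i, j) * s j" if "M \<in> carrier_mat n n" "i < n" "j < n" for M i j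
  proof -
    have "(M * E) $$ (i, j) = (\<Sum>k<n. if k = j then M $$ (i, j) * s j else 0)"
      unfolding index_mult_mat_sum[OF that(1) E that(2,3)] using that by (intro sum.cong) (auto simp: E_def)
    then show ?thesis using that by simp
  qed
  have "E * E = 1\<^sub>m n"
    by (rule eq_matI) (use E in \<open>auto simp: EM simp del: index_mult_mat(1)\<close>, auto simp: E_def ss)
  then have dE: "det E * det E = 1" using det_mult[OF E E] by simp
  define W' where "W' = transpose_mat E * W * E"
  have pdW': "pd_mat n W'" unfolding W'_def using dE by (intro pd_mat_congruence[OF W E]) auto
  have dW': "det W = det W'"
    using dE cW E by (simp add: W'_def tE det_mult[of _ n] mult_ac)
  have W': "W' $$ (i, j) = s i * s j * W $$ (i, j)" if "i < n" "j < n" for i j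
    using that E cW(1) by (simp add: W'_def tE ME EM del: index_mult_mat(1))
  define V where "V = mat n n (\<lambda>(i, j). if P i = P j then W $$ (i, j) else 0)"
  have mid: "qform n V v = (qform n W v + qform n W' v) / 2" for v
  proof -
    have "qform n W v + qform n W' v = (\<Sum>i<n. \<Sum>j<n. 2 * (V $$ (i, j) * v i * v j))"
      unfolding qform_def sum.distrib[symmetric] by (intro sum.cong refl) (auto simp: W' V_def s_def)
    then show ?thesis by (simp add: qform_def sum_distrib_left[symmetric])
  qed
  have pdV: "pd_mat n V"
  proof -
    have "transpose_mat V = V"
      by (rule symmetric_matI[of _ n]) (auto simp: V_def symmetric_mat_index[OF cW])
    moreover have "0 < qform n V v" if "\<exists>i<n. v i \<noteq> 0" for v
    proof -
      have "0 < qform n W v" "0 < qform n W' v" using W pdW' that unfolding pd_mat_iff_qform by blast+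
      then show ?thesis unfolding mid by simp
    qed
    moreover have "V \<in> carrier_mat n n" by (simp add: V_def)
    ultimately show ?thesis by (simp add: pd_mat_iff_qform)
  qed
  have "det W \<le> det V" by (rule det_le_det_midpoint[OF W pdW' pdV dW' mid])
  \<comment> \<open>Each factor keeps one diagonal block and is the identity on the other indices,
    so principal minors appear as determinants of full size without reindexing.\<close>
  also have "V = ?V1 * ?V2"
  proof (rule eq_matI)
    fix i j assume "i < dim_row (?V1 * ?V2)" "j < dim_col (?V1 * ?V2)"
    then have ij: "i < n" "j < n" by auto
    have 1: "(?V1 * ?V2) $$ (i, j) = (\<Sum>k<n. ?V1 $$ (i, k) * ?V2 $$ (k, j))"
      by (rule index_mult_mat_sum) (use ij in auto)
    show "V $$ (i, j) = (?V1 * ?V2) $$ (i, j)"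
    proof (cases "P i")
      case True
      have "(\<Sum>k<n. ?V1 $$ (i, k) * ?V2 $$ (k, j)) = (\<Sum>k<n. if k = j then V $$ (i, j) else 0)"
        using ij True by (intro sum.cong refl) (auto simp: V_def)
      then show ?thesis unfolding 1 using ij by simp
    next
      case False
      have "(\<Sum>k<n. ?V1 $$ (i, k) * ?V2 $$ (k, j)) = (\<Sum>k<n. if k = i then V $$ (i, j) else 0)"
        using ij False by (intro sum.cong refl) (auto simp: V_def)
      then show ?thesis unfolding 1 using ij by simp
    qed
  qed (auto simp: V_def)
  also have "det (?V1 * ?V2) = det ?V1 * det ?V2" by (rule det_mult[of _ n]) auto
  finally show ?thesis .
qed

text \<open>Sylvester's identity: the determinant of one block matrix is evaluated by the Schur
  complement of its lower block, and again after a unipotent factor makes it block lower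
  triangular.\<close>

lemma det_one_plus_mult_commute:
  fixes A B :: "'a :: idom mat"
  assumes A: "A \<in> carrier_mat n n" and B: "B \<in> carrier_mat n n"
  shows "det (1\<^sub>m n + A * B) = det (1\<^sub>m n + B * A)"
proof -
  let ?M = "four_block_mat (1\<^sub>m n) (- A) B (1\<^sub>m n)"
  let ?U = "four_block_mat (1\<^sub>m n) A (0\<^sub>m n n) (1\<^sub>m n)"
  have "det ?M = det (1\<^sub>m n * 1\<^sub>m n - (- A) * B)"
    using A B by (intro det_four_block_mat) auto
  also have "1\<^sub>m n * 1\<^sub>m n - (- A) * B = 1\<^sub>m n + A * B"
    using A B by (intro eq_matI) (auto simp: uminus_scalar_prod)
  finally have 1: "det ?M = det (1\<^sub>m n + A * B)" .
  have "?M * ?U = four_block_mat (1\<^sub>m n) (0\<^sub>m n n) B (B * A + 1\<^sub>m n)"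
    using A B by (subst mult_four_block_mat[of _ n n _ n _ n _ _ n _ n]) (auto intro!: arg_cong4[of _ _ _ _ _ _ _ _ four_block_mat])
  then have "det (?M * ?U) = det (B * A + 1\<^sub>m n)"
    using A B by (simp add: det_four_block_mat_upper_right_zero[of _ n _ n])
  moreover have "det (?M * ?U) = det ?M * det ?U" using A B by (intro det_mult[of _ "n + n"]) auto
  moreover have "det ?U = 1" using A by (simp add: det_four_block_mat_lower_left_zero[of _ n _ n])
  moreover have "B * A + 1\<^sub>m n = 1\<^sub>m n + B * A" using A B by (intro comm_add_mat[of _ n n]) auto
  ultimately show ?thesis using 1 by simp
qed

section \<open>Block indices and block diagonal matrices\<close>

lemma blk_off_Suc: "1 \<le> i \<Longrightarrow> blk_off ps (Suc i) = blk_off ps i + ps i"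
  by (simp add: blk_off_def)

lemma blk_off_1[simp]: "blk_off ps (Suc 0) = 0"
  by (simp add: blk_off_def)

lemma blk_off_mono: "i \<le> j \<Longrightarrow> blk_off ps i \<le> blk_off ps j"
  unfolding blk_off_def by (intro sum_mono2) auto

lemma blk_off_add_less:
  assumes "i \<in> {1..d}" "a < ps i"
  shows "blk_off ps i + a < blk_off ps (Suc d)"
  using assms blk_off_mono[of "Suc i" "Suc d" ps] blk_off_Suc[of i ps] by simp

lemma blk_index_cases:
  assumes "a < blk_off ps (Suc d)"
  obtains i a' where "i \<in> {1..d}" "a' < ps i" "a = blk_off ps i + a'"
proof -
  have "\<exists>i\<in>{1..d}. \<exists>a'<ps i. a = blk_off ps i + a'"
    using assms
  proof (induction d)
    case (Suc d)
    show ?case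
    proof (cases "a < blk_off ps (Suc d)")
      case True
      then show ?thesis using Suc.IH by fastforce
    next
      case False
      then have "a - blk_off ps (Suc d) < ps (Suc d)" "a = blk_off ps (Suc d) + (a - blk_off ps (Suc d))"
        using Suc.prems blk_off_Suc[of "Suc d" ps] by auto
      then show ?thesis by fastforce
    qed
  qed simp
  then show thesis using that by blast
qed

lemma blk_index_less:
  assumes "1 \<le> i" "i < j" "a < ps i"
  shows "blk_off ps i + a < blk_off ps j"
  using assms blk_off_mono[of "Suc i" j ps] blk_off_Suc[of i ps] by simp

lemma sum_blocks:
  fixes g :: "nat \<Rightarrow> 'a :: comm_monoid_add"
  shows "(\<Sum>a<blk_off ps (Suc d). g a) = (\<Sum>i\<in>{1..d}. \<Sum>a<ps i. g (blk_off ps i + a))"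
proof (induction d)
  case (Suc d)
  have "(\<Sum>a<m + l. g a) = (\<Sum>a<m. g a) + (\<Sum>a<l. g (m + a))" for m l
    by (induction l) (simp_all add: add.assoc)
  then show ?case using Suc blk_off_Suc[of "Suc d" ps] by simp
qed simp

text \<open>A position lies in at most one diagonal block, so the sum has at most one nonzero term.
  This form avoids recovering the block number from an index.\<close>

definition blk_diag :: "(nat \<Rightarrow> nat) \<Rightarrow> nat \<Rightarrow> (nat \<Rightarrow> real mat) \<Rightarrow> real mat" where
  "blk_diag ps d t = mat (blk_off ps (Suc d)) (blk_off ps (Suc d)) (\<lambda>(a, b). \<Sum>i\<in>{1..d}.
     if blk_off ps i \<le> a \<and> a < blk_off ps (Suc i) \<and> blk_off ps i \<le> b \<and> b < blk_off ps (Suc i)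
     then t i $$ (a - blk_off ps i, b - blk_off ps i) else 0)"

lemma blk_diag_carrier[simp]: "blk_diag ps d t \<in> carrier_mat (blk_off ps (Suc d)) (blk_off ps (Suc d))"
  by (simp add: blk_diag_def)

lemma blk_diag_index:
  assumes i: "i \<in> {1..d}" "a < ps i" and j: "j \<in> {1..d}" "b < ps j"
  shows "blk_diag ps d t $$ (blk_off ps i + a, blk_off ps j + b) = (if i = j then t i $$ (a, b) else 0)"
proof -
  have in_blk: "blk_off ps k \<le> blk_off ps l + c \<and> blk_off ps l + c < blk_off ps (Suc k) \<longleftrightarrow> k = l"
    if "k \<in> {1..d}" "l \<in> {1..d}" "c < ps l" for k l c
  proof
    assume H: "blk_off ps k \<le> blk_off ps l + c \<and> blk_off ps l + c < blk_off ps (Suc k)"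
    show "k = l"
    proof (rule ccontr)
      assume "k \<noteq> l"
      then consider "k < l" | "l < k" by linarith
      then show False
      proof cases
        case 1
        then show ?thesis using H blk_off_mono[of "Suc k" l ps] by simp
      next
        case 2
        then show ?thesis using H blk_index_less[of l k c ps] that by simp
      qed
    qed
  qed (use that blk_off_Suc[of l ps] in auto)
  have "blk_diag ps d t $$ (blk_off ps i + a, blk_off ps j + b) = (\<Sum>k\<in>{1..d}.
     if blk_off ps k \<le> blk_off ps i + a \<and> blk_off ps i + a < blk_off ps (Suc k) \<and>
       blk_off ps k \<le> blk_off ps j + b \<and> blk_off ps j + b < blk_off ps (Suc k)
     then t k $$ (blk_off ps i + a - blk_off ps k, blk_off ps j + b - blk_off ps k) else 0)"
    using blk_off_add_less[of i d a ps] blk_off_add_less[of j d b ps] i j by (simp add: blk_diag_def)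
  also have "\<dots> = (\<Sum>k\<in>{1..d}. if k = i then (if i = j then t i $$ (a, b) else 0) else 0)"
  proof (rule sum.cong[OF refl])
    fix k assume k: "k \<in> {1..d}"
    show "(if blk_off ps k \<le> blk_off ps i + a \<and> blk_off ps i + a < blk_off ps (Suc k) \<and>
       blk_off ps k \<le> blk_off ps j + b \<and> blk_off ps j + b < blk_off ps (Suc k)
     then t k $$ (blk_off ps i + a - blk_off ps k, blk_off ps j + b - blk_off ps k) else 0) =
     (if k = i then (if i = j then t i $$ (a, b) else 0) else 0)"
      using in_blk[OF k i(1) i(2)] in_blk[OF k j(1) j(2)] by (cases "k = i"; cases "k = j") auto
  qed
  finally show ?thesis using i by simp
qed

lemma blk_diag_mult_index:
  assumes M: "M \<in> carrier_mat (blk_off ps (Suc d)) m" and i: "i \<in> {1..d}" "a < ps i" and c: "c < m"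
  shows "(blk_diag ps d t * M) $$ (blk_off ps i + a, c) = (\<Sum>b<ps i. t i $$ (a, b) * M $$ (blk_off ps i + b, c))"
proof -
  have "(blk_diag ps d t * M) $$ (blk_off ps i + a, c) =
     (\<Sum>k<blk_off ps (Suc d). blk_diag ps d t $$ (blk_off ps i + a, k) * M $$ (k, c))"
    by (rule index_mult_mat_sum[OF blk_diag_carrier M blk_off_add_less[of i d a ps, OF i] c])
  also have "\<dots> = (\<Sum>j\<in>{1..d}. if j = i then (\<Sum>b<ps i. t i $$ (a, b) * M $$ (blk_off ps i + b, c)) else 0)"
    unfolding sum_blocks by (intro sum.cong refl) (use i in \<open>auto simp: blk_diag_index\<close>)
  finally show ?thesis using i by simp
qed

lemma eq_mat_blkI:
  assumes "A \<in> carrier_mat (blk_off ps (Suc d)) (blk_off ps (Suc d))"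
    "B \<in> carrier_mat (blk_off ps (Suc d)) (blk_off ps (Suc d))"
    "\<And>i j a b. i \<in> {1..d} \<Longrightarrow> j \<in> {1..d} \<Longrightarrow> a < ps i \<Longrightarrow> b < ps j \<Longrightarrow>
      A $$ (blk_off ps i + a, blk_off ps j + b) = B $$ (blk_off ps i + a, blk_off ps j + b)"
  shows "A = B"
proof (rule eq_matI)
  fix a b assume "a < dim_row B" "b < dim_col B"
  then have "a < blk_off ps (Suc d)" "b < blk_off ps (Suc d)" using assms(2) by auto
  then show "A $$ (a, b) = B $$ (a, b)" by (elim blk_index_cases) (simp add: assms(3))
qed (use assms in auto)

lemma transpose_blk_diag:
  assumes "\<And>i. i \<in> {1..d} \<Longrightarrow> t i \<in> carrier_mat (ps i) (ps i) \<and> transpose_mat (t i) = t i"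
  shows "transpose_mat (blk_diag ps d t) = blk_diag ps d t"
proof (rule eq_mat_blkI)
  fix i j a b assume ij: "i \<in> {1..d}" "j \<in> {1..d}" "a < ps i" "b < ps j"
  have "blk_off ps i + a < blk_off ps (Suc d)" "blk_off ps j + b < blk_off ps (Suc d)"
    using ij by (auto intro!: blk_off_add_less)
  then have "transpose_mat (blk_diag ps d t) $$ (blk_off ps i + a, blk_off ps j + b) =
      blk_diag ps d t $$ (blk_off ps j + b, blk_off ps i + a)"
    by (simp add: carrier_matD[OF blk_diag_carrier])
  then show "transpose_mat (blk_diag ps d t) $$ (blk_off ps i + a, blk_off ps j + b) =
      blk_diag ps d t $$ (blk_off ps i + a, blk_off ps j + b)"
    using ij assms[of i] symmetric_mat_index[of "t i" "ps i" a b]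
    by (auto simp: blk_diag_index)
qed auto

lemma blk_diag_mult:
  assumes "\<And>i. i \<in> {1..d} \<Longrightarrow> t i \<in> carrier_mat (ps i) (ps i)" "\<And>i. i \<in> {1..d} \<Longrightarrow> s i \<in> carrier_mat (ps i) (ps i)"
  shows "blk_diag ps d t * blk_diag ps d s = blk_diag ps d (\<lambda>i. t i * s i)"
proof (rule eq_mat_blkI)
  fix i j a b assume ij: "i \<in> {1..d}" "j \<in> {1..d}" "a < ps i" "b < ps j"
  then have "(blk_diag ps d t * blk_diag ps d s) $$ (blk_off ps i + a, blk_off ps j + b) =
      (\<Sum>c<ps i. t i $$ (a, c) * (if i = j then s i $$ (c, b) else 0))"
    by (simp add: blk_diag_mult_index[OF blk_diag_carrier] blk_off_add_less blk_diag_index del: index_mult_mat)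
  also have "\<dots> = (if i = j then (t i * s i) $$ (a, b) else 0)"
    using ij index_mult_mat_sum[OF assms(1)[of i] assms(2)[of i], of a b] by auto
  finally show "(blk_diag ps d t * blk_diag ps d s) $$ (blk_off ps i + a, blk_off ps j + b) =
      blk_diag ps d (\<lambda>i. t i * s i) $$ (blk_off ps i + a, blk_off ps j + b)"
    using ij by (simp add: blk_diag_index del: index_mult_mat)
qed (auto intro!: mult_carrier_mat[OF blk_diag_carrier blk_diag_carrier])

lemma mtrace_blk_diag_mult:
  assumes X: "X \<in> carrier_mat (blk_off ps (Suc d)) (blk_off ps (Suc d))"
    and t: "\<And>i. i \<in> {1..d} \<Longrightarrow> t i \<in> carrier_mat (ps i) (ps i)"
  shows "mtrace (blk_diag ps d t * X) = (\<Sum>i\<in>{1..d}. mtrace (blk ps X i i * t i))"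
proof -
  have "mtrace (blk_diag ps d t * X) = (\<Sum>a<blk_off ps (Suc d). (blk_diag ps d t * X) $$ (a, a))"
    by (simp add: mtrace_def carrier_matD[OF blk_diag_carrier] del: index_mult_mat(1))
  also have "\<dots> = (\<Sum>i\<in>{1..d}. \<Sum>a<ps i. \<Sum>b<ps i. t i $$ (a, b) * X $$ (blk_off ps i + b, blk_off ps i + a))"
    unfolding sum_blocks
    by (intro sum.cong refl) (simp add: blk_diag_mult_index[OF X] blk_off_add_less del: index_mult_mat)
  also have "\<dots> = (\<Sum>i\<in>{1..d}. mtrace (blk ps X i i * t i))"
  proof (rule sum.cong[OF refl])
    fix i assume i: "i \<in> {1..d}"
    have "mtrace (blk ps X i i * t i) = mtrace (t i * blk ps X i i)"
      using t[OF i] by (intro mtrace_mult_commute[of _ "ps i" "ps i"]) (auto simp: blk_def)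
    then show "(\<Sum>a<ps i. \<Sum>b<ps i. t i $$ (a, b) * X $$ (blk_off ps i + b, blk_off ps i + a)) = mtrace (blk ps X i i * t i)"
      using mtrace_mult[OF t[OF i], of "blk ps X i i"] by (simp add: blk_def)
  qed
  finally show ?thesis .
qed

lemma qform_blk_diag:
  "qform (blk_off ps (Suc d)) (blk_diag ps d t) v = (\<Sum>i\<in>{1..d}. qform (ps i) (t i) (\<lambda>a. v (blk_off ps i + a)))"
proof -
  have "qform (blk_off ps (Suc d)) (blk_diag ps d t) v = (\<Sum>i\<in>{1..d}. \<Sum>a<ps i. \<Sum>j\<in>{1..d}.
      if j = i then (\<Sum>b<ps i. t i $$ (a, b) * v (blk_off ps i + a) * v (blk_off ps i + b)) else 0)"
    unfolding qform_def sum_blocks by (intro sum.cong refl) (auto simp: blk_diag_index)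
  also have "\<dots> = (\<Sum>i\<in>{1..d}. qform (ps i) (t i) (\<lambda>a. v (blk_off ps i + a)))"
    unfolding qform_def by (rule sum.cong[OF refl]) simp
  finally show ?thesis .
qed

lemma psd_mat_blk_diag:
  assumes "\<And>i. i \<in> {1..d} \<Longrightarrow> psd_mat (ps i) (t i)"
  shows "psd_mat (blk_off ps (Suc d)) (blk_diag ps d t)"
proof -
  have "transpose_mat (blk_diag ps d t) = blk_diag ps d t"
    using assms by (intro transpose_blk_diag) (simp add: psd_mat_def)
  moreover have "0 \<le> qform (blk_off ps (Suc d)) (blk_diag ps d t) v" for v
    unfolding qform_blk_diag using assms by (intro sum_nonneg) (simp add: psd_mat_iff_qform)
  ultimately show ?thesis by (simp add: psd_mat_iff_qform)
qed

lemma pd_mat_blk: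
  assumes X: "pd_mat (blk_off ps (Suc d)) X" and i: "i \<in> {1..d}"
  shows "pd_mat (ps i) (blk ps X i i)"
proof -
  have cX: "X \<in> carrier_mat (blk_off ps (Suc d)) (blk_off ps (Suc d))" "transpose_mat X = X"
    using X by (auto simp: pd_mat_def)
  have "0 < qform (ps i) (blk ps X i i) v" if v: "\<exists>a<ps i. v a \<noteq> 0" for v
  proof -
    \<comment> \<open>The test vector on block \<open>i\<close> extended by zero to all
      indices.\<close>
    define u where "u k = (if blk_off ps i \<le> k \<and> k < blk_off ps (Suc i) then v (k - blk_off ps i) else 0)" for k
    have u: "u (blk_off ps j + a) = (if j = i then v a else 0)" if "j \<in> {1..d}" "a < ps j" for j a
      using that i blk_off_mono[of "Suc i" j ps] blk_index_less[of j i a ps] blk_off_Suc[of i ps]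
      by (cases i j rule: linorder_cases) (auto simp: u_def)
    have "\<exists>k<blk_off ps (Suc d). u k \<noteq> 0" using v u[OF i] blk_off_add_less[OF i] by metis
    then have "0 < qform (blk_off ps (Suc d)) X u" using X by (simp add: pd_mat_iff_qform)
    also have "\<dots> = (\<Sum>j\<in>{1..d}. \<Sum>a<ps j. \<Sum>l\<in>{1..d}. \<Sum>b<ps l.
        X $$ (blk_off ps j + a, blk_off ps l + b) * u (blk_off ps j + a) * u (blk_off ps l + b))"
      by (simp only: qform_def sum_blocks)
    also have "\<dots> = (\<Sum>j\<in>{1..d}. if j = i then (\<Sum>a<ps i. \<Sum>b<ps i.
        X $$ (blk_off ps i + a, blk_off ps i + b) * v a * v b) else 0)"
    proof (rule sum.cong[OF refl])
      fix j assume j: "j \<in> {1..d}"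
      have "(\<Sum>l\<in>{1..d}. \<Sum>b<ps l. X $$ (r, blk_off ps l + b) * c * u (blk_off ps l + b)) =
          (\<Sum>l\<in>{1..d}. if l = i then (\<Sum>b<ps i. X $$ (r, blk_off ps i + b) * c * v b) else 0)" for r c
        by (rule sum.cong[OF refl]) (auto simp: u)
      then have inner: "(\<Sum>l\<in>{1..d}. \<Sum>b<ps l. X $$ (r, blk_off ps l + b) * c * u (blk_off ps l + b)) =
          (\<Sum>b<ps i. X $$ (r, blk_off ps i + b) * c * v b)" for r c using i by simp
      show "(\<Sum>a<ps j. \<Sum>l\<in>{1..d}. \<Sum>b<ps l.
        X $$ (blk_off ps j + a, blk_off ps l + b) * u (blk_off ps j + a) * u (blk_off ps l + b)) =
        (if j = i then (\<Sum>a<ps i. \<Sum>b<ps i. X $$ (blk_off ps i + a, blk_off ps i + b) * v a * v b) else 0)"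
        unfolding inner using j by (auto simp: u)
    qed
    also have "\<dots> = qform (ps i) (blk ps X i i) v" using i by (simp add: qform_def blk_def)
    finally show ?thesis .
  qed
  moreover have "transpose_mat (blk ps X i i) = blk ps X i i"
    using i by (intro symmetric_matI[of _ "ps i"]) (auto simp: blk_def symmetric_mat_index[OF cX] blk_off_add_less)
  ultimately show ?thesis by (simp add: pd_mat_iff_qform blk_def)
qed

text \<open>The last block column vanishes above its diagonal block, so that block splits off and
  the induction continues with the leading part.\<close>

lemma det_blk_lower_triangular:
  assumes "A \<in> carrier_mat (blk_off ps (Suc d)) (blk_off ps (Suc d))"
    and "\<And>i j a b. i \<in> {1..d} \<Longrightarrow> j \<in> {1..d} \<Longrightarrow> i < j \<Longrightarrow> a < ps i \<Longrightarrow> b < ps j \<Longrightarrow>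
      A $$ (blk_off ps i + a, blk_off ps j + b) = 0"
  shows "det A = (\<Prod>i\<in>{1..d}. det (blk ps A i i))"
  using assms
proof (induction d arbitrary: A)
  case 0
  then show ?case by (simp add: det_dim_zero)
next
  case (Suc d)
  let ?m = "blk_off ps (Suc d)"
  have off: "blk_off ps (Suc (Suc d)) = ?m + ps (Suc d)" by (rule blk_off_Suc) simp
  define A1 where "A1 = mat ?m ?m (\<lambda>(i, j). A $$ (i, j))"
  define A3 where "A3 = mat (ps (Suc d)) ?m (\<lambda>(i, j). A $$ (?m + i, j))"
  have "A = four_block_mat A1 (0\<^sub>m ?m (ps (Suc d))) A3 (blk ps A (Suc d) (Suc d))"
  proof (rule eq_matI)
    fix a b assume "a < dim_row (four_block_mat A1 (0\<^sub>m ?m (ps (Suc d))) A3 (blk ps A (Suc d) (Suc d)))"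
      "b < dim_col (four_block_mat A1 (0\<^sub>m ?m (ps (Suc d))) A3 (blk ps A (Suc d) (Suc d)))"
    then have ab: "a < ?m + ps (Suc d)" "b < ?m + ps (Suc d)" by (auto simp: A1_def blk_def)
    have "A $$ (a, b) = 0" if le: "a < ?m" "?m \<le> b"
    proof -
      obtain i a' where "i \<in> {1..d}" "a' < ps i" "a = blk_off ps i + a'" using le(1) by (rule blk_index_cases)
      then show ?thesis using Suc.prems(2)[of i "Suc d" a' "b - ?m"] le ab by auto
    qed
    then show "A $$ (a, b) = four_block_mat A1 (0\<^sub>m ?m (ps (Suc d))) A3 (blk ps A (Suc d) (Suc d)) $$ (a, b)"
      using ab by (auto simp: A1_def A3_def blk_def)
  qed (use Suc.prems(1) off in \<open>auto simp: A1_def blk_def\<close>)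
  then have "det A = det A1 * det (blk ps A (Suc d) (Suc d))"
    by (metis A1_def A3_def blk_def det_four_block_mat_upper_right_zero mat_carrier)
  also have "det A1 = (\<Prod>i\<in>{1..d}. det (blk ps A1 i i))"
  proof (rule Suc.IH)
    fix i j a b assume H: "i \<in> {1..d}" "j \<in> {1..d}" "i < j" "a < ps i" "b < ps j"
    then show "A1 $$ (blk_off ps i + a, blk_off ps j + b) = 0"
      using Suc.prems(2)[of i j a b] by (simp add: A1_def blk_off_add_less)
  qed (simp add: A1_def)
  also have "\<dots> = (\<Prod>i\<in>{1..d}. det (blk ps A i i))"
  proof (rule prod.cong[OF refl])
    fix i assume "i \<in> {1..d}"
    then have "blk ps A1 i i = blk ps A i i"
      by (intro eq_matI) (auto simp: blk_def A1_def blk_off_add_less)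
    then show "det (blk ps A1 i i) = det (blk ps A i i)" by simp
  qed
  finally show ?case by simp
qed

section \<open>Bounds for determinants of the form det (I + B)\<close>

lemma qform_one: "qform n (1\<^sub>m n) v = (\<Sum>i<n. (v i)\<^sup>2)"
proof -
  have "qform n (1\<^sub>m n) v = (\<Sum>i<n. \<Sum>j<n. if j = i then v i * v i else 0)"
    unfolding qform_def by (intro sum.cong refl) auto
  then show ?thesis by (simp add: power2_eq_square)
qed

lemma qform_add:
  "A \<in> carrier_mat n n \<Longrightarrow> B \<in> carrier_mat n n \<Longrightarrow> qform n (A + B) v = qform n A v + qform n B v"
  by (simp add: qform_def sum.distrib distrib_right)

lemma qform_smult: "A \<in> carrier_mat n n \<Longrightarrow> qform n (c \<cdot>\<^sub>m A) v = c * qform n A v"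
  by (simp add: qform_def sum_distrib_left algebra_simps)

lemma qform_mult_transpose:
  assumes X: "X \<in> carrier_mat n n"
  shows "qform n (X * transpose_mat X) v = (\<Sum>k<n. (\<Sum>i<n. X $$ (i, k) * v i)\<^sup>2)"
proof -
  have "qform n (X * transpose_mat X) v = (\<Sum>i<n. \<Sum>j<n. \<Sum>k<n. X $$ (i, k) * v i * (X $$ (j, k) * v j))"
    unfolding qform_def
  proof (intro sum.cong refl)
    fix i j assume ij: "i \<in> {..<n}" "j \<in> {..<n}"
    then have "(X * transpose_mat X) $$ (i, j) = (\<Sum>k<n. X $$ (i, k) * X $$ (j, k))"
      using X by (subst index_mult_mat_sum[OF X, of _ n]) auto
    then show "(X * transpose_mat X) $$ (i, j) * v i * v j = (\<Sum>k<n. X $$ (i, k) * v i * (X $$ (j, k) * v j))"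
      by (simp add: sum_distrib_left algebra_simps)
  qed
  also have "\<dots> = (\<Sum>i<n. \<Sum>k<n. \<Sum>j<n. X $$ (i, k) * v i * (X $$ (j, k) * v j))"
    by (rule sum.cong[OF refl], rule sum.swap)
  also have "\<dots> = (\<Sum>k<n. \<Sum>i<n. \<Sum>j<n. X $$ (i, k) * v i * (X $$ (j, k) * v j))"
    by (rule sum.swap)
  finally show ?thesis by (simp add: power2_eq_square sum_product)
qed

lemma pd_mat_one: "pd_mat n (1\<^sub>m n)"
proof -
  have "0 < (\<Sum>i<n. (v i)\<^sup>2)" if "\<exists>i<n. v i \<noteq> 0" for v :: "nat \<Rightarrow> real"
    using that by (auto intro!: sum_pos2)
  then show ?thesis by (simp add: pd_mat_iff_qform qform_one)
qed

lemma pd_mat_add_psd_mat: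
  assumes A: "pd_mat n A" and B: "psd_mat n B"
  shows "pd_mat n (A + B)"
proof -
  have c: "A \<in> carrier_mat n n" "B \<in> carrier_mat n n" using A B by (auto simp: pd_mat_def psd_mat_def)
  have "transpose_mat (A + B) = A + B"
    using A B c by (simp add: transpose_add[of _ n n] pd_mat_def psd_mat_def)
  moreover have "0 < qform n (A + B) v" if "\<exists>i<n. v i \<noteq> 0" for v
  proof -
    have "0 < qform n A v" "0 \<le> qform n B v"
      using A B that unfolding pd_mat_iff_qform psd_mat_iff_qform by blast+
    then show ?thesis by (simp add: qform_add[OF c])
  qed
  ultimately show ?thesis using c by (simp add: pd_mat_iff_qform)
qed

lemma psd_mat_smult:
  assumes A: "psd_mat n A" and c: "0 \<le> c"
  shows "psd_mat n (c \<cdot>\<^sub>m A)"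
proof -
  have cA: "A \<in> carrier_mat n n" "transpose_mat A = A" using A by (auto simp: psd_mat_def)
  have "transpose_mat (c \<cdot>\<^sub>m A) = c \<cdot>\<^sub>m A"
    using cA by (intro symmetric_matI[of _ n]) (auto simp: symmetric_mat_index[OF cA])
  then show ?thesis using A c by (simp add: psd_mat_iff_qform qform_smult)
qed

lemma pd_mat_imp_psd_mat: "pd_mat n A \<Longrightarrow> psd_mat n A"
proof -
  assume A: "pd_mat n A"
  have "0 \<le> qform n A v" for v
  proof (cases "\<exists>i<n. v i \<noteq> 0")
    case True
    then show ?thesis using A unfolding pd_mat_iff_qform by (metis less_imp_le)
  next
    case False
    then have "qform n A v = 0" by (auto simp: qform_def)
    then show ?thesis by simp
  qed
  with A show ?thesis by (simp add: psd_mat_iff_qform pd_mat_iff_qform)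
qed

lemma det_one_plus_square_le:
  fixes N :: "real mat"
  assumes N: "N \<in> carrier_mat n n"
  shows "(det (1\<^sub>m n + N))\<^sup>2 \<le> 2 ^ n * det (1\<^sub>m n + N * transpose_mat N)"
proof -
  have NN: "N * transpose_mat N \<in> carrier_mat n n" using N by simp
  have "psd_mat n (transpose_mat (transpose_mat N) * 1\<^sub>m n * transpose_mat N)"
    using N by (intro psd_mat_congruence[OF pd_mat_imp_psd_mat[OF pd_mat_one]]) simp
  then have "psd_mat n (N * transpose_mat N)" using N by simp
  then have pd: "pd_mat n (1\<^sub>m n + N * transpose_mat N)" by (intro pd_mat_add_psd_mat pd_mat_one)
  define X where "X = 1\<^sub>m n + N"
  have X: "X \<in> carrier_mat n n" using N by (simp add: X_def)
  have dX: "det (X * transpose_mat X) = (det X)\<^sup>2"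
    using X det_mult[of X n "transpose_mat X"] det_transpose[OF X] by (simp add: power2_eq_square)
  \<comment> \<open>X X^T is positive definite only for nonsingular \<open>X\<close>; in the
    singular case the left-hand side is zero.\<close>
  show ?thesis
  proof (cases "det X = 0")
    case True
    then show ?thesis using pd_mat_det_pos[OF pd] by (simp add: X_def)
  next
    case False
    have "pd_mat n (transpose_mat (transpose_mat X) * 1\<^sub>m n * transpose_mat X)"
      using X False by (intro pd_mat_congruence[OF pd_mat_one]) (auto simp: det_transpose)
    then have pdX: "pd_mat n (X * transpose_mat X)" using X by simp
    have "det (X * transpose_mat X) \<le> det (2 \<cdot>\<^sub>m (1\<^sub>m n + N * transpose_mat N))"
    proof (rule det_mono_qform[OF pdX pd_mat_smult[OF pd]])
      fix v :: "nat \<Rightarrow> real"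
      have e: "(\<Sum>i<n. X $$ (i, k) * v i) = v k + (\<Sum>i<n. N $$ (i, k) * v i)" if "k < n" for k
      proof -
        have "(\<Sum>i<n. X $$ (i, k) * v i) = (\<Sum>i<n. (if i = k then v k else 0) + N $$ (i, k) * v i)"
          using that N by (intro sum.cong refl) (auto simp: X_def algebra_simps)
        then show ?thesis using that by (simp add: sum.distrib)
      qed
      have "qform n (X * transpose_mat X) v = (\<Sum>k<n. (v k + (\<Sum>i<n. N $$ (i, k) * v i))\<^sup>2)"
        unfolding qform_mult_transpose[OF X] by (intro sum.cong refl) (simp add: e)
      also have "\<dots> \<le> (\<Sum>k<n. 2 * ((v k)\<^sup>2 + (\<Sum>i<n. N $$ (i, k) * v i)\<^sup>2))"
      proof (rule sum_mono)
        fix k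
        have "(a + b)\<^sup>2 \<le> 2 * (a\<^sup>2 + b\<^sup>2)" for a b :: real
          using sum_squares_bound[of a b] by (simp add: power2_sum)
        then show "(v k + (\<Sum>i<n. N $$ (i, k) * v i))\<^sup>2 \<le> 2 * ((v k)\<^sup>2 + (\<Sum>i<n. N $$ (i, k) * v i)\<^sup>2)" .
      qed
      also have "\<dots> = qform n (2 \<cdot>\<^sub>m (1\<^sub>m n + N * transpose_mat N)) v"
        using N NN by (simp add: qform_smult qform_add qform_one qform_mult_transpose sum_distrib_left[symmetric]
            sum.distrib)
      finally show "qform n (X * transpose_mat X) v \<le> qform n (2 \<cdot>\<^sub>m (1\<^sub>m n + N * transpose_mat N)) v" .
    qed simp
    then show ?thesis unfolding dX using N by (simp add: X_def)
  qed
qed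

text \<open>Connects the form in which the determinant arises as a Laplace transform, linear in
  \<open>T\<close>, with the symmetric form to which the determinant inequalities apply.\<close>

lemma det_one_plus_sqrt:
  fixes R \<Sigma> :: "real mat"
  assumes R: "R \<in> carrier_mat n n" and S: "\<Sigma> \<in> carrier_mat n n" and T: "R * R = T"
  shows "det (1\<^sub>m n + 2 \<cdot>\<^sub>m (T * \<Sigma>)) = det (1\<^sub>m n + 2 \<cdot>\<^sub>m (R * \<Sigma> * R))"
proof -
  have "2 \<cdot>\<^sub>m (T * \<Sigma>) = R * (2 \<cdot>\<^sub>m (R * \<Sigma>))"
    unfolding T[symmetric] using mult_smult_distrib[OF R mult_carrier_mat[OF R S], of 2] assoc_mult_mat[OF R R S]
    by simp
  moreover have "2 \<cdot>\<^sub>m (R * \<Sigma>) * R = 2 \<cdot>\<^sub>m (R * \<Sigma> * R)"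
    using R S mult_smult_assoc_mat[of "R * \<Sigma>" n n R n] by simp
  ultimately show ?thesis
    using det_one_plus_mult_commute[OF R, of "2 \<cdot>\<^sub>m (R * \<Sigma>)"] R S by simp
qed

lemma pd_mat_one_plus:
  assumes R: "R \<in> carrier_mat n n" "transpose_mat R = R" and S: "pd_mat n \<Sigma>"
  shows "pd_mat n (1\<^sub>m n + 2 \<cdot>\<^sub>m (R * \<Sigma> * R))"
  using psd_mat_congruence[OF pd_mat_imp_psd_mat[OF S] R(1)] unfolding R(2)
  by (intro pd_mat_add_psd_mat[OF pd_mat_one] psd_mat_smult) simp_all

lemma det_one_plus_pos:
  assumes T: "psd_mat n T" and S: "pd_mat n \<Sigma>"
  shows "0 < det (1\<^sub>m n + 2 \<cdot>\<^sub>m (T * \<Sigma>))"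
proof -
  obtain R where R: "psd_mat n R" "R * R = T" using psd_mat_sqrt_exists[OF T] by blast
  then have cR: "R \<in> carrier_mat n n" "transpose_mat R = R" and cS: "\<Sigma> \<in> carrier_mat n n"
    using S by (auto simp: psd_mat_def pd_mat_def)
  show ?thesis unfolding det_one_plus_sqrt[OF cR(1) cS R(2)]
    by (rule pd_mat_det_pos[OF pd_mat_one_plus[OF cR S]])
qed

text \<open>Since \<open>R\<close> does not mix indices inside and outside \<open>P\<close>, the
  entries of R \<Sigma> R within one part involve only the restriction of \<open>R\<close> to that
  part. Thus both factors in \<open>det_fischer\<close> are again of the shape I + 2 Q \<Sigma> Q;
  the inner fact \<open>restrict\<close> treats \<open>P\<close> and its complement at once.\<close>

lemma det_one_plus_fischer:
  fixes P :: "nat \<Rightarrow> bool"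
  assumes R: "R \<in> carrier_mat n n" "transpose_mat R = R" and S: "pd_mat n \<Sigma>"
    and R0: "\<And>i j. i < n \<Longrightarrow> j < n \<Longrightarrow> P i \<noteq> P j \<Longrightarrow> R $$ (i, j) = 0"
    and R1: "R1 \<in> carrier_mat n n" "\<And>i j. i < n \<Longrightarrow> j < n \<Longrightarrow> R1 $$ (i, j) = (if P i \<and> P j then R $$ (i, j) else 0)"
    and R2: "R2 \<in> carrier_mat n n" "\<And>i j. i < n \<Longrightarrow> j < n \<Longrightarrow> R2 $$ (i, j) = (if \<not> P i \<and> \<not> P j then R $$ (i, j) else 0)"
  shows "det (1\<^sub>m n + 2 \<cdot>\<^sub>m (R * \<Sigma> * R)) \<le>
    det (1\<^sub>m n + 2 \<cdot>\<^sub>m (R1 * \<Sigma> * R1)) * det (1\<^sub>m n + 2 \<cdot>\<^sub>m (R2 * \<Sigma> * R2))"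
proof -
  have cS: "\<Sigma> \<in> carrier_mat n n" using S by (simp add: pd_mat_def)
  have entry: "(Q * \<Sigma> * Q) $$ (i, j) = (\<Sum>l<n. \<Sum>k<n. Q $$ (i, k) * \<Sigma> $$ (k, l) * Q $$ (l, j))"
    if "Q \<in> carrier_mat n n" "i < n" "j < n" for Q i j
  proof -
    have "(Q * \<Sigma> * Q) $$ (i, j) = (\<Sum>l<n. (Q * \<Sigma>) $$ (i, l) * Q $$ (l, j))"
      using that cS by (intro index_mult_mat_sum) auto
    also have "\<dots> = (\<Sum>l<n. \<Sum>k<n. Q $$ (i, k) * \<Sigma> $$ (k, l) * Q $$ (l, j))"
      by (intro sum.cong refl) (simp add: index_mult_mat_sum[OF that(1) cS] that sum_distrib_right del: index_mult_mat)
    finally show ?thesis .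
  qed
  have restrict: "mat n n (\<lambda>(i, j). if F i \<and> F j then (1\<^sub>m n + 2 \<cdot>\<^sub>m (R * \<Sigma> * R)) $$ (i, j) else if i = j then 1 else 0) =
      1\<^sub>m n + 2 \<cdot>\<^sub>m (Q * \<Sigma> * Q)"
    if Q: "Q \<in> carrier_mat n n" "\<And>i j. i < n \<Longrightarrow> j < n \<Longrightarrow> Q $$ (i, j) = (if F i \<and> F j then R $$ (i, j) else 0)"
      and F: "\<And>i j. i < n \<Longrightarrow> j < n \<Longrightarrow> F i \<noteq> F j \<Longrightarrow> R $$ (i, j) = 0" for Q F
  proof (rule eq_matI)
    fix i j assume "i < dim_row (1\<^sub>m n + 2 \<cdot>\<^sub>m (Q * \<Sigma> * Q))" "j < dim_col (1\<^sub>m n + 2 \<cdot>\<^sub>m (Q * \<Sigma> * Q))"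
    then have ij: "i < n" "j < n" using Q(1) by auto
    have "(Q * \<Sigma> * Q) $$ (i, j) = (if F i \<and> F j then (R * \<Sigma> * R) $$ (i, j) else 0)"
    proof (cases "F i \<and> F j")
      case True
      then have "Q $$ (i, k) = R $$ (i, k)" "Q $$ (k, j) = R $$ (k, j)" if "k < n" for k
        using F[of i k] F[of k j] that ij by (auto simp: Q(2))
      then show ?thesis using True by (simp add: entry[OF Q(1) ij] entry[OF R(1) ij])
    next
      case False
      then have "Q $$ (i, k) * \<Sigma> $$ (k, l) * Q $$ (l, j) = 0" if "k < n" "l < n" for k l
        using that ij by (auto simp: Q(2))
      then have "(\<Sum>l<n. \<Sum>k<n. Q $$ (i, k) * \<Sigma> $$ (k, l) * Q $$ (l, j)) = 0"
        by (intro sum.neutral ballI) auto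
      then show ?thesis unfolding entry[OF Q(1) ij] if_not_P[OF False] .
    qed
    then show "mat n n (\<lambda>(i, j). if F i \<and> F j then (1\<^sub>m n + 2 \<cdot>\<^sub>m (R * \<Sigma> * R)) $$ (i, j) else if i = j then 1 else 0) $$ (i, j) =
        (1\<^sub>m n + 2 \<cdot>\<^sub>m (Q * \<Sigma> * Q)) $$ (i, j)"
      using ij Q(1) R(1) cS by (auto simp del: index_mult_mat(1))
  qed (use Q in auto)
  show ?thesis
    using det_fischer[OF pd_mat_one_plus[OF R S], of P] restrict[of R1 P] restrict[of R2 "\<lambda>i. \<not> P i"] R1 R2 R0 by simp
qed

section \<open>Laplace transform of the Wishart distribution\<close>

text \<open>Congruence of \<Sigma> by its inverse B gives B^T \<Sigma> B = B^T. So B^T is positive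
  definite, therefore symmetric, and only then is it identified with B.\<close>

lemma pd_mat_minv_pd:
  assumes S: "pd_mat n \<Sigma>"
  shows "pd_mat n (minv n \<Sigma>)"
proof -
  note H = pd_mat_minv[OF S]
  have cS: "\<Sigma> \<in> carrier_mat n n" using S by (simp add: pd_mat_def)
  have "det \<Sigma> * det (minv n \<Sigma>) = 1" using det_mult[OF cS H(1)] H(2) by simp
  then have "pd_mat n (transpose_mat (minv n \<Sigma>) * \<Sigma> * minv n \<Sigma>)"
    using H by (intro pd_mat_congruence[OF S]) auto
  also have "transpose_mat (minv n \<Sigma>) * \<Sigma> * minv n \<Sigma> = transpose_mat (minv n \<Sigma>)"
    using H cS by (simp add: assoc_mult_mat[of _ n n _ n _ n])
  finally have pd: "pd_mat n (transpose_mat (minv n \<Sigma>))" .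
  then have "transpose_mat (transpose_mat (minv n \<Sigma>)) = transpose_mat (minv n \<Sigma>)" by (simp add: pd_mat_def)
  with pd show ?thesis by simp
qed

lemma multigamma_pos:
  assumes "(real n - 1) / 2 < a"
  shows "0 < multigamma n a"
proof -
  have "0 < Gamma (a - (real i - 1) / 2)" if "i \<in> {1..n}" for i
    using that assms by (intro Gamma_real_pos) (auto simp: field_simps)
  then show ?thesis unfolding multigamma_def by (intro mult_pos_pos prod_pos) auto
qed

text \<open>The factor etr(-T X) merely shifts the rate matrix of the density by \<open>T\<close>.
  The quotient of the two normalising constants is the stated power because (2 A) \<Sigma> = I + 2 T
  \<Sigma> for the shifted rate A.\<close>

lemma wishart_expect_etr:
  assumes S: "pd_mat p \<Sigma>" and T: "psd_mat p T" and alpha: "real p - 1 < \<alpha>"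
  shows "wishart_expect p \<alpha> \<Sigma> (\<lambda>X. ennreal (exp (- mtrace (T * X)))) =
    ennreal (det (1\<^sub>m p + 2 \<cdot>\<^sub>m (T * \<Sigma>)) powr (- (\<alpha> / 2)))"
proof -
  note H = pd_mat_minv[OF S]
  have c: "\<Sigma> \<in> carrier_mat p p" "T \<in> carrier_mat p p" using S T by (auto simp: pd_mat_def psd_mat_def)
  define A where "A = (1 / 2) \<cdot>\<^sub>m minv p \<Sigma> + T"
  have cA: "A \<in> carrier_mat p p" using c H by (simp add: A_def)
  have pdA: "pd_mat p A" unfolding A_def
    by (intro pd_mat_add_psd_mat[OF _ T] pd_mat_smult pd_mat_minv_pd S) simp
  define K where "K = 2 powr (real p * \<alpha> / 2) * det \<Sigma> powr (\<alpha> / 2) * multigamma p (\<alpha> / 2)"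
  have mg: "0 < multigamma p (\<alpha> / 2)" using alpha by (intro multigamma_pos) simp
  have dS: "0 < det \<Sigma>" and dA: "0 < det A" using pd_mat_det_pos S pdA by blast+
  have K: "0 < K" using mg dS by (simp add: K_def)
  have tr: "mtrace (A * X) = mtrace (minv p \<Sigma> * X) / 2 + mtrace (T * X)" if X: "X \<in> carrier_mat p p" for X
  proof -
    have "mtrace (A * X) = (\<Sum>i<p. \<Sum>j<p. minv p \<Sigma> $$ (i, j) * X $$ (j, i) / 2 + T $$ (i, j) * X $$ (j, i))"
      unfolding mtrace_mult[OF cA X] using c H
      by (intro sum.cong refl) (simp add: A_def distrib_right)
    then show ?thesis
      by (simp add: mtrace_mult[OF H(1) X] mtrace_mult[OF c(2) X] sum_divide_distrib sum.distrib)
  qed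
  have "wishart_expect p \<alpha> \<Sigma> (\<lambda>X. ennreal (exp (- mtrace (T * X)))) =
      (\<integral>\<^sup>+ f. ennreal (1 / K) * gamma_integrand p (\<alpha> / 2) A f \<partial>sym_lebesgue p)"
    unfolding wishart_expect_def
  proof (rule nn_integral_cong)
    fix f :: "nat \<times> nat \<Rightarrow> real"
    let ?X = "sym_of p f"
    have "wishart_dens p \<alpha> \<Sigma> ?X * exp (- mtrace (T * ?X)) =
        1 / K * (det ?X powr (\<alpha> / 2 - (real p + 1) / 2) * exp (- mtrace (A * ?X)))"
      by (simp add: wishart_dens_def tr K_def[symmetric] mult_exp_exp)
    then show "(if pd_mat p ?X then ennreal (wishart_dens p \<alpha> \<Sigma> ?X) * ennreal (exp (- mtrace (T * ?X))) else 0) =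
        ennreal (1 / K) * gamma_integrand p (\<alpha> / 2) A f"
      using K by (simp add: gamma_integrand_def ennreal_mult'[symmetric] ennreal_mult''[symmetric])
  qed
  also have "\<dots> = ennreal (1 / K) * ennreal (multigamma p (\<alpha> / 2) * det A powr (- (\<alpha> / 2)))"
    using borel_measurable_gamma_integrand[OF cA] nn_integral_gamma_integrand[OF pdA, of "\<alpha> / 2"] alpha
    by (subst nn_integral_cmult) (simp_all add: sym_lebesgue_def)
  also have "\<dots> = ennreal (1 / K * (multigamma p (\<alpha> / 2) * det A powr (- (\<alpha> / 2))))"
    using K by (intro ennreal_mult'[symmetric]) simp
  also have "1 / K * (multigamma p (\<alpha> / 2) * det A powr (- (\<alpha> / 2))) = (2 ^ p * det A * det \<Sigma>) powr (- (\<alpha> / 2))"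
  proof -
    have "(2 ^ p :: real) powr (- (\<alpha> / 2)) = 1 / 2 powr (real p * \<alpha> / 2)"
      by (simp add: powr_realpow[symmetric] powr_powr powr_minus_divide)
    then show ?thesis using mg dS dA
      by (simp add: K_def powr_mult powr_minus_divide)
  qed
  also have "2 ^ p * det A * det \<Sigma> = det (1\<^sub>m p + 2 \<cdot>\<^sub>m (T * \<Sigma>))"
  proof -
    have "(2 \<cdot>\<^sub>m A) * \<Sigma> = 1\<^sub>m p + 2 \<cdot>\<^sub>m (T * \<Sigma>)"
    proof -
      have "2 \<cdot>\<^sub>m A = minv p \<Sigma> + 2 \<cdot>\<^sub>m T" using c H by (intro eq_matI) (auto simp: A_def)
      then show ?thesis
        using c H by (simp add: add_mult_distrib_mat[of _ p p] mult_smult_assoc_mat[of _ p p])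
    qed
    moreover have "det ((2 \<cdot>\<^sub>m A) * \<Sigma>) = 2 ^ p * det A * det \<Sigma>"
      using cA c by (subst det_mult[of _ p]) auto
    ultimately show ?thesis by simp
  qed
  finally show ?thesis .
qed

section \<open>Expectations as integrals over the representing measures\<close>

text \<open>For a non-measurable \<open>g\<close> the integral is a supremum over simple functions
  below it; dividing by a nonzero finite \<open>e\<close> takes those below \<open>e * g\<close> to
  functions below \<open>g\<close>.\<close>

lemma nn_integral_cmult_le:
  fixes g :: "'a \<Rightarrow> ennreal"
  assumes e: "e < \<infinity>"
  shows "(\<integral>\<^sup>+x. e * g x \<partial>M) \<le> e * (\<integral>\<^sup>+x. g x \<partial>M)"
proof (cases "e = 0")
  case False
  show ?thesis unfolding nn_integral_def[of M "\<lambda>x. e * g x"]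
  proof (rule SUP_least)
    fix s assume "s \<in> {s. simple_function M s \<and> s \<le> (\<lambda>x. e * g x)}"
    then have s: "simple_function M s" and le: "\<And>x. s x \<le> e * g x" by (auto simp: le_fun_def)
    have [measurable]: "s \<in> borel_measurable M" using s by (rule borel_measurable_simple_function)
    have "integral\<^sup>S M s = integral\<^sup>N M s" using s by (rule nn_integral_eq_simple_integral[symmetric])
    also have "\<dots> = (\<integral>\<^sup>+x. e * (s x / e) \<partial>M)"
      using False e by (intro nn_integral_cong) (simp add: ennreal_times_divide mult.commute[of e] mult_divide_eq_ennreal)
    also have "\<dots> = e * (\<integral>\<^sup>+x. s x / e \<partial>M)" by (rule nn_integral_cmult) measurable
    also have "\<dots> \<le> e * (\<integral>\<^sup>+x. g x \<partial>M)"
    proof (intro mult_left_mono nn_integral_mono)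
      fix x
      have "s x / e \<le> g x * e / e" using le[of x] by (intro divide_right_mono_ennreal) (simp add: mult.commute)
      then show "s x / e \<le> g x" using False e by (simp add: mult_divide_eq_ennreal)
    qed simp
    finally show "integral\<^sup>S M s \<le> e * (\<integral>\<^sup>+x. g x \<partial>M)" .
  qed
qed simp

context product_sigma_finite
begin

text \<open>The factors \<open>g i\<close> need not be measurable, in which case their integrals are lower integrals.\<close>

lemma nn_integral_PiM_le_prod:
  fixes g :: "'i \<Rightarrow> 'a \<Rightarrow> ennreal"
  assumes "finite I" "H \<in> borel_measurable (PiM I M)" "c < \<infinity>"
    and "\<And>i. i \<in> I \<Longrightarrow> AE x in M i. P i x"
    and "\<And>i x. i \<in> I \<Longrightarrow> g i x < \<infinity>"
    and "\<And>i. i \<in> I \<Longrightarrow> (\<integral>\<^sup>+x. g i x \<partial>M i) < \<infinity>"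
    and "\<And>x. x \<in> space (PiM I M) \<Longrightarrow> (\<And>i. i \<in> I \<Longrightarrow> P i (x i)) \<Longrightarrow> H x \<le> c * (\<Prod>i\<in>I. g i (x i))"
  shows "integral\<^sup>N (PiM I M) H \<le> c * (\<Prod>i\<in>I. \<integral>\<^sup>+x. g i x \<partial>M i)"
  using assms
proof (induction I arbitrary: H c rule: finite_induct)
  case empty
  then show ?case by (simp add: PiM_empty nn_integral_count_space_finite)
next
  case (insert i I)
  let ?C = "\<Prod>j\<in>I. \<integral>\<^sup>+x. g j x \<partial>M j"
  have C: "?C < \<infinity>" using insert.prems(5) insert.hyps(1) by (simp add: less_top[symmetric] ennreal_prod_eq_top)
  have "integral\<^sup>N (PiM (insert i I) M) H = (\<integral>\<^sup>+y. \<integral>\<^sup>+x. H (x(i := y)) \<partial>PiM I M \<partial>M i)"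
    using insert.hyps insert.prems(1) by (intro product_nn_integral_insert_rev)
  also have "\<dots> \<le> (\<integral>\<^sup>+y. (c * ?C) * g i y \<partial>M i)"
  proof (rule nn_integral_mono_AE)
    have "AE y in M i. P i y \<and> y \<in> space (M i)" using insert.prems(3)[of i] by auto
    then show "AE y in M i. (\<integral>\<^sup>+x. H (x(i := y)) \<partial>PiM I M) \<le> (c * ?C) * g i y"
    proof eventually_elim
      case (elim y)
      \<comment> \<open>Once coordinate \<open>i\<close> is frozen, \<open>g i y\<close> is absorbed
        into the constant; this is why \<open>c\<close> varies in the induction and has to stay
        finite.\<close>
      have "(\<integral>\<^sup>+x. H (x(i := y)) \<partial>PiM I M) \<le> (c * g i y) * ?C"
      proof (rule insert.IH)
        show "(\<lambda>x. H (x(i := y))) \<in> borel_measurable (PiM I M)"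
          using elim by (intro measurable_compose[OF measurable_fun_upd[where J = I] insert.prems(1)]) auto
        show "c * g i y < \<infinity>" using insert.prems(2) insert.prems(4)[of i y] by (simp add: ennreal_mult_less_top)
        fix x assume x: "x \<in> space (PiM I M)" "\<And>j. j \<in> I \<Longrightarrow> P j (x j)"
        have "H (x(i := y)) \<le> c * (\<Prod>j\<in>insert i I. g j ((x(i := y)) j))"
        proof (rule insert.prems(6))
          show "x(i := y) \<in> space (PiM (insert i I) M)"
            using x(1) elim by (auto simp: space_PiM PiE_def Pi_def extensional_def)
        qed (use x(2) elim in auto)
        also have "(\<Prod>j\<in>insert i I. g j ((x(i := y)) j)) = g i y * (\<Prod>j\<in>I. g j (x j))"
          using insert.hyps by (auto intro!: arg_cong2[where f = "(*)"] prod.cong)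
        finally show "H (x(i := y)) \<le> c * g i y * (\<Prod>j\<in>I. g j (x j))" by (simp only: mult.assoc)
      qed (use insert.prems in auto)
      then show ?case by (simp add: mult_ac)
    qed
  qed
  also have "\<dots> \<le> (c * ?C) * (\<integral>\<^sup>+y. g i y \<partial>M i)"
    using C insert.prems(2) by (intro nn_integral_cmult_le) (simp add: ennreal_mult_less_top)
  finally show ?case using insert.hyps by (simp add: mult_ac)
qed

text \<open>The cylinder over a null set of one factor is null, since its measure is a finite
  product in \<open>ennreal\<close> with a factor 0, even where other factors are infinite.\<close>

lemma AE_PiM_ball:
  assumes I: "finite I" and P: "\<And>i. i \<in> I \<Longrightarrow> AE x in M i. P i x"
  shows "AE x in PiM I M. \<forall>i\<in>I. P i (x i)"
proof -
  have "AE x in PiM I M. P j (x j)" if j: "j \<in> I" for j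
  proof -
    obtain N where N: "{x \<in> space (M j). \<not> P j x} \<subseteq> N" "emeasure (M j) N = 0" "N \<in> sets (M j)"
      using P[OF j] by (auto elim: AE_E)
    let ?B = "\<lambda>i. if i = j then N else space (M i)"
    have "emeasure (PiM I M) (Pi\<^sub>E I ?B) = (\<Prod>i\<in>I. emeasure (M i) (?B i))"
      using N I by (intro emeasure_PiM) auto
    also have "\<dots> = 0" using j I N by (intro prod_zero) auto
    finally have "emeasure (PiM I M) (Pi\<^sub>E I ?B) = 0" .
    moreover have "Pi\<^sub>E I ?B \<in> sets (PiM I M)" using N I by (intro sets_PiM_I_finite) auto
    moreover have "{x \<in> space (PiM I M). \<not> P j (x j)} \<subseteq> Pi\<^sub>E I ?B"
      using N(1) j by (auto simp: space_PiM PiE_def Pi_def)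
    ultimately show ?thesis by (intro AE_I)
  qed
  then show ?thesis using I by (simp add: AE_finite_all)
qed

end

section \<open>Representing measures and Fubini\<close>

lemma borel_measurable_component_sym_space:
  assumes "sets N = sets (sym_space q)" "a \<le> b" "b < q"
  shows "(\<lambda>x. x (a, b)) \<in> borel_measurable N"
proof -
  have "(\<lambda>x. x (a, b)) \<in> borel_measurable (sym_space q)"
    unfolding sym_space_def using assms by (intro measurable_component_singleton) (simp add: sym_idx_def)
  then show ?thesis using assms(1) by (simp cong: measurable_cong_sets)
qed

text \<open>The weight etr(-X) is strictly positive and has the finite integral \<phi>(I), so its
  superlevel sets have finite measure and exhaust the space.\<close>

lemma cm_rep_sigma_finite:
  assumes rep: "cm_rep q \<phi> \<mu>"
  shows "sigma_finite_measure \<mu>"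
proof -
  have sets: "sets \<mu> = sets (sym_space q)" using rep by (simp add: cm_rep_def)
  define w where "w X = exp (- mtrace (1\<^sub>m q * sym_of q X))" for X
  have [measurable]: "w \<in> borel_measurable \<mu>"
    unfolding w_def
    by (intro measurable_compose[OF _ borel_measurable_exp] borel_measurable_uminus borel_measurable_mtrace_mult[of _ q q]
        borel_measurable_sym_of_index[of q] borel_measurable_component_sym_space[OF sets]) auto
  have "(\<integral>\<^sup>+X. ennreal (w X) \<partial>\<mu>) = ennreal (\<phi> (1\<^sub>m q))"
    using rep pd_mat_one[of q] by (simp add: cm_rep_def w_def)
  then have fin: "(\<integral>\<^sup>+X. ennreal (w X) \<partial>\<mu>) < \<infinity>" by simp
  define A where "A n = {X \<in> space \<mu>. 1 / (real n + 1) \<le> w X}" for n :: nat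
  have A: "A n \<in> sets \<mu>" for n unfolding A_def by measurable
  have "emeasure \<mu> (A n) \<noteq> \<infinity>" for n
  proof -
    have "ennreal (1 / (real n + 1)) * emeasure \<mu> (A n) = (\<integral>\<^sup>+X. ennreal (1 / (real n + 1)) * indicator (A n) X \<partial>\<mu>)"
      using A by (simp add: nn_integral_cmult_indicator)
    also have "\<dots> \<le> (\<integral>\<^sup>+X. ennreal (w X) \<partial>\<mu>)"
      by (intro nn_integral_mono) (auto simp: A_def indicator_def intro!: ennreal_leI)
    finally have "ennreal (1 / (real n + 1)) * emeasure \<mu> (A n) < \<infinity>" using fin by simp
    then show ?thesis by (auto simp: ennreal_mult_less_top less_top ennreal_mult_eq_top_iff)
  qed
  moreover have "(\<Union>n. A n) = space \<mu>"
  proof -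
    have "\<exists>n. 1 / (real n + 1) \<le> w X" for X
    proof -
      have "0 < w X" by (simp add: w_def)
      then obtain n where "inverse (real (Suc n)) < w X" using reals_Archimedean by blast
      then show ?thesis by (intro exI[of _ n]) (simp add: inverse_eq_divide add.commute)
    qed
    then show ?thesis by (auto simp: A_def)
  qed
  ultimately show ?thesis using A by (intro sigma_finite_measure.intro exI[of _ "range A"]) auto
qed

text \<open>Zero blocks outside \<open>J\<close> keep the matrix at full size, so that partial and
  full products of the \<phi>_i lead to determinants that can be compared directly.\<close>

definition blk_sym :: "(nat \<Rightarrow> nat) \<Rightarrow> nat \<Rightarrow> nat set \<Rightarrow> (nat \<Rightarrow> nat \<times> nat \<Rightarrow> real) \<Rightarrow> real mat" where
  "blk_sym ps d J t = blk_diag ps d (\<lambda>i. if i \<in> J then sym_of (ps i) (t i) else 0\<^sub>m (ps i) (ps i))"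

lemma psd_mat_zero: "psd_mat n (0\<^sub>m n n)"
  by (simp add: psd_mat_iff_qform qform_def)

lemma psd_mat_blk_sym:
  assumes "\<And>i. i \<in> J \<Longrightarrow> psd_mat (ps i) (sym_of (ps i) (t i))"
  shows "psd_mat (blk_off ps (Suc d)) (blk_sym ps d J t)"
  unfolding blk_sym_def using assms by (intro psd_mat_blk_diag) (simp add: psd_mat_zero)

lemma blk_sym_carrier[simp]: "blk_sym ps d J t \<in> carrier_mat (blk_off ps (Suc d)) (blk_off ps (Suc d))"
  by (simp add: blk_sym_def)

lemma mtrace_blk_sym_mult:
  assumes X: "X \<in> carrier_mat (blk_off ps (Suc d)) (blk_off ps (Suc d))" and J: "J \<subseteq> {1..d}"
  shows "mtrace (blk_sym ps d J t * X) = (\<Sum>i\<in>J. mtrace (blk ps X i i * sym_of (ps i) (t i)))"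
proof -
  have "mtrace (blk ps X i i * 0\<^sub>m (ps i) (ps i)) = 0" for i
    by (subst mtrace_mult[of _ "ps i" "ps i"]) (auto simp: blk_def)
  then have "mtrace (blk_sym ps d J t * X) =
      (\<Sum>i\<in>{1..d}. if i \<in> J then mtrace (blk ps X i i * sym_of (ps i) (t i)) else 0)"
    unfolding blk_sym_def by (subst mtrace_blk_diag_mult[OF X]) (auto intro!: sum.cong)
  also have "\<dots> = (\<Sum>i\<in>J. mtrace (blk ps X i i * sym_of (ps i) (t i)))"
    using J by (simp add: sum.If_cases Int_absorb1)
  finally show ?thesis .
qed

lemma borel_measurable_blk_sym_index:
  assumes t: "\<And>i a b. i \<in> J \<Longrightarrow> a \<le> b \<Longrightarrow> b < ps i \<Longrightarrow> (\<lambda>z. t z i (a, b)) \<in> borel_measurable N"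
    and ij: "i < blk_off ps (Suc d)" "j < blk_off ps (Suc d)"
  shows "(\<lambda>z. blk_sym ps d J (t z) $$ (i, j)) \<in> borel_measurable N"
proof -
  have "(\<lambda>z. if blk_off ps l \<le> i \<and> i < blk_off ps (Suc l) \<and> blk_off ps l \<le> j \<and> j < blk_off ps (Suc l)
     then (if l \<in> J then sym_of (ps l) (t z l) else 0\<^sub>m (ps l) (ps l)) $$ (i - blk_off ps l, j - blk_off ps l) else 0)
     \<in> borel_measurable N" if l: "l \<in> {1..d}" for l
  proof (cases "blk_off ps l \<le> i \<and> i < blk_off ps (Suc l) \<and> blk_off ps l \<le> j \<and> j < blk_off ps (Suc l)")
    case True
    then have "i - blk_off ps l < ps l" "j - blk_off ps l < ps l" using l blk_off_Suc[of l ps] by auto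
    then show ?thesis using True
      by (cases "l \<in> J") (auto simp del: sym_of_index intro!: borel_measurable_sym_of_index[of "ps l"] t)
  next
    case False
    then show ?thesis by (subst if_not_P) auto
  qed
  then show ?thesis using ij unfolding blk_sym_def blk_diag_def by (auto intro!: borel_measurable_sum)
qed

lemma borel_measurable_det_one_plus_blk_sym:
  assumes t: "\<And>i a b. i \<in> J \<Longrightarrow> a \<le> b \<Longrightarrow> b < ps i \<Longrightarrow> (\<lambda>z. t z i (a, b)) \<in> borel_measurable N"
    and S: "\<Sigma> \<in> carrier_mat (blk_off ps (Suc d)) (blk_off ps (Suc d))"
  shows "(\<lambda>z. det (1\<^sub>m (blk_off ps (Suc d)) + 2 \<cdot>\<^sub>m (blk_sym ps d J (t z) * \<Sigma>))) \<in> borel_measurable N"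
proof (rule borel_measurable_det)
  let ?p = "blk_off ps (Suc d)"
  show "1\<^sub>m ?p + 2 \<cdot>\<^sub>m (blk_sym ps d J (t z) * \<Sigma>) \<in> carrier_mat ?p ?p" for z
    by (intro add_carrier_mat smult_carrier_mat mult_carrier_mat[OF blk_sym_carrier S])
  fix i j assume ij: "i < ?p" "j < ?p"
  have "(1\<^sub>m ?p + 2 \<cdot>\<^sub>m (blk_sym ps d J (t z) * \<Sigma>)) $$ (i, j) =
      (if i = j then 1 else 0) + 2 * (\<Sum>k<?p. blk_sym ps d J (t z) $$ (i, k) * \<Sigma> $$ (k, j))" for z
    using ij S index_mult_mat_sum[OF blk_sym_carrier S ij, of J "t z"] carrier_matD[OF blk_sym_carrier[of ps d J "t z"]]
    by (simp del: index_mult_mat(1))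
  then show "(\<lambda>z. (1\<^sub>m ?p + 2 \<cdot>\<^sub>m (blk_sym ps d J (t z) * \<Sigma>)) $$ (i, j)) \<in> borel_measurable N"
    using borel_measurable_blk_sym_index[where t = t and N = N and J = J, OF t ij(1)]
    by (auto intro!: borel_measurable_add borel_measurable_times borel_measurable_sum)
qed

lemma wishart_expect_prod_cm:
  assumes p: "p = blk_off ps (Suc d)" and S: "pd_mat p \<Sigma>" and alpha: "real p - 1 < \<alpha>"
    and J: "J \<subseteq> {1..d}" and psf: "product_sigma_finite \<mu>"
    and rep: "\<And>i. i \<in> J \<Longrightarrow> cm_rep (ps i) (\<phi> i) (\<mu> i)"
    and nonneg: "\<And>i T. i \<in> J \<Longrightarrow> pd_mat (ps i) T \<Longrightarrow> 0 \<le> \<phi> i T"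
  shows "wishart_expect p \<alpha> \<Sigma> (\<lambda>X. ennreal (\<Prod>i\<in>J. \<phi> i (blk ps X i i))) =
    (\<integral>\<^sup>+t. ennreal (det (1\<^sub>m p + 2 \<cdot>\<^sub>m (blk_sym ps d J t * \<Sigma>)) powr (- (\<alpha> / 2))) \<partial>PiM J \<mu>)"
proof -
  interpret product_sigma_finite \<mu> by (rule psf)
  interpret lb: product_sigma_finite "\<lambda>_::nat \<times> nat. lborel :: real measure" by (rule product_sigma_finite_lborel)
  have finJ: "finite J" using J by (rule finite_subset) simp
  have finI: "finite (sym_idx p)" by (auto simp: sym_idx_def intro: finite_subset[of _ "{..p} \<times> {..p}"])
  interpret L: sigma_finite_measure "sym_lebesgue p"
    unfolding sym_lebesgue_def by (rule lb.sigma_finite[OF finI])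
  interpret Mu: sigma_finite_measure "PiM J \<mu>" by (rule sigma_finite[OF finJ])
  interpret pair_sigma_finite "sym_lebesgue p" "PiM J \<mu>" ..
  have cS: "\<Sigma> \<in> carrier_mat p p" using S by (simp add: pd_mat_def)
  note H = pd_mat_minv(1)[OF S]
  have sets_mu: "sets (\<mu> i) = sets (sym_space (ps i))" if "i \<in> J" for i
    using rep[OF that] by (simp add: cm_rep_def)
  define h where "h f t = (if pd_mat p (sym_of p f) then ennreal (wishart_dens p \<alpha> \<Sigma> (sym_of p f)) *
      ennreal (exp (- mtrace (blk_sym ps d J t * sym_of p f))) else 0)" for f t
  have mf: "(\<lambda>z. fst z (i, j)) \<in> borel_measurable (sym_lebesgue p \<Otimes>\<^sub>M PiM J \<mu>)" if "i \<le> j" "j < p" for i j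
    by (rule measurable_compose[OF measurable_fst])
      (use that in \<open>auto simp: sym_lebesgue_def sym_idx_def intro!: measurable_component_lborel\<close>)
  have mt: "(\<lambda>t. t i (a, b)) \<in> borel_measurable (PiM J \<mu>)" if "i \<in> J" "a \<le> b" "b < ps i" for i a b
    by (rule measurable_compose[OF measurable_component_singleton[of i J \<mu>, OF that(1)]
          borel_measurable_component_sym_space[OF sets_mu[OF that(1)] that(2,3)]])
  have mt2: "(\<lambda>z. snd z i (a, b)) \<in> borel_measurable (sym_lebesgue p \<Otimes>\<^sub>M PiM J \<mu>)" if "i \<in> J" "a \<le> b" "b < ps i" for i a b
    by (rule measurable_compose[OF measurable_snd mt[OF that]])
  \<comment> \<open>Joint measurability for Fubini: the integrand is built from determinants and
    traces, with no matrix square root, and the definiteness test is handled by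
    \<open>pred_pd_mat_sym_of\<close>.\<close>
  have mh: "case_prod h \<in> borel_measurable (sym_lebesgue p \<Otimes>\<^sub>M PiM J \<mu>)"
  proof -
    let ?N = "sym_lebesgue p \<Otimes>\<^sub>M PiM J \<mu>"
    have [measurable]: "Measurable.pred ?N (\<lambda>z. pd_mat p (sym_of p (fst z)))"
      by (rule pred_pd_mat_sym_of) (rule mf)
    have [measurable]: "(\<lambda>z. det (sym_of p (fst z))) \<in> borel_measurable ?N"
      by (intro borel_measurable_det[of _ p] borel_measurable_sym_of_index[of p] mf) auto
    have [measurable]: "(\<lambda>z. mtrace (minv p \<Sigma> * sym_of p (fst z))) \<in> borel_measurable ?N"
      by (intro borel_measurable_mtrace_mult[of _ p p] borel_measurable_sym_of_index[of p] mf) (auto simp: H)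
    have [measurable]: "(\<lambda>z. mtrace (blk_sym ps d J (snd z) * sym_of p (fst z))) \<in> borel_measurable ?N"
    proof (rule borel_measurable_mtrace_mult[of _ p p])
      show "(\<lambda>z. blk_sym ps d J (snd z) $$ (i, j)) \<in> borel_measurable ?N" if "i < p" "j < p" for i j
        using that unfolding p by (intro borel_measurable_blk_sym_index mt2[unfolded p])
      show "(\<lambda>z. sym_of p (fst z) $$ (i, j)) \<in> borel_measurable ?N" if "i < p" "j < p" for i j
        using that by (intro borel_measurable_sym_of_index[of p] mf)
    qed (auto simp: p)
    show ?thesis unfolding case_prod_beta' h_def wishart_dens_def by measurable
  qed
  have "wishart_expect p \<alpha> \<Sigma> (\<lambda>X. ennreal (\<Prod>i\<in>J. \<phi> i (blk ps X i i))) =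
      (\<integral>\<^sup>+f. \<integral>\<^sup>+t. h f t \<partial>PiM J \<mu> \<partial>sym_lebesgue p)"
    unfolding wishart_expect_def
  proof (rule nn_integral_cong)
    fix f assume f: "f \<in> space (sym_lebesgue p)"
    let ?X = "sym_of p f"
    show "(if pd_mat p ?X then ennreal (wishart_dens p \<alpha> \<Sigma> ?X) * ennreal (\<Prod>i\<in>J. \<phi> i (blk ps ?X i i)) else 0) =
        (\<integral>\<^sup>+t. h f t \<partial>PiM J \<mu>)"
    proof (cases "pd_mat p ?X")
      case True
      have pdb: "pd_mat (ps i) (blk ps ?X i i)" if "i \<in> J" for i
        using True that J unfolding p by (intro pd_mat_blk[of ps d]) auto
      have "ennreal (\<Prod>i\<in>J. \<phi> i (blk ps ?X i i)) = (\<Prod>i\<in>J. ennreal (\<phi> i (blk ps ?X i i)))"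
        using nonneg pdb by (intro prod_ennreal[symmetric]) auto
      also have "\<dots> = (\<Prod>i\<in>J. \<integral>\<^sup>+x. ennreal (exp (- mtrace (blk ps ?X i i * sym_of (ps i) x))) \<partial>\<mu> i)"
        using rep pdb by (intro prod.cong refl) (simp add: cm_rep_def)
      also have "\<dots> = (\<integral>\<^sup>+t. (\<Prod>i\<in>J. ennreal (exp (- mtrace (blk ps ?X i i * sym_of (ps i) (t i))))) \<partial>PiM J \<mu>)"
      proof (rule product_nn_integral_prod[OF finJ, symmetric])
        fix i assume i: "i \<in> J"
        show "(\<lambda>x. ennreal (exp (- mtrace (blk ps ?X i i * sym_of (ps i) x)))) \<in> borel_measurable (\<mu> i)"
          by (intro measurable_compose[OF _ measurable_ennreal] measurable_compose[OF _ borel_measurable_exp]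
              borel_measurable_uminus borel_measurable_mtrace_mult[of _ "ps i" "ps i"]
              borel_measurable_sym_of_index[of "ps i"] borel_measurable_component_sym_space[OF sets_mu[OF i]])
            (auto simp: blk_def)
      qed
      \<comment> \<open>The exponentials multiply, and the block traces add up to tr (T X) for the
        block diagonal T.\<close>
      also have "\<dots> = (\<integral>\<^sup>+t. ennreal (exp (- mtrace (blk_sym ps d J t * ?X))) \<partial>PiM J \<mu>)"
        using mtrace_blk_sym_mult[OF _ J, of ?X ps]
        by (intro nn_integral_cong) (simp add: p prod_ennreal exp_sum[OF finJ] sum_negf[symmetric] del: sum_negf)
      finally have "ennreal (\<Prod>i\<in>J. \<phi> i (blk ps ?X i i)) =
          (\<integral>\<^sup>+t. ennreal (exp (- mtrace (blk_sym ps d J t * ?X))) \<partial>PiM J \<mu>)" .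
      moreover have "(\<lambda>t. ennreal (exp (- mtrace (blk_sym ps d J t * ?X)))) \<in> borel_measurable (PiM J \<mu>)"
        unfolding p
        by (intro measurable_compose[OF _ measurable_ennreal] measurable_compose[OF _ borel_measurable_exp]
            borel_measurable_uminus borel_measurable_mtrace_mult[of _ "blk_off ps (Suc d)" "blk_off ps (Suc d)"]
            borel_measurable_blk_sym_index mt) auto
      ultimately show ?thesis using True by (simp add: h_def nn_integral_cmult)
    qed (simp add: h_def)
  qed
  also have "\<dots> = (\<integral>\<^sup>+t. \<integral>\<^sup>+f. h f t \<partial>sym_lebesgue p \<partial>PiM J \<mu>)"
    by (rule Fubini'[OF mh, symmetric])
  also have "\<dots> = (\<integral>\<^sup>+t. ennreal (det (1\<^sub>m p + 2 \<cdot>\<^sub>m (blk_sym ps d J t * \<Sigma>)) powr (- (\<alpha> / 2))) \<partial>PiM J \<mu>)"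
  \<comment> \<open>\<open>wishart_expect_etr\<close> requires a nonnegative definite matrix, and
    the representing measures guarantee this only almost everywhere.\<close>
  proof (rule nn_integral_cong_AE)
    have "AE t in PiM J \<mu>. \<forall>i\<in>J. psd_mat (ps i) (sym_of (ps i) (t i))"
      using rep by (intro AE_PiM_ball finJ) (simp add: cm_rep_def)
    then show "AE t in PiM J \<mu>. (\<integral>\<^sup>+f. h f t \<partial>sym_lebesgue p) =
        ennreal (det (1\<^sub>m p + 2 \<cdot>\<^sub>m (blk_sym ps d J t * \<Sigma>)) powr (- (\<alpha> / 2)))"
    proof eventually_elim
      case (elim t)
      then have "psd_mat p (blk_sym ps d J t)" unfolding p by (intro psd_mat_blk_sym) auto
      from wishart_expect_etr[OF S this alpha] show ?case by (simp add: wishart_expect_def h_def)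
    qed
  qed
  finally show ?thesis .
qed

section \<open>Pointwise bounds for the integrands\<close>

lemma det_one_plus_blk_sym_fischer:
  assumes S: "pd_mat (blk_off ps (Suc d)) \<Sigma>" and k: "1 \<le> k" "k \<le> d"
    and T: "\<And>i. i \<in> {1..d} \<Longrightarrow> psd_mat (ps i) (sym_of (ps i) (t i))"
  shows "det (1\<^sub>m (blk_off ps (Suc d)) + 2 \<cdot>\<^sub>m (blk_sym ps d {1..d} t * \<Sigma>)) \<le>
    det (1\<^sub>m (blk_off ps (Suc d)) + 2 \<cdot>\<^sub>m (blk_sym ps d {1..<k} t * \<Sigma>)) *
    det (1\<^sub>m (blk_off ps (Suc d)) + 2 \<cdot>\<^sub>m (blk_sym ps d {k..d} t * \<Sigma>))"
proof -
  let ?p = "blk_off ps (Suc d)"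
  define s where "s i = msqrt (ps i) (sym_of (ps i) (t i))" for i
  have s: "s i \<in> carrier_mat (ps i) (ps i)" "transpose_mat (s i) = s i" "s i * s i = sym_of (ps i) (t i)"
    if "i \<in> {1..d}" for i
    using msqrt_psd[OF T[OF that]] by (auto simp: s_def psd_mat_def)
  define R where "R J = blk_diag ps d (\<lambda>i. if i \<in> J then s i else 0\<^sub>m (ps i) (ps i))" for J
  have R: "R J \<in> carrier_mat ?p ?p" for J by (simp add: R_def)
  have RR: "R J * R J = blk_sym ps d J t" for J
  proof -
    have "R J * R J = blk_diag ps d (\<lambda>i. (if i \<in> J then s i else 0\<^sub>m (ps i) (ps i)) * (if i \<in> J then s i else 0\<^sub>m (ps i) (ps i)))"
      unfolding R_def using s by (intro blk_diag_mult) auto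
    also have "\<dots> = blk_sym ps d J t"
      unfolding blk_sym_def
      by (rule eq_mat_blkI[OF blk_diag_carrier blk_diag_carrier]) (simp add: blk_diag_index s(3) del: index_mult_mat)
    finally show ?thesis .
  qed
  have sym: "transpose_mat (R {1..d}) = R {1..d}"
    unfolding R_def using s by (intro transpose_blk_diag) auto
  \<comment> \<open>The index cut falls at the start of block \<open>k\<close>, and roots were taken
    block by block, so \<open>R\<close> vanishes across the cut.\<close>
  let ?P = "\<lambda>a. a < blk_off ps k"
  have P: "?P (blk_off ps i + a) \<longleftrightarrow> i < k" if "i \<in> {1..d}" "a < ps i" for i a
    using blk_index_less[of i k a ps] blk_off_mono[of k i ps] that by (cases "i < k") auto
  have split: "R J $$ (a, b) = (if Q a \<and> Q b then R {1..d} $$ (a, b) else 0)"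
    if ab: "a < ?p" "b < ?p" and Q: "\<And>i a. i \<in> {1..d} \<Longrightarrow> a < ps i \<Longrightarrow> Q (blk_off ps i + a) \<longleftrightarrow> i \<in> J" for a b Q J
  proof -
    obtain i a' where i: "i \<in> {1..d}" "a' < ps i" "a = blk_off ps i + a'" using ab(1) by (rule blk_index_cases)
    obtain j b' where j: "j \<in> {1..d}" "b' < ps j" "b = blk_off ps j + b'" using ab(2) by (rule blk_index_cases)
    show ?thesis using i j Q by (auto simp: R_def blk_diag_index)
  qed
  have off: "R {1..d} $$ (a, b) = 0" if ab: "a < ?p" "b < ?p" "?P a \<noteq> ?P b" for a b
  proof -
    obtain i a' where i: "i \<in> {1..d}" "a' < ps i" "a = blk_off ps i + a'" using ab(1) by (rule blk_index_cases)
    obtain j b' where j: "j \<in> {1..d}" "b' < ps j" "b = blk_off ps j + b'" using ab(2) by (rule blk_index_cases)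
    have "i \<noteq> j" using ab(3) P i j by auto
    then show ?thesis using i j by (simp add: R_def blk_diag_index)
  qed
  have cS: "\<Sigma> \<in> carrier_mat ?p ?p" using S by (simp add: pd_mat_def)
  have "det (1\<^sub>m ?p + 2 \<cdot>\<^sub>m (R {1..d} * \<Sigma> * R {1..d})) \<le>
      det (1\<^sub>m ?p + 2 \<cdot>\<^sub>m (R {1..<k} * \<Sigma> * R {1..<k})) * det (1\<^sub>m ?p + 2 \<cdot>\<^sub>m (R {k..d} * \<Sigma> * R {k..d}))"
  proof (rule det_one_plus_fischer[OF R sym S off R _ R])
    show "R {1..<k} $$ (a, b) = (if ?P a \<and> ?P b then R {1..d} $$ (a, b) else 0)" if "a < ?p" "b < ?p" for a b
      using that by (intro split) (auto simp: P)
    show "R {k..d} $$ (a, b) = (if \<not> ?P a \<and> \<not> ?P b then R {1..d} $$ (a, b) else 0)" if "a < ?p" "b < ?p" for a b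
      using that by (intro split) (auto simp: P)
  qed
  then show ?thesis by (simp only: det_one_plus_sqrt[OF R cS RR])
qed

lemma transpose_smult_mat: "transpose_mat (c \<cdot>\<^sub>m A) = c \<cdot>\<^sub>m transpose_mat A"
  by (intro eq_matI) auto

lemma smult_mult_mat_vec:
  fixes A :: "'a :: comm_semiring_0 mat"
  assumes "A \<in> carrier_mat n m" "v \<in> carrier_vec m"
  shows "(c \<cdot>\<^sub>m A) *\<^sub>v v = c \<cdot>\<^sub>v (A *\<^sub>v v)"
  using assms by (intro eq_vecI) (auto simp: scalar_prod_def sum_distrib_left mult.assoc)

text \<open>Pairing a kernel vector v with u = M v gives v^T M v + sqrt 2 (u^T S u) = 0, where the
  first term is positive and the second nonnegative. The result matters because division by zero
  yields 0, which would destroy the bounding integrand.\<close>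

lemma det_one_plus_msqrt_mult_nonzero:
  assumes T: "psd_mat n T" and M: "pd_mat n M"
  shows "det (1\<^sub>m n + sqrt 2 \<cdot>\<^sub>m (msqrt n T * M)) \<noteq> 0"
proof
  let ?S = "msqrt n T"
  note S = msqrt_psd(1)[OF T]
  have c: "?S \<in> carrier_mat n n" "M \<in> carrier_mat n n" "transpose_mat M = M"
    using S M by (auto simp: psd_mat_def pd_mat_def)
  have c': "1\<^sub>m n + sqrt 2 \<cdot>\<^sub>m (?S * M) \<in> carrier_mat n n" using c by simp
  assume "det (1\<^sub>m n + sqrt 2 \<cdot>\<^sub>m (?S * M)) = 0"
  then obtain v where v: "v \<in> carrier_vec n" "v \<noteq> 0\<^sub>v n" "(1\<^sub>m n + sqrt 2 \<cdot>\<^sub>m (?S * M)) *\<^sub>v v = 0\<^sub>v n"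
    using det_0_iff_vec_prod_zero_field[OF c'] by blast
  define u where "u = M *\<^sub>v v"
  have u: "u \<in> carrier_vec n" using c v by (simp add: u_def)
  have Su: "?S *\<^sub>v u \<in> carrier_vec n" using c u by simp
  have "(1\<^sub>m n + sqrt 2 \<cdot>\<^sub>m (?S * M)) *\<^sub>v v = v + sqrt 2 \<cdot>\<^sub>v (?S *\<^sub>v u)"
    using c v by (simp add: u_def add_mult_distrib_mat_vec[of _ n n] smult_mult_mat_vec[of _ n n] assoc_mult_mat_vec[of _ n n _ n])
  then have "v + sqrt 2 \<cdot>\<^sub>v (?S *\<^sub>v u) = 0\<^sub>v n" using v(3) by simp
  then have "u \<bullet> (v + sqrt 2 \<cdot>\<^sub>v (?S *\<^sub>v u)) = 0" using u by simp
  then have "u \<bullet> v + sqrt 2 * (u \<bullet> (?S *\<^sub>v u)) = 0"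
    using u v Su by (simp add: scalar_prod_add_distrib[of _ n])
  moreover have "0 \<le> u \<bullet> (?S *\<^sub>v u)" using S u by (simp add: psd_mat_def)
  moreover have "u \<bullet> v = v \<bullet> (M *\<^sub>v v)" using u v by (simp add: u_def comm_scalar_prod[of _ n])
  moreover have "0 < v \<bullet> (M *\<^sub>v v)" using M v by (simp add: pd_mat_def)
  ultimately show False by (smt (verit) mult_nonneg_nonneg real_sqrt_ge_zero)
qed

lemma prod_det_square_le:
  assumes M: "M \<in> carrier_mat (blk_off ps (Suc d)) (blk_off ps (Suc d))"
    and M_lower: "\<forall>i\<in>{1..d}. \<forall>j\<in>{1..d}. i < j \<longrightarrow> blk ps M i j = 0\<^sub>m (ps i) (ps j)"
    and T: "\<And>i. i \<in> {1..d} \<Longrightarrow> psd_mat (ps i) (sym_of (ps i) (t i))"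
  shows "(\<Prod>i\<in>{1..d}. (det (1\<^sub>m (ps i) + sqrt 2 \<cdot>\<^sub>m (msqrt (ps i) (sym_of (ps i) (t i)) * blk ps M i i)))\<^sup>2) \<le>
    2 ^ blk_off ps (Suc d) * det (1\<^sub>m (blk_off ps (Suc d)) + 2 \<cdot>\<^sub>m (blk_sym ps d {1..d} t * (M * transpose_mat M)))"
proof -
  let ?p = "blk_off ps (Suc d)"
  define s where "s i = msqrt (ps i) (sym_of (ps i) (t i))" for i
  have s: "s i \<in> carrier_mat (ps i) (ps i)" "transpose_mat (s i) = s i" "s i * s i = sym_of (ps i) (t i)"
    if "i \<in> {1..d}" for i
    using msqrt_psd[OF T[OF that]] by (auto simp: s_def psd_mat_def)
  define R where "R = blk_diag ps d s"
  have R: "R \<in> carrier_mat ?p ?p" by (simp add: R_def)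
  have RR: "R * R = blk_sym ps d {1..d} t"
  proof -
    have "R * R = blk_diag ps d (\<lambda>i. s i * s i)" unfolding R_def using s by (intro blk_diag_mult) auto
    also have "\<dots> = blk_sym ps d {1..d} t"
      unfolding blk_sym_def
      by (rule eq_mat_blkI[OF blk_diag_carrier blk_diag_carrier]) (simp add: blk_diag_index s(3) del: index_mult_mat)
    finally show ?thesis .
  qed
  have sym: "transpose_mat R = R" unfolding R_def using s by (intro transpose_blk_diag) auto
  \<comment> \<open>The factor sqrt 2 makes N N^T equal to 2 R (M M^T) R, the matrix of the Laplace
    transform; left multiplication by the block diagonal \<open>R\<close> preserves block
    triangularity.\<close>
  define N where "N = sqrt 2 \<cdot>\<^sub>m (R * M)"
  have RM: "R * M \<in> carrier_mat ?p ?p" using R M by simp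
  have N: "N \<in> carrier_mat ?p ?p" using RM by (simp add: N_def)
  have Nidx: "N $$ (blk_off ps i + a, blk_off ps j + b) = sqrt 2 * (\<Sum>c<ps i. s i $$ (a, c) * blk ps M i j $$ (c, b))"
    if "i \<in> {1..d}" "j \<in> {1..d}" "a < ps i" "b < ps j" for i j a b
  proof -
    have lt: "blk_off ps i + a < ?p" "blk_off ps j + b < ?p" using that by (auto intro!: blk_off_add_less)
    then have "N $$ (blk_off ps i + a, blk_off ps j + b) = sqrt 2 * (R * M) $$ (blk_off ps i + a, blk_off ps j + b)"
      using RM by (simp add: N_def del: index_mult_mat)
    also have "(R * M) $$ (blk_off ps i + a, blk_off ps j + b) =
        (\<Sum>c<ps i. s i $$ (a, c) * M $$ (blk_off ps i + c, blk_off ps j + b))"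
      unfolding R_def by (rule blk_diag_mult_index[OF M that(1,3) lt(2)])
    also have "\<dots> = (\<Sum>c<ps i. s i $$ (a, c) * blk ps M i j $$ (c, b))"
      using that by (intro sum.cong refl) (simp add: blk_def)
    finally show ?thesis .
  qed
  have "det (1\<^sub>m ?p + N) = (\<Prod>i\<in>{1..d}. det (blk ps (1\<^sub>m ?p + N) i i))"
  proof (rule det_blk_lower_triangular)
    fix i j a b assume ij: "i \<in> {1..d}" "j \<in> {1..d}" "i < j" "a < ps i" "b < ps j"
    have "blk ps M i j $$ (c, b) = 0" if "c < ps i" for c
      using M_lower ij that by simp
    then have "N $$ (blk_off ps i + a, blk_off ps j + b) = 0" using ij by (simp add: Nidx)
    moreover have "blk_off ps i + a < blk_off ps j" using ij by (intro blk_index_less) auto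
    moreover have "blk_off ps i + a < ?p" "blk_off ps j + b < ?p" using ij by (auto intro!: blk_off_add_less)
    ultimately show "(1\<^sub>m ?p + N) $$ (blk_off ps i + a, blk_off ps j + b) = 0" using N by simp
  qed (use N in simp)
  also have "\<dots> = (\<Prod>i\<in>{1..d}. det (1\<^sub>m (ps i) + sqrt 2 \<cdot>\<^sub>m (s i * blk ps M i i)))"
  proof (rule prod.cong[OF refl])
    fix i assume i: "i \<in> {1..d}"
    have cb: "blk ps M i i \<in> carrier_mat (ps i) (ps i)" by (simp add: blk_def)
    have "blk ps (1\<^sub>m ?p + N) i i = 1\<^sub>m (ps i) + sqrt 2 \<cdot>\<^sub>m (s i * blk ps M i i)"
    proof (rule eq_matI)
      fix a b assume "a < dim_row (1\<^sub>m (ps i) + sqrt 2 \<cdot>\<^sub>m (s i * blk ps M i i))"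
        "b < dim_col (1\<^sub>m (ps i) + sqrt 2 \<cdot>\<^sub>m (s i * blk ps M i i))"
      then have ab: "a < ps i" "b < ps i" using s(1)[OF i] cb by auto
      have "blk_off ps i + a < ?p" "blk_off ps i + b < ?p" using ab i by (auto intro!: blk_off_add_less)
      then have "blk ps (1\<^sub>m ?p + N) i i $$ (a, b) = (if a = b then 1 else 0) + N $$ (blk_off ps i + a, blk_off ps i + b)"
        using ab N by (simp add: blk_def)
      also have "\<dots> = (if a = b then 1 else 0) + sqrt 2 * (s i * blk ps M i i) $$ (a, b)"
        using index_mult_mat_sum[OF s(1)[OF i] cb ab] Nidx[OF i i ab] by (simp del: index_mult_mat)
      finally show "blk ps (1\<^sub>m ?p + N) i i $$ (a, b) = (1\<^sub>m (ps i) + sqrt 2 \<cdot>\<^sub>m (s i * blk ps M i i)) $$ (a, b)"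
        using ab s(1)[OF i] cb by (simp del: index_mult_mat(1))
    qed (use s(1)[OF i] cb in \<open>auto simp: blk_def\<close>)
    then show "det (blk ps (1\<^sub>m ?p + N) i i) = det (1\<^sub>m (ps i) + sqrt 2 \<cdot>\<^sub>m (s i * blk ps M i i))" by simp
  qed
  finally have dN: "det (1\<^sub>m ?p + N) = (\<Prod>i\<in>{1..d}. det (1\<^sub>m (ps i) + sqrt 2 \<cdot>\<^sub>m (s i * blk ps M i i)))" .
  have tM: "transpose_mat M \<in> carrier_mat ?p ?p" using M by simp
  have "N * transpose_mat N = 2 \<cdot>\<^sub>m (R * (M * transpose_mat M) * R)"
  proof -
    have "transpose_mat N = sqrt 2 \<cdot>\<^sub>m (transpose_mat M * R)"
      using transpose_mult[OF R M] sym RM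
      by (simp add: N_def transpose_smult_mat)
    then have "N * transpose_mat N = sqrt 2 \<cdot>\<^sub>m (sqrt 2 \<cdot>\<^sub>m (R * M * (transpose_mat M * R)))"
      using mult_smult_distrib[OF N mult_carrier_mat[OF tM R], of "sqrt 2"]
        mult_smult_assoc_mat[OF RM mult_carrier_mat[OF tM R], of "sqrt 2"] by (simp add: N_def)
    also have "\<dots> = 2 \<cdot>\<^sub>m (R * M * (transpose_mat M * R))"
      by (intro eq_matI) (auto simp: mult.assoc[symmetric] simp del: index_mult_mat(1))
    also have "R * M * (transpose_mat M * R) = R * (M * transpose_mat M) * R"
      using assoc_mult_mat[OF RM tM R] assoc_mult_mat[OF R M tM] by simp
    finally show ?thesis .
  qed
  then have "det (1\<^sub>m ?p + N * transpose_mat N) = det (1\<^sub>m ?p + 2 \<cdot>\<^sub>m (blk_sym ps d {1..d} t * (M * transpose_mat M)))"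
    using det_one_plus_sqrt[OF R mult_carrier_mat[OF M tM] RR] by simp
  then show ?thesis using det_one_plus_square_le[OF N] unfolding dN s_def by (simp add: prod_power_distrib)
qed

text \<open>Real \<open>powr\<close> sees only the absolute value of its base, so for the block
  determinants it is enough that they do not vanish; their sign never enters.\<close>

lemma powr_eq_square_powr_half:
  fixes x :: real shows "x powr a = (x\<^sup>2) powr (a / 2)"
proof (cases "x = 0")
  case False
  have "ln (x\<^sup>2) = 2 * ln x" using False by (simp add: power2_eq_square ln_mult)
  then show ?thesis using False by (simp add: powr_def)
qed simp

text \<open>Raising the squared bound to the power a/2 and distributing 2^p over the blocks, of
  sizes \<open>m i\<close> with sum \<open>p\<close>, gives each block its own constant.\<close>

lemma powr_minus_half_le_prod:
  fixes x :: "nat \<Rightarrow> real"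
  assumes fin: "finite I" and p: "p = (\<Sum>i\<in>I. m i)" and D: "0 < D" and x: "\<And>i. i \<in> I \<Longrightarrow> x i \<noteq> 0" and a: "0 \<le> a"
    and le: "(\<Prod>i\<in>I. (x i)\<^sup>2) \<le> 2 ^ p * D"
  shows "D powr (- (a / 2)) \<le> (\<Prod>i\<in>I. 2 powr (real (m i) * a / 2) / x i powr a)"
proof -
  have pos: "0 < (\<Prod>i\<in>I. (x i)\<^sup>2)" using x by (intro prod_pos) simp
  have "(\<Prod>i\<in>I. (x i)\<^sup>2) powr (a / 2) \<le> (2 ^ p * D) powr (a / 2)"
    using le a pos by (intro powr_mono2) auto
  also have "\<dots> = 2 powr (real p * a / 2) * D powr (a / 2)"
    using D by (simp add: powr_mult powr_realpow[symmetric] powr_powr)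
  finally have 1: "(\<Prod>i\<in>I. (x i)\<^sup>2) powr (a / 2) \<le> 2 powr (real p * a / 2) * D powr (a / 2)" .
  have "(\<Prod>i\<in>I. (x i)\<^sup>2) powr (a / 2) = (\<Prod>i\<in>I. x i powr a)"
    by (subst prod_powr_distrib) (auto simp: powr_eq_square_powr_half[of _ a] intro!: prod.cong)
  moreover have "2 powr (real p * a / 2) = (\<Prod>i\<in>I. 2 powr (real (m i) * a / 2))"
    using fin by (simp add: p powr_sum[symmetric] sum_distrib_right sum_divide_distrib)
  ultimately have "D powr (- (a / 2)) * (\<Prod>i\<in>I. x i powr a) \<le> (\<Prod>i\<in>I. 2 powr (real (m i) * a / 2))"
    using 1 D by (simp add: powr_minus field_simps)
  moreover have "0 < (\<Prod>i\<in>I. x i powr a)" using x by (intro prod_pos) simp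
  ultimately show ?thesis by (simp add: prod_dividef pos_le_divide_eq)
qed

text \<open>The witnesses are measures representing the \<phi>_i. Finiteness of the integrals on the
  right is a premise inside the existential, since these integrals refer to the measures.\<close>

theorem theorem3p3:
  fixes d k :: nat and ps :: "nat \<Rightarrow> nat" and p :: nat and \<alpha> :: real
    and \<Sigma> M :: "real mat" and \<phi> :: "nat \<Rightarrow> real mat \<Rightarrow> real"
  assumes ps_pos: "\<forall>i\<in>{1..d}. 1 \<le> ps i"
    and p_def: "p = (\<Sum>i\<in>{1..d}. ps i)"
    and alpha: "real p - 1 < \<alpha>"
    and Sigma: "pd_mat p \<Sigma>"
    and phi: "\<forall>i\<in>{1..d}. matrix_cm (ps i) (\<phi> i)"
    and M_carrier: "M \<in> carrier_mat p p"
    and M_lower: "\<forall>i\<in>{1..d}. \<forall>j\<in>{1..d}. i < j \<longrightarrow> blk ps M i j = 0\<^sub>m (ps i) (ps j)"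
    and M_fact: "\<Sigma> = M * transpose_mat M"
    and M_diag: "\<forall>i\<in>{1..d}. pd_mat (ps i) (blk ps M i i)"
    and k: "k \<in> {2..d}"
    and fin1: "wishart_expect p \<alpha> \<Sigma> (\<lambda>X. ennreal (\<Prod>i\<in>{1..<k}. \<phi> i (blk ps X i i))) < \<infinity>"
    and fin2: "wishart_expect p \<alpha> \<Sigma> (\<lambda>X. ennreal (\<Prod>i\<in>{k..d}. \<phi> i (blk ps X i i))) < \<infinity>"
    and fin3: "wishart_expect p \<alpha> \<Sigma> (\<lambda>X. ennreal (\<Prod>i\<in>{1..d}. \<phi> i (blk ps X i i))) < \<infinity>"
  shows "\<exists>\<mu> :: nat \<Rightarrow> (nat \<times> nat \<Rightarrow> real) measure.
    (\<forall>i\<in>{1..d}. cm_rep (ps i) (\<phi> i) (\<mu> i)) \<and>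
    wishart_expect p \<alpha> \<Sigma> (\<lambda>X. ennreal (\<Prod>i\<in>{1..<k}. \<phi> i (blk ps X i i))) *
    wishart_expect p \<alpha> \<Sigma> (\<lambda>X. ennreal (\<Prod>i\<in>{k..d}. \<phi> i (blk ps X i i)))
      \<le> wishart_expect p \<alpha> \<Sigma> (\<lambda>X. ennreal (\<Prod>i\<in>{1..d}. \<phi> i (blk ps X i i))) \<and>
    ((\<forall>i\<in>{1..d}. (\<integral>\<^sup>+ T. ennreal (2 powr (real (ps i) * \<alpha> / 2) /
          det (1\<^sub>m (ps i) + sqrt 2 \<cdot>\<^sub>m (msqrt (ps i) (sym_of (ps i) T) * blk ps M i i)) powr \<alpha>)
        \<partial>\<mu> i) < \<infinity>) \<longrightarrow>
     wishart_expect p \<alpha> \<Sigma> (\<lambda>X. ennreal (\<Prod>i\<in>{1..d}. \<phi> i (blk ps X i i)))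
      \<le> (\<Prod>i\<in>{1..d}. \<integral>\<^sup>+ T. ennreal (2 powr (real (ps i) * \<alpha> / 2) /
          det (1\<^sub>m (ps i) + sqrt 2 \<cdot>\<^sub>m (msqrt (ps i) (sym_of (ps i) T) * blk ps M i i)) powr \<alpha>)
        \<partial>\<mu> i))"
proof -
  have p: "p = blk_off ps (Suc d)"
    by (simp add: p_def blk_off_def atLeastLessThanSuc_atLeastAtMost)
  have cS: "\<Sigma> \<in> carrier_mat p p" using Sigma by (simp add: pd_mat_def)
  \<comment> \<open>The range of \<open>k\<close> forces at least two blocks, hence p \<ge> 1. A
    nonnegative \<alpha> fixes the direction in which powers reverse or preserve
    inequalities.\<close>
  have a0: "0 \<le> \<alpha>"
  proof -
    have "(\<Sum>i\<in>{1..d}. 1) \<le> (\<Sum>i\<in>{1..d}. ps i)" using ps_pos by (intro sum_mono) auto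
    then have "1 \<le> p" using k by (simp add: p_def)
    then show ?thesis using alpha by simp
  qed
  have "\<forall>i\<in>{1..d}. \<exists>\<nu>. cm_rep (ps i) (\<phi> i) \<nu>" using phi by (auto simp: matrix_cm_def)
  then obtain \<nu> where \<nu>: "\<And>i. i \<in> {1..d} \<Longrightarrow> cm_rep (ps i) (\<phi> i) (\<nu> i)" by metis
  \<comment> \<open>\<open>product_sigma_finite\<close> speaks of all indices, so the empty counting
    measure fills the places outside the blocks.\<close>
  define \<mu> where "\<mu> i = (if i \<in> {1..d} then \<nu> i else count_space {})" for i
  have rep: "cm_rep (ps i) (\<phi> i) (\<mu> i)" if "i \<in> {1..d}" for i using \<nu>[OF that] that by (simp add: \<mu>_def)
  have psf: "product_sigma_finite \<mu>"
  proof (rule product_sigma_finite.intro)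
    show "sigma_finite_measure (\<mu> i)" for i
      using cm_rep_sigma_finite[OF \<nu>, of i] sigma_finite_measure_count_space_finite[of "{}"] by (auto simp: \<mu>_def)
  qed
  interpret product_sigma_finite \<mu> by (rule psf)
  have AE_psd: "AE x in \<mu> i. psd_mat (ps i) (sym_of (ps i) x)" if "i \<in> {1..d}" for i
    using rep[OF that] by (simp add: cm_rep_def)
  define G where "G J t = ennreal (det (1\<^sub>m p + 2 \<cdot>\<^sub>m (blk_sym ps d J t * \<Sigma>)) powr (- (\<alpha> / 2)))" for J t
  have E: "wishart_expect p \<alpha> \<Sigma> (\<lambda>X. ennreal (\<Prod>i\<in>J. \<phi> i (blk ps X i i))) = integral\<^sup>N (PiM J \<mu>) (G J)"
    if J: "J \<subseteq> {1..d}" for J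
    unfolding G_def using phi J rep
    by (intro wishart_expect_prod_cm[OF p Sigma alpha J psf]) (auto simp: matrix_cm_def)
  have mG: "G J \<in> borel_measurable (PiM J \<mu>)" if J: "J \<subseteq> {1..d}" for J
  proof -
    have mt: "(\<lambda>t. t i (a, b)) \<in> borel_measurable (PiM J \<mu>)" if i: "i \<in> J" and ab: "a \<le> b" "b < ps i" for i a b
    proof -
      have "sets (\<mu> i) = sets (sym_space (ps i))" using rep[of i] i J by (auto simp: cm_rep_def)
      from measurable_compose[OF measurable_component_singleton[of i J \<mu>, OF i]
          borel_measurable_component_sym_space[OF this ab]] show ?thesis .
    qed
    have "(\<lambda>t. det (1\<^sub>m p + 2 \<cdot>\<^sub>m (blk_sym ps d J t * \<Sigma>))) \<in> borel_measurable (PiM J \<mu>)"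
      unfolding p using cS[unfolded p] by (intro borel_measurable_det_one_plus_blk_sym mt)
    then show ?thesis unfolding G_def by measurable
  qed
  have lower: "integral\<^sup>N (PiM {1..<k} \<mu>) (G {1..<k}) * integral\<^sup>N (PiM {k..d} \<mu>) (G {k..d}) \<le>
      integral\<^sup>N (PiM {1..d} \<mu>) (G {1..d})"
  proof -
    have un: "{1..<k} \<union> {k..d} = {1..d}" and disj: "{1..<k} \<inter> {k..d} = {}"
      and sub: "{1..<k} \<subseteq> {1..d}" "{k..d} \<subseteq> {1..d}" using k by auto
    have "integral\<^sup>N (PiM {1..<k} \<mu>) (G {1..<k}) * integral\<^sup>N (PiM {k..d} \<mu>) (G {k..d}) =
        (\<integral>\<^sup>+x. G {1..<k} x * integral\<^sup>N (PiM {k..d} \<mu>) (G {k..d}) \<partial>PiM {1..<k} \<mu>)"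
      using mG[OF sub(1)] by (simp add: nn_integral_multc)
    also have "\<dots> = (\<integral>\<^sup>+x. \<integral>\<^sup>+y. G {1..<k} x * G {k..d} y \<partial>PiM {k..d} \<mu> \<partial>PiM {1..<k} \<mu>)"
      using mG[OF sub(2)] by (simp add: nn_integral_cmult)
    \<comment> \<open>Fischer's inequality holds at almost every pair (x, y): the merged point
      carries all blocks, and its restrictions to the two groups give the two factors.\<close>
    also have "\<dots> \<le> (\<integral>\<^sup>+x. \<integral>\<^sup>+y. G {1..d} (merge {1..<k} {k..d} (x, y)) \<partial>PiM {k..d} \<mu> \<partial>PiM {1..<k} \<mu>)"
    proof -
      have AE1: "AE x in PiM {1..<k} \<mu>. \<forall>i\<in>{1..<k}. psd_mat (ps i) (sym_of (ps i) (x i))"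
        using sub by (intro AE_PiM_ball AE_psd) auto
      have AE2: "AE x in PiM {k..d} \<mu>. \<forall>i\<in>{k..d}. psd_mat (ps i) (sym_of (ps i) (x i))"
        using sub by (intro AE_PiM_ball AE_psd) auto
      have le: "G {1..<k} x * G {k..d} y \<le> G {1..d} (merge {1..<k} {k..d} (x, y))"
        if x: "\<forall>i\<in>{1..<k}. psd_mat (ps i) (sym_of (ps i) (x i))"
          and y: "\<forall>i\<in>{k..d}. psd_mat (ps i) (sym_of (ps i) (y i))" for x y
      proof -
        let ?z = "merge {1..<k} {k..d} (x, y)"
        have zx: "?z i = x i" if "i \<in> {1..<k}" for i using that by (simp add: merge_def)
        have zy: "?z i = y i" if "i \<in> {k..d}" for i using that by (auto simp: merge_def)
        have T: "psd_mat (ps i) (sym_of (ps i) (?z i))" if "i \<in> {1..d}" for i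
          using x y zx[of i] zy[of i] that by (cases "i < k") auto
        have b1: "blk_sym ps d {1..<k} x = blk_sym ps d {1..<k} ?z"
          unfolding blk_sym_def by (rule arg_cong[where f = "blk_diag ps d"]) (auto simp: zx fun_eq_iff simp del: One_nat_def)
        have b2: "blk_sym ps d {k..d} y = blk_sym ps d {k..d} ?z"
          unfolding blk_sym_def by (rule arg_cong[where f = "blk_diag ps d"]) (auto simp: zy fun_eq_iff simp del: One_nat_def)
        let ?D = "\<lambda>J. det (1\<^sub>m p + 2 \<cdot>\<^sub>m (blk_sym ps d J ?z * \<Sigma>))"
        have pos: "0 < ?D J" if "J \<subseteq> {1..d}" for J
          using T that Sigma unfolding p by (intro det_one_plus_pos psd_mat_blk_sym) auto
        have "?D {1..d} \<le> ?D {1..<k} * ?D {k..d}"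
          unfolding p using Sigma k T by (intro det_one_plus_blk_sym_fischer) (auto simp: p)
        \<comment> \<open>The exponent is nonpositive, so the upper bound on the full determinant
          becomes a lower bound on its power.\<close>
        then have "(?D {1..<k} * ?D {k..d}) powr (- (\<alpha> / 2)) \<le> ?D {1..d} powr (- (\<alpha> / 2))"
          using pos[of "{1..d}"] a0 by (intro powr_mono2') auto
        then have "?D {1..<k} powr (- (\<alpha> / 2)) * ?D {k..d} powr (- (\<alpha> / 2)) \<le> ?D {1..d} powr (- (\<alpha> / 2))"
          using pos[OF sub(1)] pos[OF sub(2)] by (simp add: powr_mult)
        then show ?thesis unfolding G_def b1 b2 by (simp add: ennreal_mult'[symmetric] ennreal_leI)
      qed
      have "AE x in PiM {1..<k} \<mu>. (\<integral>\<^sup>+y. G {1..<k} x * G {k..d} y \<partial>PiM {k..d} \<mu>) \<le>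
          (\<integral>\<^sup>+y. G {1..d} (merge {1..<k} {k..d} (x, y)) \<partial>PiM {k..d} \<mu>)"
        using AE1
      proof eventually_elim
        case (elim x)
        have "AE y in PiM {k..d} \<mu>. G {1..<k} x * G {k..d} y \<le> G {1..d} (merge {1..<k} {k..d} (x, y))"
          using AE2 by eventually_elim (rule le[OF elim])
        then show ?case by (rule nn_integral_mono_AE)
      qed
      then show ?thesis by (rule nn_integral_mono_AE)
    qed
    also have "\<dots> = integral\<^sup>N (PiM {1..d} \<mu>) (G {1..d})"
      using product_nn_integral_fold[OF disj, of "G {1..d}"] mG[of "{1..d}"] unfolding un by simp
    finally show ?thesis .
  qed
  let ?g = "\<lambda>i T. 2 powr (real (ps i) * \<alpha> / 2) /
          det (1\<^sub>m (ps i) + sqrt 2 \<cdot>\<^sub>m (msqrt (ps i) (sym_of (ps i) T) * blk ps M i i)) powr \<alpha>"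
  have upper: "integral\<^sup>N (PiM {1..d} \<mu>) (G {1..d}) \<le> (\<Prod>i\<in>{1..d}. \<integral>\<^sup>+T. ennreal (?g i T) \<partial>\<mu> i)"
    if fin: "\<forall>i\<in>{1..d}. (\<integral>\<^sup>+T. ennreal (?g i T) \<partial>\<mu> i) < \<infinity>"
  proof -
    \<comment> \<open>The factor 1 is the initial value of the constant that collects frozen factors
      in \<open>nn_integral_PiM_le_prod\<close>.\<close>
    have "integral\<^sup>N (PiM {1..d} \<mu>) (G {1..d}) \<le> 1 * (\<Prod>i\<in>{1..d}. \<integral>\<^sup>+T. ennreal (?g i T) \<partial>\<mu> i)"
    proof (rule nn_integral_PiM_le_prod[where P = "\<lambda>i x. psd_mat (ps i) (sym_of (ps i) x)"])
      fix t assume t: "\<And>i. i \<in> {1..d} \<Longrightarrow> psd_mat (ps i) (sym_of (ps i) (t i))"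
      let ?D = "det (1\<^sub>m p + 2 \<cdot>\<^sub>m (blk_sym ps d {1..d} t * \<Sigma>))"
      have "?D powr (- (\<alpha> / 2)) \<le> (\<Prod>i\<in>{1..d}. ?g i (t i))"
      proof (rule powr_minus_half_le_prod)
        show "0 < ?D" using t Sigma unfolding p by (intro det_one_plus_pos psd_mat_blk_sym) auto
        show "(\<Prod>i\<in>{1..d}. (det (1\<^sub>m (ps i) + sqrt 2 \<cdot>\<^sub>m (msqrt (ps i) (sym_of (ps i) (t i)) * blk ps M i i)))\<^sup>2) \<le> 2 ^ p * ?D"
          unfolding M_fact p by (rule prod_det_square_le[OF M_carrier[unfolded p] M_lower t])
        show "det (1\<^sub>m (ps i) + sqrt 2 \<cdot>\<^sub>m (msqrt (ps i) (sym_of (ps i) (t i)) * blk ps M i i)) \<noteq> 0"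
          if "i \<in> {1..d}" for i
          using t[OF that] M_diag that by (intro det_one_plus_msqrt_mult_nonzero) auto
      qed (use p_def a0 in auto)
      then have "G {1..d} t \<le> ennreal (\<Prod>i\<in>{1..d}. ?g i (t i))" unfolding G_def by (rule ennreal_leI)
      then show "G {1..d} t \<le> 1 * (\<Prod>i\<in>{1..d}. ennreal (?g i (t i)))" by (simp add: prod_ennreal)
    qed (use fin mG AE_psd in auto)
    then show ?thesis by simp
  qed
  have sub: "{1..<k} \<subseteq> {1..d}" "{k..d} \<subseteq> {1..d}" using k by auto
  show ?thesis
    unfolding E[OF sub(1)] E[OF sub(2)] E[OF subset_refl] using rep lower upper by blast
qed

end
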